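(* Let $1\le m\le k\le n-m$ and $f\in L^1(V_{n,m})$. If $\mathrm{Re}\,\alpha>m-1$, then $$\mathcal C^{*,\alpha}_{m,k}F_{m,k}f=F^*_{m,k}\,\mathcal C^\alpha_{m,k}f=c_\alpha\,Q^{\alpha+n-k-m}f,\qquad c_\alpha=\frac{\Gamma_m((n-m)/2)\,\Gamma_m(\alpha/2)}{\Gamma_m(k/2)\,\Gamma_m((\alpha+n-m-k)/2)}.$$ If $\mathrm{Re}\,\alpha>k-1$, then $$\mathcal C^{*,\alpha}_{m,k}F_{m,k}f=F^*_{m,k}\,\mathcal C^\alpha_{m,k}f=\tilde c_\alpha\,M^{\alpha+m-k}F_{m}f,\qquad \tilde c_\alpha=\frac{\Gamma_m(m/2)\,\Gamma_m(\alpha/2)}{\Gamma_m(k/2)\,\Gamma_m((\alpha+m-k)/2)}.$$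
   Context: $V_{n,m}=\{v\in M_{n,m}(\mathbb R): v'v=I_m\}$ is the Stiefel manifold, with $O(n)$-invariant probability measure $d_*v$ (and $L^1$ with respect to it). For a square matrix $a$, $|a|=|\det a|$. $\Gamma_m(\alpha)=\pi^{m(m-1)/4}\prod_{j=0}^{m-1}\Gamma(\alpha-j/2)$. Equalities between integrable functions are understood almost everywhere. Funk transform and its dual ($k+m\le n$): $$(F_{m,k}f)(u)=\int_{V_{n-k,m}} f\Big(g_u\begin{bmatrix}\omega\\ 0\end{bmatrix}\Big)d_*\omega,\quad u\in V_{n,k};\qquad (F^*_{m,k}\varphi)(v)=\int_{V_{n-m,k}}\varphi\Big(g_v\begin{bmatrix}\theta\\ 0\end{bmatrix}\Big)d_*\theta,\quad v\in V_{n,m},$$ where $g_u,g_v\in O(n)$ are any matrices with $g_u\begin{bmatrix}0\\ I_k\end{bmatrix}=u$, $g_v\begin{bmatrix}0\\ I_m\end{bmatrix}=v$. $F_m=F_{m,m}$. Cosine and sine transforms: $$(\mathcal C^\alpha_{m,k}f)(u)=\int_{V_{n,m}}f(v)|v'uu'v|^{(\alpha-k)/2}d_*v,\qquad (\mathcal C^{*,\alpha}_{m,k}\varphi)(v)=\int_{V_{n,k}}\varphi(u)|v'uu'v|^{(\alpha-k)/2}d_*u,$$ and, for $u\in V_{n,m}$, $$(M^\alpha f)(u)=\int_{V_{n,m}}f(v)|v'uu'v|^{(\alpha-m)/2}d_*v,\qquad (Q^\alpha f)(u)=\int_{V_{n,m}}f(v)|I_m-v'uu'v|^{(\alpha+m-n)/2}d_*v.$$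 *)

theory Defs
  imports "HOL-Probability.Probability" "Jordan_Normal_Form.Determinant"
begin

text \<open>Matrices are those of \<^theory>\<open>Jordan_Normal_Form.Matrix\<close>, whose dimensions are natural numbers:
  the blocks of sizes \<open>n - k\<close> and \<open>n - m\<close> below could not be indexed by types.\<close>

definition stiefel :: "nat \<Rightarrow> nat \<Rightarrow> real mat set" where
  "stiefel n m = {v \<in> carrier_mat n m. transpose_mat v * v = 1\<^sub>m m}"

definition orthogonal_group :: "nat \<Rightarrow> real mat set" where
  "orthogonal_group n = {g \<in> carrier_mat n n. transpose_mat g * g = 1\<^sub>m n}"

text \<open>The type of matrices carries no topology. The Borel sigma-algebra of \<open>stiefel n m\<close> is the one
  pulled back from \<open>\<real>\<^bsup>n \<times> m\<^esup>\<close> along the map that sends a matrix to its family of entries.\<close>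

definition stiefel_borel :: "nat \<Rightarrow> nat \<Rightarrow> real mat measure" where
  "stiefel_borel n m =
     vimage_algebra (stiefel n m) (\<lambda>v. \<lambda>ij\<in>{..<n} \<times> {..<m}. v $$ ij)
       (\<Pi>\<^sub>M ij\<in>{..<n} \<times> {..<m}. (borel :: real measure))"

text \<open>For \<open>m \<le> n\<close> there is exactly one measure with these properties.\<close>

definition stiefel_measure :: "nat \<Rightarrow> nat \<Rightarrow> real mat measure" where
  "stiefel_measure n m =
     (THE \<mu>. sets \<mu> = sets (stiefel_borel n m) \<and> prob_space \<mu> \<and>
             (\<forall>g\<in>orthogonal_group n. distr \<mu> \<mu> (\<lambda>v. g * v) = \<mu>))"

text \<open>A choice of \<open>g\<^sub>u\<close>. By the invariance of \<open>stiefel_measure\<close>, the integrals in \<open>funk\<close> and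
  \<open>dual_funk\<close> do not depend on it: two choices differ by a right factor \<open>diag(h, I)\<close> with
  orthogonal \<open>h\<close>.\<close>

definition frame_completion :: "nat \<Rightarrow> nat \<Rightarrow> real mat \<Rightarrow> real mat" where
  "frame_completion n k u =
     (SOME g. g \<in> orthogonal_group n \<and> g * (0\<^sub>m (n - k) k @\<^sub>r 1\<^sub>m k) = u)"

definition funk :: "nat \<Rightarrow> nat \<Rightarrow> nat \<Rightarrow> (real mat \<Rightarrow> complex) \<Rightarrow> real mat \<Rightarrow> complex" where
  "funk n m k f u =
     (LINT \<omega>|stiefel_measure (n - k) m. f (frame_completion n k u * (\<omega> @\<^sub>r 0\<^sub>m k m)))"

definition dual_funk :: "nat \<Rightarrow> nat \<Rightarrow> nat \<Rightarrow> (real mat \<Rightarrow> complex) \<Rightarrow> real mat \<Rightarrow> complex" where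
  "dual_funk n m k \<phi> v =
     (LINT \<theta>|stiefel_measure (n - m) k. \<phi> (frame_completion n m v * (\<theta> @\<^sub>r 0\<^sub>m m k)))"

text \<open>\<open>|a| = |det a|\<close>, in the base of a complex power. The determinant has to be qualified because
  HOL-Analysis has a constant of the same name.\<close>

definition absdet :: "real mat \<Rightarrow> complex" where
  "absdet a = complex_of_real \<bar>Determinant.det a\<bar>"

definition cosine_transform ::
    "nat \<Rightarrow> nat \<Rightarrow> nat \<Rightarrow> complex \<Rightarrow> (real mat \<Rightarrow> complex) \<Rightarrow> real mat \<Rightarrow> complex" where
  "cosine_transform n m k \<alpha> f u =
     (LINT v|stiefel_measure n m.
        f v * absdet (transpose_mat v * u * transpose_mat u * v) powr ((\<alpha> - of_nat k) / 2))"

definition dual_cosine_transform ::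
    "nat \<Rightarrow> nat \<Rightarrow> nat \<Rightarrow> complex \<Rightarrow> (real mat \<Rightarrow> complex) \<Rightarrow> real mat \<Rightarrow> complex" where
  "dual_cosine_transform n m k \<alpha> \<phi> v =
     (LINT u|stiefel_measure n k.
        \<phi> u * absdet (transpose_mat v * u * transpose_mat u * v) powr ((\<alpha> - of_nat k) / 2))"

definition M_transform ::
    "nat \<Rightarrow> nat \<Rightarrow> complex \<Rightarrow> (real mat \<Rightarrow> complex) \<Rightarrow> real mat \<Rightarrow> complex" where
  "M_transform n m \<alpha> f u =
     (LINT v|stiefel_measure n m.
        f v * absdet (transpose_mat v * u * transpose_mat u * v) powr ((\<alpha> - of_nat m) / 2))"

definition Q_transform ::
    "nat \<Rightarrow> nat \<Rightarrow> complex \<Rightarrow> (real mat \<Rightarrow> complex) \<Rightarrow> real mat \<Rightarrow> complex" where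
  "Q_transform n m \<alpha> f u =
     (LINT v|stiefel_measure n m.
        f v * absdet (1\<^sub>m m - transpose_mat v * u * transpose_mat u * v)
          powr ((\<alpha> + of_nat m - of_nat n) / 2))"

definition Gamma_m :: "nat \<Rightarrow> complex \<Rightarrow> complex" where
  "Gamma_m m \<alpha> =
     complex_of_real (pi powr (real m * (real m - 1) / 4)) * (\<Prod>j<m. Gamma (\<alpha> - of_nat j / 2))"

text \<open>Equality of integrable functions. The integrability is stated because Isabelle's integral is
  total, so that an equation between divergent integrals may hold vacuously.\<close>

definition eq_L1 :: "'a measure \<Rightarrow> ('a \<Rightarrow> complex) \<Rightarrow> ('a \<Rightarrow> complex) \<Rightarrow> bool" where
  "eq_L1 M f g \<longleftrightarrow> integrable M f \<and> integrable M g \<and> (AE x in M. f x = g x)"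

end

theory Submission
  imports Defs
begin

text \<open>
  Let \<open>s = (\<alpha> - k)/2\<close>. Each of \<open>F\<^sup>* C f\<close>, \<open>C\<^sup>* F f\<close> and \<open>Q f\<close> is, at \<open>v\<close>, an integral of \<open>f w\<close> against a kernel in \<open>v\<close>
  and \<open>w\<close>, and the first formula holds because the kernels agree up to the constant.

  For \<open>F\<^sup>* C\<close> the kernel is \<open>K(v, w) = E |w' p p' w|\<^sup>s\<close>, where \<open>p\<close> is a uniformly distributed \<open>k\<close>-frame in
  the orthogonal complement of \<open>v\<close>. Let \<open>A\<close> be the matrix of the component of \<open>w\<close> in that complement, in
  an orthonormal basis of it; it has \<open>n - m\<close> rows. Then \<open>|w' p p' w| = |A' \<theta> \<theta>' A|\<close> with \<open>\<theta>\<close>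
  uniform on \<open>V\<^bsub>n-m,k\<^esub>\<close>, and \<open>|A' A| = |I - w' v v' w|\<close>. Write \<open>A = Q R\<close> with an \<open>m\<close>-frame \<open>Q\<close> and a square
  \<open>R\<close>: the factor \<open>|R|\<^sup>2 = |A' A|\<close> comes out, and by invariance the remaining expectation does not
  depend on \<open>Q\<close>. So \<open>K(v, w) = c |I - w' v v' w|\<^sup>s\<close>, where \<open>c\<close> is a moment of the determinant of a block of
  a uniform frame (\<open>stiefel_projection_moment\<close>, \<open>complement_moment\<close>). This is the kernel of \<open>c Q\<close>.

  For \<open>C\<^sup>* F\<close>, the pair \<open>(w, u)\<close> of mutually orthogonal frames can be drawn in either order: first \<open>u\<close> and
  then \<open>w\<close> in its complement, as in \<open>C\<^sup>* F\<close>, or first \<open>w\<close> and then \<open>u\<close>. Both laws are the image of Haar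
  measure on \<open>O(n)\<close> (\<open>frame_pair_law_swap\<close>). In the second order the kernel is \<open>K(w, v)\<close>, and
  \<open>|I - v' w w' v| = |I - w' v v' w|\<close>.

  The constant is found with Gaussian matrices. If \<open>X\<close> is an \<open>n\<close> by \<open>m\<close> standard Gaussian matrix, a
  rotation of its last column onto a coordinate axis splits \<open>|X' X|\<close> into independent factors that are
  chi-square distributed with \<open>n\<close>, \<open>n - 1\<close>, ... degrees of freedom (\<open>gauss_gram_det_law\<close>), which gives
  \<open>E |X' X|\<^sup>s\<close> as a product of quotients of Gamma values. If \<open>a\<close> is a \<open>k\<close>-frame, then \<open>a' X\<close> is again Gaussian, and
  \<open>|X' a a' X|\<close> has the law of \<open>|X' X|\<close> times an independent \<open>|v' a a' v|\<close> with uniform \<open>v\<close>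
  (\<open>gauss_gram_det_frame_law\<close>). So the moment of the second factor is a quotient of Gaussian moments.

  The second formula of the theorem is the first one, with \<open>m\<close> in place of \<open>k\<close> and \<open>\<alpha> + m - k\<close> in place of \<open>\<alpha>\<close>,
  read backwards: the exponent \<open>s\<close> is the same, so both sides are multiples of the same \<open>Q f\<close>.

  Everything rests on invariant measures. Lebesgue measure on the space of matrices is, up to a factor, the only translation
  invariant measure and is therefore preserved by orthogonal maps, hence so is the Gaussian measure.
  Normalizing a Gaussian vector gives the measure on the sphere, and adding one column at a time gives all
  Stiefel manifolds (\<open>invariant_measure_extend\<close>). Uniqueness follows by averaging over \<open>O(n)\<close>
  (\<open>invariant_eq_haar\<close>). The matrix \<open>g\<^sub>u\<close> in the definition of the Funk transform is an arbitrary choice; a product of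
  reflections (\<open>frame_section\<close>) is another one whose entries are measurable in \<open>u\<close>, which makes the Funk
  transform of a measurable function measurable.
\<close>

section \<open>Matrix algebra\<close>

text \<open>Dimensions are kept as equations: membership in \<open>carrier_mat\<close> is rewritten into them, and the rules
  below have them as premises. In this form associativity and distributivity are rewrite rules that
  require no dimension to be named. The dimension \<open>1\<close> has to remain \<open>1\<close>, because it occurs as an argument of the frames
  below.\<close>

declare One_nat_def [simp del] carrier_matD [simp del] mult_carrier_mat [simp del] row_mult [simp del] col_mult [simp del]

lemma carrier_mat_iff [simp]: "A \<in> carrier_mat n m \<longleftrightarrow> dim_row A = n \<and> dim_col A = m"
  by (auto simp: carrier_mat_def)

lemma mat_assoc:
  fixes A B C :: "real mat"
  shows "dim_col A = dim_row B \<Longrightarrow> dim_col B = dim_row C \<Longrightarrow> A * B * C = A * (B * C)"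
  by (rule assoc_mult_mat[of _ "dim_row A" "dim_col A" _ "dim_col B" _ "dim_col C"]) auto

lemma mat_transpose_mult:
  fixes A B :: "real mat"
  shows "dim_col A = dim_row B \<Longrightarrow> (A * B)\<^sup>T = B\<^sup>T * A\<^sup>T"
  by (rule transpose_mult[of _ "dim_row A" "dim_col A" _ "dim_col B"]) auto

lemma mat_one_left: "dim_row A = n \<Longrightarrow> 1\<^sub>m n * A = (A :: real mat)"
  by (rule left_mult_one_mat[of _ _ "dim_col A"]) auto

lemma mat_one_right: "dim_col A = n \<Longrightarrow> A * 1\<^sub>m n = (A :: real mat)"
  by (rule right_mult_one_mat[of _ "dim_row A"]) auto

lemma mat_zero_left: "dim_row A = n \<Longrightarrow> 0\<^sub>m k n * A = 0\<^sub>m k (dim_col (A :: real mat))"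
  by (rule left_mult_zero_mat[of _ _ "dim_col A"]) auto

lemma mat_zero_right: "dim_col A = n \<Longrightarrow> A * 0\<^sub>m n k = 0\<^sub>m (dim_row (A :: real mat)) k"
  by (rule right_mult_zero_mat[of _ "dim_row A"]) auto

lemma mat_distrib_left:
  fixes A B C :: "real mat"
  shows "dim_col A = dim_row B \<Longrightarrow> dim_row C = dim_row B \<Longrightarrow> dim_col C = dim_col B \<Longrightarrow>
    A * (B + C) = A * B + A * C"
  by (rule mult_add_distrib_mat[of _ "dim_row A" "dim_col A" _ "dim_col B"]) auto

lemma mat_distrib_right:
  fixes A B C :: "real mat"
  shows "dim_row B = dim_row A \<Longrightarrow> dim_col B = dim_col A \<Longrightarrow> dim_col A = dim_row C \<Longrightarrow>
    (A + B) * C = A * C + B * C"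
  by (rule add_mult_distrib_mat[of _ "dim_row A" "dim_col A" _ _ "dim_col C"]) auto

lemma mat_diff_distrib_left:
  fixes A B C :: "real mat"
  shows "dim_col A = dim_row B \<Longrightarrow> dim_row C = dim_row B \<Longrightarrow> dim_col C = dim_col B \<Longrightarrow>
    A * (B - C) = A * B - A * C"
  by (rule mult_minus_distrib_mat[of _ "dim_row A" "dim_col A" _ "dim_col B"]) auto

lemma mat_diff_distrib_right:
  fixes A B C :: "real mat"
  shows "dim_row B = dim_row A \<Longrightarrow> dim_col B = dim_col A \<Longrightarrow> dim_col A = dim_row C \<Longrightarrow>
    (A - B) * C = A * C - B * C"
  by (rule minus_mult_distrib_mat[of _ "dim_row A" "dim_col A" _ _ "dim_col C"]) auto

lemma mat_smult_left: "dim_col A = dim_row B \<Longrightarrow> (c \<cdot>\<^sub>m A) * B = c \<cdot>\<^sub>m (A * B :: real mat)"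
  by (rule mult_smult_assoc_mat[of _ "dim_row A" "dim_col A" _ "dim_col B"]) auto

lemma mat_smult_right: "dim_col A = dim_row B \<Longrightarrow> A * (c \<cdot>\<^sub>m B) = c \<cdot>\<^sub>m (A * B :: real mat)"
  by (rule mult_smult_distrib[of _ "dim_row A" "dim_col A" _ "dim_col B"]) auto

lemma smult_zero_mat_left: "0 \<cdot>\<^sub>m A = 0\<^sub>m (dim_row A) (dim_col (A :: real mat))"
  by (intro eq_matI) auto

lemma mat_smult_smult: "a \<cdot>\<^sub>m (b \<cdot>\<^sub>m A) = (a * b) \<cdot>\<^sub>m (A :: real mat)"
  by (intro eq_matI) auto

lemma mat_transpose_smult: "(a \<cdot>\<^sub>m A)\<^sup>T = a \<cdot>\<^sub>m (A\<^sup>T :: real mat)"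
  by (intro eq_matI) auto

lemmas mat_algebra = mat_assoc mat_transpose_mult mat_one_left mat_one_right mat_zero_left
  mat_zero_right mat_distrib_left mat_distrib_right mat_diff_distrib_left mat_diff_distrib_right
  mat_smult_left mat_smult_right

text \<open>Products are associated to the right, so an equation for \<open>A * B\<close> applies to \<open>A * (B * X)\<close> only in
  this form.\<close>

lemma mult_eq_cancel:
  fixes A B C :: "real mat"
  assumes "A * B = C" "dim_col A = dim_row B" "dim_col B = dim_row X"
  shows "A * (B * X) = C * X"
  using assms mat_assoc[of A B X] by simp

text \<open>The diagonal entries of the Gram matrix are the squared norms of the columns.\<close>

lemma gram_zero_imp_zero:
  fixes X :: "real mat"
  assumes "X\<^sup>T * X = 0\<^sub>m (dim_col X) (dim_col X)"
  shows "X = 0\<^sub>m (dim_row X) (dim_col X)"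
proof (rule eq_matI; simp)
  fix i j assume ij: "i < dim_row X" "j < dim_col X"
  have "(X\<^sup>T * X) $$ (j,j) = (\<Sum>l<dim_row X. (X $$ (l,j))\<^sup>2)"
    using ij by (simp add: scalar_prod_def lessThan_atLeast0 power2_eq_square)
  then have "(\<Sum>l<dim_row X. (X $$ (l,j))\<^sup>2) = 0"
    using ij by (simp add: assms)
  then show "X $$ (i,j) = 0"
    using ij by (subst (asm) sum_nonneg_eq_0_iff) auto
qed

lemma stiefelD:
  assumes "v \<in> stiefel n m"
  shows "v \<in> carrier_mat n m" "v\<^sup>T * v = 1\<^sub>m m" "dim_row v = n" "dim_col v = m"
  using assms by (auto simp: stiefel_def)

lemma stiefelI: "v \<in> carrier_mat n m \<Longrightarrow> v\<^sup>T * v = 1\<^sub>m m \<Longrightarrow> v \<in> stiefel n m"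
  by (auto simp: stiefel_def)

lemma stiefel_square: "stiefel n n = orthogonal_group n"
  by (auto simp: stiefel_def orthogonal_group_def)

lemma orthogonalD:
  assumes "g \<in> orthogonal_group n"
  shows "g \<in> carrier_mat n n" "g\<^sup>T * g = 1\<^sub>m n" "g * g\<^sup>T = 1\<^sub>m n" "dim_row g = n" "dim_col g = n"
  using assms mat_mult_left_right_inverse[of "g\<^sup>T" n g] by (auto simp: orthogonal_group_def)

lemma orthogonal_cancel:
  assumes "g \<in> orthogonal_group n" "dim_row X = n"
  shows "g\<^sup>T * (g * X) = X" "g * (g\<^sup>T * X) = X"
  using mult_eq_cancel[OF orthogonalD(2)[OF assms(1)], of X]
    mult_eq_cancel[OF orthogonalD(3)[OF assms(1)], of X] orthogonalD[OF assms(1)] assms(2)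
  by (simp_all add: mat_algebra)

lemma orthogonal_one: "1\<^sub>m n \<in> orthogonal_group n"
  by (simp add: orthogonal_group_def)

lemma orthogonal_transpose:
  assumes "g \<in> orthogonal_group n"
  shows "g\<^sup>T \<in> orthogonal_group n"
  using orthogonalD[OF assms] by (simp add: orthogonal_group_def)

lemma orthogonal_mult_stiefel:
  assumes "g \<in> orthogonal_group n" "v \<in> stiefel n m"
  shows "g * v \<in> stiefel n m"
  using orthogonalD[OF assms(1)] stiefelD[OF assms(2)] orthogonal_cancel[OF assms(1), of v]
  by (intro stiefelI) (auto simp: mat_algebra)

lemma orthogonal_mult:
  "g \<in> orthogonal_group n \<Longrightarrow> h \<in> orthogonal_group n \<Longrightarrow> g * h \<in> orthogonal_group n"
  using orthogonal_mult_stiefel[of g n h n] by (simp add: stiefel_square)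

lemma stiefel_mult:
  assumes "v \<in> stiefel n m" "w \<in> stiefel m k"
  shows "v * w \<in> stiefel n k"
  using stiefelD[OF assms(1)] stiefelD[OF assms(2)] mult_eq_cancel[OF stiefelD(2)[OF assms(1)], of w]
  by (intro stiefelI) (auto simp: mat_algebra)

section \<open>Coordinate frames and their stabilizers\<close>

text \<open>These are the matrices \<open>[0; I]\<close> and \<open>[I; 0]\<close> of the context. Since \<open>[w; 0]\<close> is a product with
  \<open>first_frame\<close>, all block matrices with a zero block turn into products.\<close>

definition last_frame :: "nat \<Rightarrow> nat \<Rightarrow> real mat" where
  "last_frame n k = 0\<^sub>m (n - k) k @\<^sub>r 1\<^sub>m k"

definition first_frame :: "nat \<Rightarrow> nat \<Rightarrow> real mat" where
  "first_frame n m = 1\<^sub>m m @\<^sub>r 0\<^sub>m (n - m) m"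

lemma append_rows_index:
  assumes "i < dim_row A + dim_row B" "j < dim_col A" "dim_col B = dim_col A"
  shows "(A @\<^sub>r B) $$ (i,j) = (if i < dim_row A then A $$ (i,j) else B $$ (i - dim_row A, j))"
  using assms by (simp add: append_rows_def)

lemma append_rows_dim [simp]:
  "dim_row (A @\<^sub>r B) = dim_row A + dim_row B" "dim_col (A @\<^sub>r B) = dim_col A"
  by (simp_all add: append_rows_def)

lemma last_frame_index:
  "k \<le> n \<Longrightarrow> i < n \<Longrightarrow> j < k \<Longrightarrow> last_frame n k $$ (i,j) = (if i = n - k + j then 1 else 0)"
  unfolding last_frame_def by (subst append_rows_index) auto

lemma first_frame_index:
  "m \<le> n \<Longrightarrow> i < n \<Longrightarrow> j < m \<Longrightarrow> first_frame n m $$ (i,j) = (if i = j then 1 else 0)"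
  unfolding first_frame_def by (subst append_rows_index) auto

lemma last_frame_dim [simp]:
  "k \<le> n \<Longrightarrow> dim_row (last_frame n k) = n" "dim_col (last_frame n k) = k"
  by (auto simp: last_frame_def)

lemma first_frame_dim [simp]:
  "m \<le> n \<Longrightarrow> dim_row (first_frame n m) = n" "dim_col (first_frame n m) = m"
  by (auto simp: first_frame_def)

lemma mult_last_frame_index:
  assumes "k \<le> n" "dim_col A = n" "i < dim_row A" "j < k"
  shows "(A * last_frame n k) $$ (i,j) = A $$ (i, n - k + j)"
proof -
  have "(A * last_frame n k) $$ (i,j) = (\<Sum>l<n. A $$ (i,l) * (if l = n - k + j then 1 else 0))"
    using assms by (simp add: scalar_prod_def lessThan_atLeast0 last_frame_index)
  also have "\<dots> = (\<Sum>l<n. if l = n - k + j then A $$ (i,l) else 0)"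
    by (intro sum.cong) auto
  also have "\<dots> = A $$ (i, n - k + j)"
    using assms by simp
  finally show ?thesis .
qed

lemma mult_first_frame_index:
  assumes "m \<le> n" "dim_col A = n" "i < dim_row A" "j < m"
  shows "(A * first_frame n m) $$ (i,j) = A $$ (i, j)"
proof -
  have "(A * first_frame n m) $$ (i,j) = (\<Sum>l<n. A $$ (i,l) * (if l = j then 1 else 0))"
    using assms by (simp add: scalar_prod_def lessThan_atLeast0 first_frame_index)
  also have "\<dots> = (\<Sum>l<n. if l = j then A $$ (i,l) else 0)"
    by (intro sum.cong) auto
  also have "\<dots> = A $$ (i, j)"
    using assms by simp
  finally show ?thesis .
qed

lemma last_frame_stiefel: "k \<le> n \<Longrightarrow> last_frame n k \<in> stiefel n k"
  by (intro stiefelI carrier_matI eq_matI) (auto simp: mult_last_frame_index last_frame_index simp del: index_mult_mat(1))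

lemma first_frame_stiefel: "m \<le> n \<Longrightarrow> first_frame n m \<in> stiefel n m"
  by (intro stiefelI carrier_matI eq_matI) (auto simp: mult_first_frame_index first_frame_index simp del: index_mult_mat(1))

lemma first_last_orthogonal:
  "k + m \<le> n \<Longrightarrow> (first_frame n m)\<^sup>T * last_frame n k = 0\<^sub>m m k"
  by (intro eq_matI) (auto simp: mult_last_frame_index first_frame_index simp del: index_mult_mat(1))

lemma last_first_orthogonal:
  "k + m \<le> n \<Longrightarrow> (last_frame n k)\<^sup>T * first_frame n m = 0\<^sub>m k m"
  by (intro eq_matI) (auto simp: mult_first_frame_index last_frame_index simp del: index_mult_mat(1))

lemma frames_complete:
  assumes "k \<le> n"
  shows "first_frame n (n - k) * (first_frame n (n - k))\<^sup>T + last_frame n k * (last_frame n k)\<^sup>T = 1\<^sub>m n"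
    (is "?F * ?F\<^sup>T + ?E * ?E\<^sup>T = _")
proof (rule eq_matI)
  fix i j assume ij: "i < dim_row (1\<^sub>m n :: real mat)" "j < dim_col (1\<^sub>m n :: real mat)"
  have "(?F * ?F\<^sup>T) $$ (i,j) = (\<Sum>l<n-k. ?F $$ (i,l) * ?F $$ (j,l))"
    using ij assms by (simp add: scalar_prod_def lessThan_atLeast0)
  also have "\<dots> = (\<Sum>l<n-k. if l = i \<and> i = j then 1 else 0)"
    using ij assms by (intro sum.cong) (auto simp: first_frame_index)
  also have "\<dots> = (if i = j \<and> i < n - k then 1 else 0)"
    by (cases "i = j") auto
  finally have 1: "(?F * ?F\<^sup>T) $$ (i,j) = (if i = j \<and> i < n - k then 1 else 0)" .
  have "(?E * ?E\<^sup>T) $$ (i,j) = (\<Sum>l<k. ?E $$ (i,l) * ?E $$ (j,l))"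
    using ij assms by (simp add: scalar_prod_def lessThan_atLeast0)
  also have "\<dots> = (\<Sum>l<k. if l = i - (n-k) then (if i = j \<and> n-k \<le> i then 1 else 0) else 0)"
    using ij assms by (intro sum.cong) (auto simp: last_frame_index)
  also have "\<dots> = (if i = j \<and> n - k \<le> i then 1 else 0)"
    using ij assms by auto
  finally have 2: "(?E * ?E\<^sup>T) $$ (i,j) = (if i = j \<and> n - k \<le> i then 1 else 0)" .
  show "(?F * ?F\<^sup>T + ?E * ?E\<^sup>T) $$ (i,j) = 1\<^sub>m n $$ (i,j)"
    using ij assms 1 2 by auto
qed (use assms in auto)

lemma append_zero_rows:
  assumes "w \<in> carrier_mat m k" "m + l = n"
  shows "w @\<^sub>r 0\<^sub>m l k = first_frame n m * w"
proof (rule eq_matI)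
  fix i j assume ij: "i < dim_row (first_frame n m * w)" "j < dim_col (first_frame n m * w)"
  have "(first_frame n m * w) $$ (i,j) = (\<Sum>l<m. (if i = l then 1 else 0) * w $$ (l,j))"
    using ij assms by (auto simp: scalar_prod_def lessThan_atLeast0 first_frame_index intro!: sum.cong)
  also have "\<dots> = (\<Sum>l<m. if l = i then w $$ (l,j) else 0)"
    by (intro sum.cong) auto
  also have "\<dots> = (if i < m then w $$ (i,j) else 0)"
    by simp
  finally show "(w @\<^sub>r 0\<^sub>m l k) $$ (i,j) = (first_frame n m * w) $$ (i,j)"
    using ij assms by (auto simp: append_rows_index)
qed (use assms in auto)

text \<open>This is the statement \<open>g = diag(h, I)\<close>. If \<open>g\<close> fixes the last basis vectors then so does \<open>g'\<close>, so the
  last rows of \<open>g\<close> vanish on the first basis vectors, and \<open>h\<close> is the remaining block.\<close>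

lemma last_frame_stabilizer:
  assumes k: "k \<le> n" and g: "g \<in> orthogonal_group n" "g * last_frame n k = last_frame n k"
  obtains h where "h \<in> orthogonal_group (n - k)"
    "g * first_frame n (n - k) = first_frame n (n - k) * h"
proof
  let ?F = "first_frame n (n - k)" and ?E = "last_frame n k"
  note gD = orthogonalD[OF g(1)]
  note F = stiefelD[OF first_frame_stiefel[of "n-k" n]]
  have gE: "g\<^sup>T * ?E = ?E"
    using orthogonal_cancel(1)[OF g(1), of ?E] g k by simp
  have "?E\<^sup>T * (g * ?F) = (g\<^sup>T * ?E)\<^sup>T * ?F"
    using k gD by (simp add: mat_algebra)
  then have 0: "?E\<^sup>T * (g * ?F) = 0\<^sub>m k (n - k)"
    using k by (simp add: gE last_first_orthogonal)
  have EE: "?E * (?E\<^sup>T * (g * ?F)) = 0\<^sub>m n (n - k)"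
    using k by (simp add: 0 mat_zero_right)
  have "g * ?F = (?F * ?F\<^sup>T + ?E * ?E\<^sup>T) * (g * ?F)"
    unfolding frames_complete[OF k] using k gD by (simp add: mat_one_left)
  also have "\<dots> = ?F * (?F\<^sup>T * (g * ?F)) + ?E * (?E\<^sup>T * (g * ?F))"
    using k gD by (simp add: mat_distrib_right mat_assoc)
  also have "\<dots> = ?F * (?F\<^sup>T * (g * ?F))"
    unfolding EE using k by (intro right_add_zero_mat[of _ n "n - k"]) auto
  finally have eq: "?F * (?F\<^sup>T * (g * ?F)) = g * ?F"
    by (rule sym)
  show "g * ?F = ?F * (?F\<^sup>T * (g * ?F))"
    by (rule eq[symmetric])
  show "?F\<^sup>T * (g * ?F) \<in> orthogonal_group (n - k)"
    (is "?h \<in> _")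
  proof -
    have "?h\<^sup>T * ?h = ?F\<^sup>T * (g\<^sup>T * (?F * (?F\<^sup>T * (g * ?F))))"
      using k gD by (simp add: mat_transpose_mult mat_assoc)
    also have "\<dots> = ?F\<^sup>T * ?F"
      unfolding eq using k by (subst orthogonal_cancel(1)[OF g(1)]) simp_all
    also have "\<dots> = 1\<^sub>m (n - k)"
      by (rule F(2)) simp
    finally show ?thesis
      using k by (simp add: orthogonal_group_def)
  qed
qed

section \<open>A measurable completion of a frame\<close>

text \<open>The reflection that exchanges two vectors \<open>x\<close> and \<open>y\<close> of equal norm. For \<open>x = y\<close> the coefficient is
  \<open>2 / 0 = 0\<close>, so the matrix is the identity and still sends \<open>x\<close> to \<open>y\<close>.\<close>

definition refl_mat :: "real mat \<Rightarrow> real mat \<Rightarrow> real mat" where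
  "refl_mat x y = 1\<^sub>m (dim_row x) -
     (2 / ((x - y)\<^sup>T * (x - y)) $$ (0,0)) \<cdot>\<^sub>m ((x - y) * (x - y)\<^sup>T)"

lemma mat_1x1: "dim_row A = 1 \<Longrightarrow> dim_col A = 1 \<Longrightarrow> A = (A $$ (0,0)) \<cdot>\<^sub>m (1\<^sub>m 1 :: real mat)"
  by (intro eq_matI) auto

lemma refl_mat_dim:
  assumes "x \<in> carrier_mat n 1" "y \<in> carrier_mat n 1"
  shows "refl_mat x y \<in> carrier_mat n n" "dim_row (refl_mat x y) = n" "dim_col (refl_mat x y) = n"
  using assms by (auto simp: refl_mat_def)

lemma refl_mat_mult:
  assumes "x \<in> carrier_mat n 1" "y \<in> carrier_mat n 1" "z \<in> carrier_mat n 1"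
  shows "refl_mat x y * z = z - (2 / ((x - y)\<^sup>T * (x - y)) $$ (0,0) * ((x - y)\<^sup>T * z) $$ (0,0)) \<cdot>\<^sub>m (x - y)"
proof -
  define d where "d = x - y"
  define c where "c = 2 / (d\<^sup>T * d) $$ (0,0)"
  define t where "t = (d\<^sup>T * z) $$ (0,0)"
  have d: "dim_row d = n" "dim_col d = 1" and z: "dim_row z = n" "dim_col z = 1"
    using assms by (auto simp: d_def)
  have "d\<^sup>T * z = t \<cdot>\<^sub>m 1\<^sub>m 1"
    unfolding t_def using d z by (intro mat_1x1) auto
  then have "d * (d\<^sup>T * z) = t \<cdot>\<^sub>m d"
    using d by (simp add: mat_smult_right mat_one_right)
  then have "(1\<^sub>m n - c \<cdot>\<^sub>m (d * d\<^sup>T)) * z = z - (c * t) \<cdot>\<^sub>m d"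
    using d z by (simp add: mat_diff_distrib_right mat_smult_left mat_assoc mat_one_left mat_smult_smult)
  then show ?thesis
    using assms(1) unfolding refl_mat_def c_def t_def d_def by simp
qed

lemma refl_mat_fix:
  assumes "x \<in> carrier_mat n 1" "y \<in> carrier_mat n 1" "z \<in> carrier_mat n 1"
    "x\<^sup>T * z = y\<^sup>T * z"
  shows "refl_mat x y * z = z"
proof -
  have "(x - y)\<^sup>T * z = x\<^sup>T * z - y\<^sup>T * z"
    using assms(1-3) by (simp add: transpose_minus[of _ n 1] mat_diff_distrib_right)
  also have "\<dots> = 0\<^sub>m 1 1"
    unfolding assms(4) using assms(2,3) by (intro eq_matI) auto
  finally have "(x - y)\<^sup>T * z = 0\<^sub>m 1 1" .
  then have "((x - y)\<^sup>T * z) $$ (0,0) = 0"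
    by (simp only: index_zero_mat(1) zero_less_one)
  then have "refl_mat x y * z = z - (2 / ((x - y)\<^sup>T * (x - y)) $$ (0,0) * 0) \<cdot>\<^sub>m (x - y)"
    by (simp only: refl_mat_mult[OF assms(1-3)])
  also have "\<dots> = z"
    using assms(1-3) by (intro eq_matI) simp_all
  finally show ?thesis .
qed

lemma refl_mat_swap:
  assumes xy: "x \<in> carrier_mat n 1" "y \<in> carrier_mat n 1" and eq: "x\<^sup>T * x = y\<^sup>T * y"
  shows "refl_mat x y * x = y"
proof (cases "((x - y)\<^sup>T * (x - y)) $$ (0,0) = 0")
  case True
  have "(x - y)\<^sup>T * (x - y) = (((x - y)\<^sup>T * (x - y)) $$ (0,0)) \<cdot>\<^sub>m 1\<^sub>m 1"
    using xy by (intro mat_1x1) auto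
  also have "\<dots> = 0\<^sub>m (dim_col (x - y)) (dim_col (x - y))"
    unfolding True using xy by (simp add: smult_zero_mat_left)
  finally have zero: "x - y = 0\<^sub>m (dim_row (x - y)) (dim_col (x - y))"
    by (rule gram_zero_imp_zero)
  have "x = y"
  proof (rule eq_matI)
    fix i j assume ij: "i < dim_row y" "j < dim_col y"
    have "x $$ (i,j) - y $$ (i,j) = (x - y) $$ (i,j)"
      using ij xy by simp
    also have "\<dots> = 0"
      using ij xy by (subst zero) simp
    finally show "x $$ (i,j) = y $$ (i,j)"
      by simp
  qed (use xy in auto)
  with refl_mat_fix[OF xy xy(2)] show ?thesis
    by blast
next
  case False
  have "x\<^sup>T * y = y\<^sup>T * x"
    using xy by (intro eq_matI) (auto simp: scalar_prod_def mult.commute)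
  then have "(x - y)\<^sup>T * (x - y) = 2 \<cdot>\<^sub>m ((x - y)\<^sup>T * x)"
    using xy eq[symmetric]
    by (auto simp: transpose_minus[of _ n 1] mat_diff_distrib_right mat_diff_distrib_left simp del: index_mult_mat(1) intro!: eq_matI)
  then have "((x - y)\<^sup>T * (x - y)) $$ (0,0) = 2 * ((x - y)\<^sup>T * x) $$ (0,0)"
    using xy by (simp del: index_mult_mat(1))
  then have "2 / ((x - y)\<^sup>T * (x - y)) $$ (0,0) * ((x - y)\<^sup>T * x) $$ (0,0) = 1"
    using False by (simp del: index_mult_mat(1))
  then have "refl_mat x y * x = x - 1 \<cdot>\<^sub>m (x - y)"
    by (simp only: refl_mat_mult[OF xy xy(1)])
  also have "\<dots> = y"
    using xy by (intro eq_matI) auto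
  finally show ?thesis .
qed

lemma refl_mat_orthogonal:
  assumes xy: "x \<in> carrier_mat n 1" "y \<in> carrier_mat n 1"
  shows "refl_mat x y \<in> orthogonal_group n"
proof -
  define d where "d = x - y"
  define c where "c = (d\<^sup>T * d) $$ (0,0)"
  define P where "P = (2 / c) \<cdot>\<^sub>m (d * d\<^sup>T)"
  have d: "dim_row d = n" "dim_col d = 1"
    using xy by (auto simp: d_def)
  have dd: "d\<^sup>T * d = c \<cdot>\<^sub>m 1\<^sub>m 1"
    unfolding c_def using d by (intro mat_1x1) auto
  have "(d * d\<^sup>T) * (d * d\<^sup>T) = d * ((d\<^sup>T * d) * d\<^sup>T)"
    using d by (simp add: mat_assoc)
  also have "\<dots> = c \<cdot>\<^sub>m (d * d\<^sup>T)"
    unfolding dd using d by (simp add: mat_algebra)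
  finally have PP: "P * P = 2 \<cdot>\<^sub>m P"
    using d unfolding P_def by (simp add: mat_smult_left mat_smult_right mat_smult_smult)
  have P: "dim_row P = n" "dim_col P = n"
    using d by (auto simp: P_def)
  have R: "refl_mat x y = 1\<^sub>m n - P"
    using xy by (simp add: refl_mat_def P_def c_def d_def)
  have T: "(refl_mat x y)\<^sup>T = refl_mat x y"
    using xy by (intro eq_matI) (auto simp: refl_mat_def scalar_prod_def mult.commute)
  have "refl_mat x y * refl_mat x y = 1\<^sub>m n - P - (P - P * P)"
    unfolding R using P
    by (simp add: mat_diff_distrib_left mat_diff_distrib_right mat_one_left mat_one_right)
  also have "\<dots> = 1\<^sub>m n"
    unfolding PP using P by (intro eq_matI) auto
  finally show ?thesis
    using T refl_mat_dim[OF xy] by (auto simp: orthogonal_group_def)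
qed

definition col_mat :: "real mat \<Rightarrow> nat \<Rightarrow> real mat" where
  "col_mat A j = Matrix.mat (dim_row A) 1 (\<lambda>(i,_). A $$ (i,j))"

lemma col_mat_dim [simp]: "dim_row (col_mat A j) = dim_row A" "dim_col (col_mat A j) = 1"
  by (auto simp: col_mat_def)

lemma col_mat_index: "i < dim_row A \<Longrightarrow> col_mat A j $$ (i,0) = A $$ (i,j)"
  by (simp add: col_mat_def)

lemma col_mat_mult: "dim_col A = dim_row B \<Longrightarrow> j < dim_col B \<Longrightarrow> col_mat (A * B) j = A * col_mat B j"
  by (intro eq_matI) (auto simp: col_mat_def scalar_prod_def intro!: sum.cong)

lemma gram_col_mat:
  assumes "i < dim_col A" "j < dim_col A"
  shows "(col_mat A i)\<^sup>T * col_mat A j = ((A\<^sup>T * A) $$ (i,j)) \<cdot>\<^sub>m 1\<^sub>m 1"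
  using assms by (intro eq_matI) (auto simp: col_mat_def scalar_prod_def intro!: sum.cong)

text \<open>Step \<open>j\<close> reflects the present image of the basis vector with index \<open>n - k + j\<close> to column \<open>j\<close> of \<open>u\<close>. The columns reached
  before are orthogonal to both vectors and so stay where they are.\<close>

primrec section_aux :: "nat \<Rightarrow> nat \<Rightarrow> real mat \<Rightarrow> nat \<Rightarrow> real mat" where
  "section_aux n k u 0 = 1\<^sub>m n"
| "section_aux n k u (Suc j) =
     refl_mat (col_mat (section_aux n k u j) (n - k + j)) (col_mat u j) * section_aux n k u j"

text \<open>A completion of \<open>u\<close> to an orthogonal matrix, given by a formula so that it is measurable in \<open>u\<close>.\<close>

definition frame_section :: "nat \<Rightarrow> nat \<Rightarrow> real mat \<Rightarrow> real mat" where
  "frame_section n k u = section_aux n k u k"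

lemma section_aux:
  assumes u: "u \<in> stiefel n k" and k: "k \<le> n"
  shows "j \<le> k \<Longrightarrow> section_aux n k u j \<in> orthogonal_group n \<and>
    (\<forall>i<j. col_mat (section_aux n k u j) (n - k + i) = col_mat u i)"
proof (induction j)
  case 0
  then show ?case by (simp add: orthogonal_one)
next
  case (Suc j)
  let ?g = "section_aux n k u j"
  let ?x = "col_mat ?g (n - k + j)" and ?y = "col_mat u j"
  have g: "?g \<in> orthogonal_group n" and IH: "\<And>i. i < j \<Longrightarrow> col_mat ?g (n - k + i) = col_mat u i"
    using Suc by auto
  note gD = orthogonalD[OF g] and uD = stiefelD[OF u]
  have xy: "?x \<in> carrier_mat n 1" "?y \<in> carrier_mat n 1"
    using gD uD by auto
  have eq: "?x\<^sup>T * ?x = ?y\<^sup>T * ?y"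
    using gD uD Suc.prems k by (simp add: gram_col_mat)
  have "col_mat (refl_mat ?x ?y * ?g) (n - k + i) = col_mat u i" if i: "i < Suc j" for i
  proof (cases "i = j")
    case True
    then show ?thesis
      using refl_mat_swap[OF xy eq] refl_mat_dim[OF xy] gD Suc.prems k by (simp add: col_mat_mult)
  next
    case False
    then have i: "i < j" using i by simp
    have "?x\<^sup>T * col_mat ?g (n - k + i) = 0\<^sub>m 1 1"
      using gD Suc.prems k i by (subst gram_col_mat) (auto intro!: eq_matI)
    then have "?x\<^sup>T * col_mat u i = 0\<^sub>m 1 1"
      unfolding IH[OF i] .
    moreover have "?y\<^sup>T * col_mat u i = 0\<^sub>m 1 1"
      using uD Suc.prems k i by (subst gram_col_mat) (auto intro!: eq_matI)
    ultimately have "?x\<^sup>T * col_mat u i = ?y\<^sup>T * col_mat u i"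
      by (rule trans[OF _ sym])
    moreover have "col_mat u i \<in> carrier_mat n 1"
      using uD by auto
    ultimately have "refl_mat ?x ?y * col_mat u i = col_mat u i"
      by (intro refl_mat_fix[OF xy])
    then show ?thesis
      using IH[OF i] refl_mat_dim[OF xy] gD Suc.prems k i by (simp add: col_mat_mult)
  qed
  then show ?case
    using orthogonal_mult[OF refl_mat_orthogonal[OF xy] g] by simp
qed

lemma frame_section:
  assumes u: "u \<in> stiefel n k" and k: "k \<le> n"
  shows "frame_section n k u \<in> orthogonal_group n" "frame_section n k u * last_frame n k = u"
proof -
  note * = section_aux[OF assms order_refl]
  then show g: "frame_section n k u \<in> orthogonal_group n"
    by (simp add: frame_section_def)
  note gD = orthogonalD[OF g] and uD = stiefelD[OF u]
  show "frame_section n k u * last_frame n k = u"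
  proof (rule eq_matI)
    fix i j assume ij: "i < dim_row u" "j < dim_col u"
    then have "col_mat (frame_section n k u) (n - k + j) $$ (i,0) = col_mat u j $$ (i,0)"
      using * uD by (simp add: frame_section_def)
    then show "(frame_section n k u * last_frame n k) $$ (i,j) = u $$ (i,j)"
      using ij gD(4,5) uD(3,4) k by (simp add: mult_last_frame_index col_mat_index del: index_mult_mat(1))
  qed (use gD uD in auto)
qed

lemma frame_completion:
  assumes u: "u \<in> stiefel n k" and k: "k \<le> n"
  shows "frame_completion n k u \<in> orthogonal_group n" "frame_completion n k u * last_frame n k = u"
proof -
  have "\<exists>g. g \<in> orthogonal_group n \<and> g * (0\<^sub>m (n - k) k @\<^sub>r 1\<^sub>m k) = u"
    using frame_section[OF assms] unfolding last_frame_def by metis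
  then have *: "frame_completion n k u \<in> orthogonal_group n \<and>
      frame_completion n k u * (0\<^sub>m (n - k) k @\<^sub>r 1\<^sub>m k) = u"
    unfolding frame_completion_def by (rule someI_ex)
  show "frame_completion n k u \<in> orthogonal_group n"
    by (rule conjunct1[OF *])
  show "frame_completion n k u * last_frame n k = u"
    unfolding last_frame_def by (rule conjunct2[OF *])
qed

section \<open>Gram determinants and QR factorization\<close>

definition snoc_col :: "real mat \<Rightarrow> real mat \<Rightarrow> real mat" where
  "snoc_col Z y = Matrix.mat (dim_row Z) (Suc (dim_col Z))
     (\<lambda>(i,j). if j < dim_col Z then Z $$ (i,j) else y $$ (i,0))"

lemma snoc_col_dim [simp]: "dim_row (snoc_col Z y) = dim_row Z" "dim_col (snoc_col Z y) = Suc (dim_col Z)"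
  by (simp_all add: snoc_col_def)

lemma snoc_col_index:
  "i < dim_row Z \<Longrightarrow> j < Suc (dim_col Z) \<Longrightarrow>
    snoc_col Z y $$ (i,j) = (if j < dim_col Z then Z $$ (i,j) else y $$ (i,0))"
  by (simp add: snoc_col_def)

lemma snoc_col_cases:
  assumes "dim_row A = n" "dim_col A = Suc m"
  obtains Z y where "A = snoc_col Z y" "dim_row Z = n" "dim_col Z = m" "dim_row y = n" "dim_col y = 1"
proof
  show "A = snoc_col (Matrix.mat n m (\<lambda>ij. A $$ ij)) (col_mat A m)"
    using assms by (intro eq_matI) (auto simp: snoc_col_index col_mat_index less_Suc_eq)
qed (use assms in auto)

lemma mult_snoc_col:
  assumes "dim_col g = dim_row Z" "dim_row y = dim_row Z" "dim_col y = 1"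
  shows "g * snoc_col Z y = snoc_col (g * Z) (g * y)"
proof (rule eq_matI)
  fix i j assume ij: "i < dim_row (snoc_col (g * Z) (g * y))" "j < dim_col (snoc_col (g * Z) (g * y))"
  have "(g * snoc_col Z y) $$ (i,j) = (\<Sum>l<dim_row Z. g $$ (i,l) * snoc_col Z y $$ (l,j))"
    using ij assms by (simp add: scalar_prod_def lessThan_atLeast0)
  also have "\<dots> = snoc_col (g * Z) (g * y) $$ (i,j)"
    using ij assms by (auto simp: snoc_col_index scalar_prod_def lessThan_atLeast0)
  finally show "(g * snoc_col Z y) $$ (i,j) = snoc_col (g * Z) (g * y) $$ (i,j)" .
qed (use assms in auto)

text \<open>The product is a sum over columns, and the last column contributes \<open>b * d'\<close>.\<close>

lemma snoc_col_outer:
  assumes "dim_col A = dim_col C" "dim_row b = dim_row A" "dim_col b = 1" "dim_row d = dim_row C" "dim_col d = 1"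
  shows "snoc_col A b * (snoc_col C d)\<^sup>T = A * C\<^sup>T + b * d\<^sup>T"
proof (rule eq_matI)
  fix i j assume ij: "i < dim_row (A * C\<^sup>T + b * d\<^sup>T)" "j < dim_col (A * C\<^sup>T + b * d\<^sup>T)"
  have "(snoc_col A b * (snoc_col C d)\<^sup>T) $$ (i,j)
      = (\<Sum>l<Suc (dim_col C). snoc_col A b $$ (i,l) * snoc_col C d $$ (j,l))"
    using ij assms by (simp add: scalar_prod_def lessThan_atLeast0)
  also have "\<dots> = (\<Sum>l<dim_col C. A $$ (i,l) * C $$ (j,l)) + b $$ (i,0) * d $$ (j,0)"
    using ij assms by (simp add: snoc_col_index)
  also have "\<dots> = (A * C\<^sup>T + b * d\<^sup>T) $$ (i,j)"
    using ij assms by (simp add: scalar_prod_def lessThan_atLeast0 One_nat_def)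
  finally show "(snoc_col A b * (snoc_col C d)\<^sup>T) $$ (i,j) = (A * C\<^sup>T + b * d\<^sup>T) $$ (i,j)" .
qed (use assms in auto)

lemma snoc_col_gram:
  assumes "dim_row y = dim_row Z" "dim_col y = 1"
  shows "(snoc_col Z y)\<^sup>T * snoc_col Z y = four_block_mat (Z\<^sup>T * Z) (Z\<^sup>T * y) (y\<^sup>T * Z) (y\<^sup>T * y)"
proof (rule eq_matI)
  let ?B = "four_block_mat (Z\<^sup>T * Z) (Z\<^sup>T * y) (y\<^sup>T * Z) (y\<^sup>T * y)"
  fix i j assume ij: "i < dim_row ?B" "j < dim_col ?B"
  have "((snoc_col Z y)\<^sup>T * snoc_col Z y) $$ (i,j)
      = (\<Sum>l<dim_row Z. snoc_col Z y $$ (l,i) * snoc_col Z y $$ (l,j))"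
    using ij assms by (simp add: scalar_prod_def lessThan_atLeast0)
  also have "\<dots> = ?B $$ (i,j)"
    using ij assms
    by (cases "i < dim_col Z"; cases "j < dim_col Z")
       (auto simp: snoc_col_index scalar_prod_def lessThan_atLeast0 less_Suc_eq)
  finally show "((snoc_col Z y)\<^sup>T * snoc_col Z y) $$ (i,j) = ?B $$ (i,j)" .
qed (use assms in auto)

text \<open>For \<open>y = 0\<close> any unit vector serves, with \<open>t = 0\<close>.\<close>

lemma scaled_unit_vector:
  assumes "dim_row y = n" "dim_col y = 1" "1 \<le> n"
  obtains c t where "c \<in> stiefel n 1" "y = t \<cdot>\<^sub>m c" "t\<^sup>2 = (y\<^sup>T * y) $$ (0,0)" "t \<ge> 0"
proof (cases "(y\<^sup>T * y) $$ (0,0) = 0")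
  case True
  have "y\<^sup>T * y = ((y\<^sup>T * y) $$ (0,0)) \<cdot>\<^sub>m 1\<^sub>m 1"
    using assms by (intro mat_1x1) auto
  also have "\<dots> = 0\<^sub>m (dim_col y) (dim_col y)"
    unfolding True using assms by (simp add: smult_zero_mat_left)
  finally have zero: "y = 0\<^sub>m (dim_row y) (dim_col y)"
    by (rule gram_zero_imp_zero)
  have "y = 0 \<cdot>\<^sub>m first_frame n 1"
    by (subst zero) (use assms in \<open>simp add: smult_zero_mat_left\<close>)
  with that[OF first_frame_stiefel this] True assms show ?thesis by simp
next
  case False
  let ?s = "(y\<^sup>T * y) $$ (0,0)"
  have "?s = (\<Sum>l<n. (y $$ (l,0))\<^sup>2)"
    using assms by (simp add: scalar_prod_def lessThan_atLeast0 power2_eq_square)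
  then have s: "?s > 0"
    using False by (metis order_le_less sum_nonneg zero_le_power2)
  have "y\<^sup>T * y = ?s \<cdot>\<^sub>m 1\<^sub>m 1"
    using assms by (intro mat_1x1) auto
  then have yy: "y\<^sup>T * y = ?s \<cdot>\<^sub>m 1\<^sub>m 1" .
  have "((1 / sqrt ?s) \<cdot>\<^sub>m y)\<^sup>T * ((1 / sqrt ?s) \<cdot>\<^sub>m y) = (1 / sqrt ?s * (1 / sqrt ?s)) \<cdot>\<^sub>m (y\<^sup>T * y)"
    using assms by (simp add: mat_transpose_smult mat_smult_left mat_smult_right mat_smult_smult del: index_mult_mat(1))
  also have "\<dots> = (1 / sqrt ?s * (1 / sqrt ?s)) \<cdot>\<^sub>m (?s \<cdot>\<^sub>m 1\<^sub>m 1)"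
    by (subst yy) (rule refl)
  also have "\<dots> = 1\<^sub>m 1"
    using s by (intro eq_matI) (auto simp: field_simps simp del: index_mult_mat(1))
  finally have "(1 / sqrt ?s) \<cdot>\<^sub>m y \<in> stiefel n 1"
    using assms by (intro stiefelI) auto
  moreover have "y = sqrt ?s \<cdot>\<^sub>m ((1 / sqrt ?s) \<cdot>\<^sub>m y)"
    using s by (intro eq_matI) (auto simp del: index_mult_mat(1))
  ultimately show ?thesis
    using that[of "(1 / sqrt ?s) \<cdot>\<^sub>m y" "sqrt ?s"] s by (auto simp del: index_mult_mat(1))
qed

lemma resolve_frames:
  assumes "k \<le> n" "dim_row X = n"
  shows "first_frame n (n - k) * ((first_frame n (n - k))\<^sup>T * X) +
    last_frame n k * ((last_frame n k)\<^sup>T * X) = X"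
proof -
  have "first_frame n (n - k) * ((first_frame n (n - k))\<^sup>T * X) +
    last_frame n k * ((last_frame n k)\<^sup>T * X) =
    (first_frame n (n - k) * (first_frame n (n - k))\<^sup>T + last_frame n k * (last_frame n k)\<^sup>T) * X"
    using assms by (simp add: mat_distrib_right mat_assoc)
  then show ?thesis
    using assms by (simp add: frames_complete mat_one_left)
qed

text \<open>This is the frame \<open>[Q 0; 0 1]\<close>.\<close>

lemma embed_stiefel:
  assumes Q: "Q \<in> stiefel (n - 1) m" and n: "1 \<le> n"
  shows "snoc_col (first_frame n (n - 1) * Q) (last_frame n 1) \<in> stiefel n (Suc m)"
proof -
  let ?E = "last_frame n 1" and ?F = "first_frame n (n - 1)"
  note Qd = stiefelD(2-4)[OF Q]
  have EE: "?E\<^sup>T * ?E = 1\<^sub>m 1" and FF: "?F\<^sup>T * ?F = 1\<^sub>m (n - 1)"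
    using stiefelD(2)[OF last_frame_stiefel[OF n]] stiefelD(2)[OF first_frame_stiefel[of "n-1" n]] by auto
  have EF: "?E\<^sup>T * ?F = 0\<^sub>m 1 (n - 1)" and FE: "?F\<^sup>T * ?E = 0\<^sub>m (n - 1) 1"
    using n by (auto intro!: last_first_orthogonal first_last_orthogonal)
  have FFX: "?F\<^sup>T * (?F * Q) = Q" and EFX: "?E\<^sup>T * (?F * Q) = 0\<^sub>m 1 m"
    using Qd n mult_eq_cancel[OF FF, of Q] mult_eq_cancel[OF EF, of Q]
    by (auto simp: mat_one_left mat_zero_left)
  have "(?F * Q)\<^sup>T * ?E = 0\<^sub>m m 1"
    using Qd n by (simp add: mat_transpose_mult mat_assoc FE mat_zero_right)
  then have "(snoc_col (?F * Q) ?E)\<^sup>T * snoc_col (?F * Q) ?E = four_block_mat (1\<^sub>m m) (0\<^sub>m m 1) (0\<^sub>m 1 m) (1\<^sub>m 1)"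
    using Qd n by (simp add: snoc_col_gram mat_transpose_mult mat_assoc FFX EFX EE)
  then show ?thesis
    using Qd n four_block_one_mat[of m 1, where 'a = real] by (auto simp: stiefel_def)
qed

text \<open>A QR factorization in which the right factor \<open>Q' * A\<close> is not required to be triangular. It holds for singular \<open>A\<close> too.
  A rotation takes the last column of \<open>A\<close> to a multiple of the last basis vector; the first \<open>n - 1\<close> rows of
  the other columns are factorized by induction.\<close>

lemma qr_exists:
  assumes "m \<le> n" "A \<in> carrier_mat n m"
  obtains Q where "Q \<in> stiefel n m" "A = Q * (Q\<^sup>T * A)"
proof -
  have "m \<le> n \<Longrightarrow> dim_row A = n \<Longrightarrow> dim_col A = m \<Longrightarrow> \<exists>Q\<in>stiefel n m. A = Q * (Q\<^sup>T * A)"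
  proof (induction m arbitrary: n A)
    case 0
    then show ?case
      by (intro bexI[OF _ first_frame_stiefel[of 0 n]]) (auto intro!: eq_matI)
  next
    case (Suc m)
    obtain Z y where A: "A = snoc_col Z y" and d: "dim_row Z = n" "dim_col Z = m" "dim_row y = n" "dim_col y = 1"
      using snoc_col_cases Suc.prems by metis
    have n: "1 \<le> n" "m \<le> n - 1" using Suc.prems by auto
    obtain c t where c: "c \<in> stiefel n 1" and y: "y = t \<cdot>\<^sub>m c"
      using scaled_unit_vector[OF d(3,4) n(1)] by metis
    define g where "g = frame_section n 1 c"
    have g: "g \<in> orthogonal_group n" and gE: "g * last_frame n 1 = c"
      using frame_section[OF c n(1)] by (auto simp: g_def)
    note gd = orthogonalD(4,5)[OF g]
    let ?E = "last_frame n 1" and ?F = "first_frame n (n - 1)"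
    have EE: "?E\<^sup>T * ?E = 1\<^sub>m 1"
      using stiefelD(2)[OF last_frame_stiefel[OF n(1)]] .
    have FE: "?F\<^sup>T * ?E = 0\<^sub>m (n - 1) 1"
      using n by (auto intro!: first_last_orthogonal)
    obtain Q where Q: "Q \<in> stiefel (n - 1) m" and W: "?F\<^sup>T * (g\<^sup>T * Z) = Q * (Q\<^sup>T * (?F\<^sup>T * (g\<^sup>T * Z)))"
      using Suc.IH[OF n(2), of "?F\<^sup>T * (g\<^sup>T * Z)"] d by auto
    note Qd = stiefelD(2-4)[OF Q]
    define Q1 where "Q1 = snoc_col (?F * Q) ?E"
    have Q1d: "dim_row Q1 = n" "dim_col Q1 = Suc m"
      using Qd by (auto simp: Q1_def)
    have Q1: "Q1 \<in> stiefel n (Suc m)"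
      unfolding Q1_def by (rule embed_stiefel[OF Q n(1)])
    have Q1Q1: "Q1 * (Q1\<^sup>T * X) = ?F * (Q * (Q\<^sup>T * (?F\<^sup>T * X))) + ?E * (?E\<^sup>T * X)"
      if "dim_row X = n" for X
    proof -
      have "Q1 * (Q1\<^sup>T * X) = (Q1 * Q1\<^sup>T) * X"
        using Q1d that by (simp add: mat_assoc)
      also have "Q1 * Q1\<^sup>T = (?F * Q) * (?F * Q)\<^sup>T + ?E * ?E\<^sup>T"
        unfolding Q1_def using Qd n by (intro snoc_col_outer) auto
      finally show ?thesis
        using Qd that n by (simp add: mat_distrib_right mat_transpose_mult mat_assoc)
    qed
    have 1: "Q1 * (Q1\<^sup>T * (g\<^sup>T * Z)) = g\<^sup>T * Z"
      using Q1Q1[of "g\<^sup>T * Z"] resolve_frames[OF n(1), of "g\<^sup>T * Z"] W gd by simp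
    have gy: "g\<^sup>T * y = t \<cdot>\<^sub>m ?E"
      using orthogonal_cancel(1)[OF g, of ?E] gd n by (simp add: y gE[symmetric] mat_smult_right)
    have 2: "Q1 * (Q1\<^sup>T * (g\<^sup>T * y)) = g\<^sup>T * y"
    proof -
      have "?F * (Q * (Q\<^sup>T * (?F\<^sup>T * ?E))) = 0\<^sub>m n 1"
        using Qd n by (simp add: FE mat_zero_right)
      moreover have "?E * (?E\<^sup>T * ?E) = ?E"
        by (simp add: EE mat_one_right)
      ultimately show ?thesis
        using Q1Q1[of ?E] n Q1d unfolding gy by (simp add: mat_smult_right)
    qed
    have "g * Q1 * ((g * Q1)\<^sup>T * A) = g * snoc_col (Q1 * (Q1\<^sup>T * (g\<^sup>T * Z))) (Q1 * (Q1\<^sup>T * (g\<^sup>T * y)))"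
      using Q1d gd d by (simp add: A mat_transpose_mult mat_assoc mult_snoc_col)
    also have "\<dots> = A"
      unfolding 1 2 using gd d
      by (simp add: mult_snoc_col A orthogonal_cancel(2)[OF g])
    finally show ?case
      using orthogonal_mult_stiefel[OF g Q1] by metis
  qed
  then show ?thesis
    using assms that by (metis carrier_matD)
qed

text \<open>For \<open>A = u' v\<close> this is the determinant \<open>|v' u u' v|\<close> of the cosine transform.\<close>

definition gram_det :: "real mat \<Rightarrow> real" where
  "gram_det A = Determinant.det (A\<^sup>T * A)"

lemma gram_det_mult_right:
  assumes "dim_col B = m" "dim_row R = m" "dim_col R = m"
  shows "gram_det (B * R) = (Determinant.det R)\<^sup>2 * gram_det B"
proof -
  have "(B * R)\<^sup>T * (B * R) = R\<^sup>T * ((B\<^sup>T * B) * R)"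
    using assms by (simp add: mat_transpose_mult mat_assoc)
  also have "Determinant.det \<dots> = Determinant.det (R\<^sup>T) * Determinant.det ((B\<^sup>T * B) * R)"
    using assms by (intro det_mult[of _ m]) auto
  also have "Determinant.det ((B\<^sup>T * B) * R) = Determinant.det (B\<^sup>T * B) * Determinant.det R"
    using assms by (intro det_mult[of _ m]) auto
  also have "Determinant.det (R\<^sup>T) = Determinant.det R"
    using assms by (intro det_transpose) auto
  finally show ?thesis by (simp add: gram_det_def power2_eq_square)
qed

text \<open>Base times height: \<open>W\<close> consists of the components of the columns of \<open>Z\<close> that are orthogonal to the unit vector
  \<open>g * last_frame n 1\<close>, in coordinates. The Gram matrix is a product of two block triangular
  matrices, one with diagonal blocks \<open>I, t\<close> and one with \<open>W' W, t\<close>.\<close>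

lemma gram_det_snoc_col:
  fixes Z :: "real mat"
  assumes Z: "dim_row Z = n" "dim_col Z = m" and n: "1 \<le> n" and g: "g \<in> orthogonal_group n"
  defines "W \<equiv> (first_frame n (n - 1))\<^sup>T * (g\<^sup>T * Z)"
  shows "gram_det (snoc_col Z (t \<cdot>\<^sub>m (g * last_frame n 1))) = t\<^sup>2 * gram_det W"
proof -
  let ?E = "last_frame n 1" and ?F = "first_frame n (n - 1)"
  note gd = orthogonalD(4,5)[OF g]
  define X where "X = g\<^sup>T * Z"
  define r where "r = ?E\<^sup>T * X"
  define y where "y = t \<cdot>\<^sub>m (g * ?E)"
  have d: "dim_row X = n" "dim_col X = m" "dim_row W = n - 1" "dim_col W = m" "dim_row r = 1" "dim_col r = m"
    "dim_row y = n" "dim_col y = 1"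
    using Z gd n by (auto simp: X_def W_def r_def y_def)
  have ZX: "Z = g * X"
    using orthogonal_cancel(2)[OF g Z(1)] by (simp add: X_def)
  have gg: "(g * A)\<^sup>T * (g * B) = A\<^sup>T * B" if "dim_row A = n" "dim_row B = n" for A B
    using that gd orthogonal_cancel(1)[OF g, of B] by (simp add: mat_transpose_mult mat_assoc)
  have "Z\<^sup>T * Z = X\<^sup>T * X"
    using d gg by (simp add: ZX)
  also have "\<dots> = X\<^sup>T * (?F * (?F\<^sup>T * X) + ?E * (?E\<^sup>T * X))"
    using resolve_frames[OF n, of X] d by simp
  also have "\<dots> = W\<^sup>T * W + r\<^sup>T * r"
    using d n unfolding W_def X_def[symmetric] r_def
    by (simp add: mat_distrib_left mat_transpose_mult mat_assoc)
  finally have 1: "Z\<^sup>T * Z = W\<^sup>T * W + r\<^sup>T * r" .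
  have y: "y = g * (t \<cdot>\<^sub>m ?E)"
    using gd n by (simp add: y_def mat_smult_right)
  have 2: "Z\<^sup>T * y = t \<cdot>\<^sub>m r\<^sup>T"
    using d n gg[of X "t \<cdot>\<^sub>m ?E"] unfolding ZX y r_def by (simp add: mat_smult_right mat_transpose_mult)
  have 3: "y\<^sup>T * Z = t \<cdot>\<^sub>m r"
    using d n gg[of "t \<cdot>\<^sub>m ?E" X] unfolding ZX y r_def by (simp add: mat_transpose_smult mat_smult_left)
  have EE: "?E\<^sup>T * ?E = 1\<^sub>m 1"
    using stiefelD(2)[OF last_frame_stiefel[OF n]] .
  have 4: "y\<^sup>T * y = (t * t) \<cdot>\<^sub>m 1\<^sub>m 1"
    using d n gg[of "t \<cdot>\<^sub>m ?E" "t \<cdot>\<^sub>m ?E"] unfolding y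
    by (simp add: mat_transpose_smult mat_smult_left mat_smult_right mat_smult_smult EE)
  have "four_block_mat (1\<^sub>m m) (r\<^sup>T) (0\<^sub>m 1 m) (t \<cdot>\<^sub>m 1\<^sub>m 1) *
        four_block_mat (W\<^sup>T * W) (0\<^sub>m m 1) r (t \<cdot>\<^sub>m 1\<^sub>m 1) =
        four_block_mat (1\<^sub>m m * (W\<^sup>T * W) + r\<^sup>T * r) (1\<^sub>m m * 0\<^sub>m m 1 + r\<^sup>T * (t \<cdot>\<^sub>m 1\<^sub>m 1))
          (0\<^sub>m 1 m * (W\<^sup>T * W) + (t \<cdot>\<^sub>m 1\<^sub>m 1) * r) (0\<^sub>m 1 m * 0\<^sub>m m 1 + (t \<cdot>\<^sub>m 1\<^sub>m 1) * (t \<cdot>\<^sub>m 1\<^sub>m 1))"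
    using d by (intro mult_four_block_mat[of _ m m _ 1 _ 1 _ _ m _ 1]) auto
  also have "\<dots> = four_block_mat (Z\<^sup>T * Z) (Z\<^sup>T * y) (y\<^sup>T * Z) (y\<^sup>T * y)"
    unfolding 1 2 3 4 using d
    by (simp add: mat_one_left mat_one_right mat_zero_left mat_zero_right mat_smult_right mat_smult_left mat_smult_smult
        left_add_zero_mat[of _ m 1] left_add_zero_mat[of _ 1 m] left_add_zero_mat[of _ 1 1])
  also have "\<dots> = (snoc_col Z y)\<^sup>T * snoc_col Z y"
    using d Z by (intro snoc_col_gram[symmetric]) auto
  finally have "Determinant.det ((snoc_col Z y)\<^sup>T * snoc_col Z y) =
      Determinant.det (four_block_mat (1\<^sub>m m) (r\<^sup>T) (0\<^sub>m 1 m) (t \<cdot>\<^sub>m 1\<^sub>m 1) *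
        four_block_mat (W\<^sup>T * W) (0\<^sub>m m 1) r (t \<cdot>\<^sub>m 1\<^sub>m 1))"
    by simp
  also have "\<dots> = Determinant.det (four_block_mat (1\<^sub>m m) (r\<^sup>T) (0\<^sub>m 1 m) (t \<cdot>\<^sub>m 1\<^sub>m 1)) *
      Determinant.det (four_block_mat (W\<^sup>T * W) (0\<^sub>m m 1) r (t \<cdot>\<^sub>m 1\<^sub>m 1))"
    using d by (intro det_mult[of _ "m + 1"]) auto
  also have "Determinant.det (four_block_mat (1\<^sub>m m) (r\<^sup>T) (0\<^sub>m 1 m) (t \<cdot>\<^sub>m 1\<^sub>m 1))
      = Determinant.det (1\<^sub>m m) * Determinant.det (t \<cdot>\<^sub>m 1\<^sub>m 1)"
    using d by (intro det_four_block_mat_lower_left_zero[of _ m _ 1]) auto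
  also have "Determinant.det (four_block_mat (W\<^sup>T * W) (0\<^sub>m m 1) r (t \<cdot>\<^sub>m 1\<^sub>m 1))
      = Determinant.det (W\<^sup>T * W) * Determinant.det (t \<cdot>\<^sub>m 1\<^sub>m 1)"
    using d by (intro det_four_block_mat_upper_right_zero[of _ m _ 1]) auto
  finally show ?thesis
    unfolding y_def gram_det_def by (simp add: det_smult det_one power2_eq_square)
qed

text \<open>The block matrix with rows \<open>[I, A]\<close> and \<open>[B, I]\<close> has both numbers as its determinant.\<close>

lemma det_one_minus_swap:
  fixes A B :: "real mat"
  assumes A: "dim_row A = m" "dim_col A = m" and B: "dim_row B = m" "dim_col B = m"
  shows "Determinant.det (1\<^sub>m m - A * B) = Determinant.det (1\<^sub>m m - B * A)"
proof -
  have "Determinant.det (1\<^sub>m m * 1\<^sub>m m - A * B) = Determinant.det (four_block_mat (1\<^sub>m m) A B (1\<^sub>m m))"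
    using A B by (intro det_four_block_mat[symmetric]) (auto simp: mat_one_left mat_one_right)
  also have "four_block_mat (1\<^sub>m m) A B (1\<^sub>m m) =
      four_block_mat (1\<^sub>m m * 1\<^sub>m m + 0\<^sub>m m m * 0\<^sub>m m m) (1\<^sub>m m * A + 0\<^sub>m m m * (1\<^sub>m m - B * A))
        (B * 1\<^sub>m m + 1\<^sub>m m * 0\<^sub>m m m) (B * A + 1\<^sub>m m * (1\<^sub>m m - B * A))"
    using A B by (intro cong_four_block_mat)
      (auto simp: mat_one_left mat_one_right mat_zero_left mat_zero_right intro!: eq_matI)
  also have "\<dots> = four_block_mat (1\<^sub>m m) (0\<^sub>m m m) B (1\<^sub>m m) * four_block_mat (1\<^sub>m m) A (0\<^sub>m m m) (1\<^sub>m m - B * A)"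
    using A B by (intro mult_four_block_mat[symmetric, of _ m m _ m _ m _ _ m _ m]) auto
  also have "Determinant.det \<dots> = Determinant.det (four_block_mat (1\<^sub>m m) (0\<^sub>m m m) B (1\<^sub>m m)) *
      Determinant.det (four_block_mat (1\<^sub>m m) A (0\<^sub>m m m) (1\<^sub>m m - B * A))"
    using A B by (intro det_mult[of _ "m + m"]) auto
  also have "Determinant.det (four_block_mat (1\<^sub>m m) (0\<^sub>m m m) B (1\<^sub>m m)) = Determinant.det (1\<^sub>m m :: real mat) * Determinant.det (1\<^sub>m m :: real mat)"
    using A B by (intro det_four_block_mat_upper_right_zero[of _ m _ m]) auto
  also have "Determinant.det (four_block_mat (1\<^sub>m m) A (0\<^sub>m m m) (1\<^sub>m m - B * A)) = Determinant.det (1\<^sub>m m :: real mat) * Determinant.det (1\<^sub>m m - B * A)"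
    using A B by (intro det_four_block_mat_lower_left_zero[of _ m _ m]) auto
  finally show ?thesis
    by (simp add: mat_one_left det_one)
qed

lemma gram_det_stiefel: "v \<in> stiefel n m \<Longrightarrow> gram_det v = 1"
  by (simp add: gram_det_def stiefelD(2))

text \<open>The frame \<open>Q\<close> depends on \<open>A\<close> only. Hence the dependence on \<open>A\<close> of a
  determinant \<open>|A' P' P A|\<close> is a scalar factor, up to the choice of a frame, and this choice is irrelevant once \<open>P\<close> is random
  with an invariant law.\<close>

lemma gram_det_frame_factor:
  assumes "m \<le> n" "A \<in> carrier_mat n m"
  obtains Q where "Q \<in> stiefel n m"
    "\<And>P. dim_col P = n \<Longrightarrow> gram_det (P * A) = gram_det A * gram_det (P * Q)" "0 \<le> gram_det A"
proof -
  obtain Q where Q: "Q \<in> stiefel n m" "A = Q * (Q\<^sup>T * A)"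
    by (rule qr_exists[OF assms])
  note d = stiefelD(3,4)[OF Q(1)]
  define R where "R = Q\<^sup>T * A"
  have R: "dim_row R = m" "dim_col R = m" and A: "A = Q * R"
    using d assms Q(2) by (auto simp: R_def)
  have gA: "gram_det A = (Determinant.det R)\<^sup>2"
    unfolding A using gram_det_mult_right[OF d(2) R] gram_det_stiefel[OF Q(1)] by simp
  have "gram_det (P * A) = gram_det A * gram_det (P * Q)" if "dim_col P = n" for P
  proof -
    have "gram_det (P * A) = gram_det ((P * Q) * R)"
      using that d R by (simp add: A mat_assoc)
    also have "\<dots> = (Determinant.det R)\<^sup>2 * gram_det (P * Q)"
      using d R by (intro gram_det_mult_right) auto
    finally show ?thesis by (simp add: gA)
  qed
  with Q(1) show ?thesis by (rule that) (simp_all add: gA)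
qed

lemma gram_det_nonneg:
  assumes "dim_col A \<le> dim_row A"
  shows "0 \<le> gram_det A"
  using gram_det_frame_factor[OF assms, of A] by (metis carrier_mat_triv)

section \<open>Measurability of matrix operations\<close>

text \<open>The Borel sets of all matrices, defined as those of the Stiefel manifold are. Measurability into
  this space means measurability of all entries.\<close>

definition mat_borel :: "nat \<Rightarrow> nat \<Rightarrow> real mat measure" where
  "mat_borel n m = vimage_algebra (carrier_mat n m) (\<lambda>v. \<lambda>ij\<in>{..<n} \<times> {..<m}. v $$ ij)
     (\<Pi>\<^sub>M ij\<in>{..<n} \<times> {..<m}. (borel :: real measure))"

lemma space_mat_borel [simp]: "space (mat_borel n m) = carrier_mat n m"
  by (simp add: mat_borel_def)

lemma space_stiefel_borel [simp]: "space (stiefel_borel n m) = stiefel n m"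
  by (simp add: stiefel_borel_def)

lemma measurable_mat_borelI:
  assumes "\<And>x. x \<in> space M \<Longrightarrow> f x \<in> carrier_mat n m"
    and "\<And>i j. i < n \<Longrightarrow> j < m \<Longrightarrow> (\<lambda>x. f x $$ (i,j)) \<in> borel_measurable M"
  shows "f \<in> measurable M (mat_borel n m)"
  unfolding mat_borel_def
  using assms by (intro measurable_vimage_algebra2 measurable_restrict) auto

lemma measurable_stiefel_borelI:
  assumes "\<And>x. x \<in> space M \<Longrightarrow> f x \<in> stiefel n m" and "f \<in> measurable M (mat_borel n m)"
  shows "f \<in> measurable M (stiefel_borel n m)"
  unfolding stiefel_borel_def
proof (rule measurable_vimage_algebra2)
  show "(\<lambda>x. \<lambda>ij\<in>{..<n} \<times> {..<m}. f x $$ ij) \<in> measurable M (\<Pi>\<^sub>M ij\<in>{..<n} \<times> {..<m}. borel)"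
    using assms(2) unfolding mat_borel_def
    by (rule measurable_compose[OF _ measurable_vimage_algebra1]) (auto simp: space_PiM)
qed (use assms(1) in auto)

lemma measurable_entry:
  assumes "f \<in> measurable M (mat_borel n m)" "i < n" "j < m"
  shows "(\<lambda>x. f x $$ (i,j)) \<in> borel_measurable M"
proof -
  have "(\<lambda>v. \<lambda>ij\<in>{..<n} \<times> {..<m}. v $$ ij) \<in> measurable (mat_borel n m) (\<Pi>\<^sub>M ij\<in>{..<n} \<times> {..<m}. (borel :: real measure))"
    unfolding mat_borel_def by (rule measurable_vimage_algebra1) (auto simp: space_PiM)
  then have "(\<lambda>v. (\<lambda>ij\<in>{..<n} \<times> {..<m}. v $$ ij) (i,j)) \<in> borel_measurable (mat_borel n m)"
    by (rule measurable_compose[OF _ measurable_component_singleton]) (use assms in auto)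
  then have "(\<lambda>v. v $$ (i,j)) \<in> borel_measurable (mat_borel n m)"
    using assms by simp
  from measurable_compose[OF assms(1) this] show ?thesis .
qed

lemma measurable_mat_dim:
  assumes "f \<in> measurable M (mat_borel n m)" "x \<in> space M"
  shows "dim_row (f x) = n" "dim_col (f x) = m"
  using measurable_space[OF assms] by auto

lemma measurable_stiefel_mat [measurable_dest]:
  assumes "f \<in> measurable M (stiefel_borel n m)"
  shows "f \<in> measurable M (mat_borel n m)"
proof -
  have "(\<lambda>v. \<lambda>ij\<in>{..<n} \<times> {..<m}. v $$ ij) \<in> measurable (stiefel_borel n m) (\<Pi>\<^sub>M ij\<in>{..<n} \<times> {..<m}. (borel :: real measure))"
    unfolding stiefel_borel_def by (rule measurable_vimage_algebra1) (auto simp: space_PiM)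
  then have "(\<lambda>v. v) \<in> measurable (stiefel_borel n m) (mat_borel n m)"
    unfolding mat_borel_def by (intro measurable_vimage_algebra2) (auto simp: stiefel_def)
  from measurable_compose[OF assms this] show ?thesis by simp
qed

lemma measurable_stiefel_ident: "(\<lambda>v. v) \<in> measurable (stiefel_borel n m) (mat_borel n m)"
  by (rule measurable_stiefel_mat) simp

lemma measurable_mat_mult [measurable (raw)]:
  assumes f: "f \<in> measurable M (mat_borel n k)" and g: "g \<in> measurable M (mat_borel k m)"
  shows "(\<lambda>x. f x * g x) \<in> measurable M (mat_borel n m)"
proof (rule measurable_mat_borelI)
  fix i j assume ij: "i < n" "j < m"
  have "(\<lambda>x. \<Sum>l<k. f x $$ (i,l) * g x $$ (l,j)) \<in> borel_measurable M"
    using ij by (intro borel_measurable_sum borel_measurable_times measurable_entry[OF f] measurable_entry[OF g]) auto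
  also have "?this \<longleftrightarrow> (\<lambda>x. (f x * g x) $$ (i,j)) \<in> borel_measurable M"
    using ij measurable_mat_dim[OF f] measurable_mat_dim[OF g]
    by (intro measurable_cong) (simp add: scalar_prod_def lessThan_atLeast0)
  finally show "(\<lambda>x. (f x * g x) $$ (i,j)) \<in> borel_measurable M" .
qed (use measurable_mat_dim[OF f] measurable_mat_dim[OF g] in auto)

lemma measurable_mat_transpose [measurable (raw)]:
  assumes f: "f \<in> measurable M (mat_borel n m)"
  shows "(\<lambda>x. (f x)\<^sup>T) \<in> measurable M (mat_borel m n)"
proof (rule measurable_mat_borelI)
  fix i j assume ij: "i < m" "j < n"
  show "(\<lambda>x. (f x)\<^sup>T $$ (i,j)) \<in> borel_measurable M"
    using ij measurable_entry[OF f, of j i] measurable_mat_dim[OF f]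
    by (subst measurable_cong[where g="\<lambda>x. f x $$ (j,i)"]) auto
qed (use measurable_mat_dim[OF f] in auto)

lemma measurable_mat_minus [measurable (raw)]:
  assumes f: "f \<in> measurable M (mat_borel n m)" and g: "g \<in> measurable M (mat_borel n m)"
  shows "(\<lambda>x. f x - g x) \<in> measurable M (mat_borel n m)"
proof (rule measurable_mat_borelI)
  fix i j assume ij: "i < n" "j < m"
  show "(\<lambda>x. (f x - g x) $$ (i,j)) \<in> borel_measurable M"
    using ij measurable_entry[OF f, of i j] measurable_entry[OF g, of i j] measurable_mat_dim[OF f] measurable_mat_dim[OF g]
    by (subst measurable_cong[where g="\<lambda>x. f x $$ (i,j) - g x $$ (i,j)"]) auto
qed (use measurable_mat_dim[OF f] measurable_mat_dim[OF g] in auto)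

lemma measurable_mat_smult [measurable (raw)]:
  assumes f: "f \<in> measurable M (mat_borel n m)" and c: "c \<in> borel_measurable M"
  shows "(\<lambda>x. c x \<cdot>\<^sub>m f x) \<in> measurable M (mat_borel n m)"
proof (rule measurable_mat_borelI)
  fix i j assume ij: "i < n" "j < m"
  show "(\<lambda>x. (c x \<cdot>\<^sub>m f x) $$ (i,j)) \<in> borel_measurable M"
    using ij c measurable_entry[OF f, of i j] measurable_mat_dim[OF f]
    by (subst measurable_cong[where g="\<lambda>x. c x * f x $$ (i,j)"]) auto
qed (use measurable_mat_dim[OF f] in auto)

lemma measurable_mat_const: "A \<in> carrier_mat n m \<Longrightarrow> (\<lambda>x. A) \<in> measurable M (mat_borel n m)"
  by (intro measurable_mat_borelI) auto

lemma measurable_snoc_col [measurable (raw)]: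
  assumes f: "f \<in> measurable M (mat_borel n m)" and g: "g \<in> measurable M (mat_borel n 1)"
  shows "(\<lambda>x. snoc_col (f x) (g x)) \<in> measurable M (mat_borel n (Suc m))"
proof (rule measurable_mat_borelI)
  fix i j assume ij: "i < n" "j < Suc m"
  show "(\<lambda>x. snoc_col (f x) (g x) $$ (i,j)) \<in> borel_measurable M"
    using ij measurable_entry[OF f, of i j] measurable_entry[OF g, of i 0] measurable_mat_dim[OF f] measurable_mat_dim[OF g]
    by (subst measurable_cong[where g="\<lambda>x. if j < m then f x $$ (i,j) else g x $$ (i,0)"])
       (cases "j < m"; auto simp: snoc_col_index)+
qed (use measurable_mat_dim[OF f] measurable_mat_dim[OF g] in auto)

lemma measurable_col_mat:
  assumes f: "f \<in> measurable M (mat_borel n m)" and j: "j < m"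
  shows "(\<lambda>x. col_mat (f x) j) \<in> measurable M (mat_borel n 1)"
proof (rule measurable_mat_borelI)
  fix i l :: nat assume ij: "i < n" "l < 1"
  show "(\<lambda>x. col_mat (f x) j $$ (i,l)) \<in> borel_measurable M"
    using ij measurable_entry[OF f ij(1) j] measurable_mat_dim[OF f]
    by (subst measurable_cong[where g="\<lambda>x. f x $$ (i,j)"]) (auto simp: col_mat_index)
qed (use measurable_mat_dim[OF f] in auto)

lemma measurable_refl_mat:
  assumes f: "f \<in> measurable M (mat_borel n 1)" and g: "g \<in> measurable M (mat_borel n 1)"
  shows "(\<lambda>x. refl_mat (f x) (g x)) \<in> measurable M (mat_borel n n)"
proof -
  have d: "(\<lambda>x. f x - g x) \<in> measurable M (mat_borel n 1)"
    by (rule measurable_mat_minus[OF f g])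
  have "(\<lambda>x. ((f x - g x)\<^sup>T * (f x - g x)) $$ (0,0)) \<in> borel_measurable M"
    by (rule measurable_entry[OF measurable_mat_mult[OF measurable_mat_transpose[OF d] d]]) auto
  then have "(\<lambda>x. 1\<^sub>m n - (2 / ((f x - g x)\<^sup>T * (f x - g x)) $$ (0,0)) \<cdot>\<^sub>m ((f x - g x) * (f x - g x)\<^sup>T))
      \<in> measurable M (mat_borel n n)"
    by (intro measurable_mat_minus measurable_mat_const measurable_mat_smult borel_measurable_divide
        measurable_mat_mult[OF d] measurable_mat_transpose d borel_measurable_const) auto
  then show ?thesis
    unfolding refl_mat_def using measurable_mat_dim(1)[OF f]
    by (subst measurable_cong[where g="\<lambda>x. 1\<^sub>m n - (2 / ((f x - g x)\<^sup>T * (f x - g x)) $$ (0,0)) \<cdot>\<^sub>m ((f x - g x) * (f x - g x)\<^sup>T)"]) auto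
qed

lemma measurable_frame_section [measurable (raw)]:
  assumes f: "f \<in> measurable M (mat_borel n k)" and k: "k \<le> n"
  shows "(\<lambda>x. frame_section n k (f x)) \<in> measurable M (mat_borel n n)"
proof -
  have "j \<le> k \<Longrightarrow> (\<lambda>x. section_aux n k (f x) j) \<in> measurable M (mat_borel n n)" for j
  proof (induction j)
    case (Suc j)
    then show ?case
      using k by (auto intro!: measurable_mat_mult[of _ _ n n] measurable_refl_mat measurable_col_mat[of _ _ _ n]
          measurable_col_mat[OF f])
  qed (auto intro: measurable_mat_const)
  then show ?thesis
    by (simp add: frame_section_def)
qed

text \<open>The determinant is a polynomial in the entries.\<close>

lemma measurable_det [measurable (raw)]:
  assumes f: "f \<in> measurable M (mat_borel m m)"
  shows "(\<lambda>x. Determinant.det (f x)) \<in> borel_measurable M"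
proof -
  have "(\<lambda>x. \<Sum>p\<in>{p. p permutes {0..<m}}. signof p * (\<Prod>i = 0..<m. f x $$ (i, p i))) \<in> borel_measurable M"
  proof (intro borel_measurable_sum borel_measurable_times borel_measurable_const borel_measurable_prod)
    fix p i assume "p \<in> {p. p permutes {0..<m}}" "i \<in> {0..<m}"
    then show "(\<lambda>x. f x $$ (i, p i)) \<in> borel_measurable M"
      using permutes_in_image[of p "{0..<m}" i] by (intro measurable_entry[OF f]) auto
  qed
  also have "?this \<longleftrightarrow> ?thesis"
    using measurable_mat_dim[OF f] by (intro measurable_cong) (simp add: Determinant.det_def)
  finally show ?thesis .
qed

section \<open>Lebesgue measure and isometries\<close>

abbreviation (input) lebesgue_on :: "'i set \<Rightarrow> ('i \<Rightarrow> real) measure" where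
  "lebesgue_on I \<equiv> \<Pi>\<^sub>M i\<in>I. (lborel :: real measure)"

interpretation lborel_product: product_sigma_finite "\<lambda>i. (lborel :: real measure)"
  by standard

lemma sets_PiM_lborel: "sets (\<Pi>\<^sub>M i\<in>I. (lborel :: real measure)) = sets (\<Pi>\<^sub>M i\<in>I. (borel :: real measure))"
  by (intro sets_PiM_cong) auto

lemma sigma_finite_PiM_lborel: "finite I \<Longrightarrow> sigma_finite_measure (\<Pi>\<^sub>M i\<in>I. (lborel :: real measure))"
  by (rule lborel_product.sigma_finite)

text \<open>Translation invariance, reflection invariance and scaling of Lebesgue measure in one statement.\<close>

lemma PiM_lborel_affine:
  assumes I: "finite I" and a: "a \<noteq> 0"
  shows "distr (lebesgue_on I) (lebesgue_on I) (\<lambda>x. \<lambda>i\<in>I. a * x i + b i) =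
    scale_measure (ennreal (inverse \<bar>a\<bar> ^ card I)) (lebesgue_on I)"
proof -
  let ?L = "lebesgue_on I" and ?T = "\<lambda>x. \<lambda>i\<in>I. a * x i + b i"
  have T: "?T \<in> measurable ?L ?L"
    by measurable
  have "scale_measure (ennreal (\<bar>a\<bar> ^ card I)) (distr ?L ?L ?T) = ?L"
  proof (rule lborel_product.PiM_eqI[OF I])
    fix A :: "'a \<Rightarrow> real set" assume A: "\<And>i. i \<in> I \<Longrightarrow> A i \<in> sets lborel"
    have meas: "(\<lambda>x. b i + a * x) -` A i \<in> sets lborel" if "i \<in> I" for i
      using measurable_sets[of "\<lambda>x. b i + a * x" borel borel "A i"] A[OF that] by simp
    have vimage: "?T -` (\<Pi>\<^sub>E i\<in>I. A i) \<inter> space ?L = (\<Pi>\<^sub>E i\<in>I. (\<lambda>x. b i + a * x) -` A i)"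
      by (auto simp: space_PiM PiE_iff add.commute extensional_def)
    have "emeasure (distr ?L ?L ?T) (\<Pi>\<^sub>E i\<in>I. A i) = emeasure ?L (\<Pi>\<^sub>E i\<in>I. (\<lambda>x. b i + a * x) -` A i)"
      using A T I by (subst emeasure_distr) (auto simp: vimage intro!: sets_PiM_I_finite)
    also have "\<dots> = (\<Prod>i\<in>I. emeasure lborel ((\<lambda>x. b i + a * x) -` A i))"
      using meas by (intro lborel_product.emeasure_PiM[OF I]) auto
    also have "ennreal (\<bar>a\<bar> ^ card I) * \<dots> = (\<Prod>i\<in>I. ennreal \<bar>a\<bar> * emeasure lborel ((\<lambda>x. b i + a * x) -` A i))"
      by (simp add: prod.distrib ennreal_power)
    also have "\<dots> = (\<Prod>i\<in>I. emeasure lborel (A i))"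
    proof (rule prod.cong[OF refl])
      fix i assume i: "i \<in> I"
      have "emeasure lborel (A i) = emeasure (density (distr lborel borel (\<lambda>x. b i + a * x)) (\<lambda>_. ennreal \<bar>a\<bar>)) (A i)"
        by (subst lborel_real_affine[OF a, of "b i"]) simp
      also have "\<dots> = ennreal \<bar>a\<bar> * emeasure lborel ((\<lambda>x. b i + a * x) -` A i)"
        using A[OF i] by (simp add: emeasure_density emeasure_distr nn_integral_cmult_indicator)
      finally show "ennreal \<bar>a\<bar> * emeasure lborel ((\<lambda>x. b i + a * x) -` A i) = emeasure lborel (A i)" ..
    qed
    finally show "emeasure (scale_measure (ennreal (\<bar>a\<bar> ^ card I)) (distr ?L ?L ?T)) (\<Pi>\<^sub>E i\<in>I. A i) = (\<Prod>i\<in>I. emeasure lborel (A i))"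
      by simp
  qed auto
  then have "scale_measure (ennreal (inverse \<bar>a\<bar> ^ card I)) ?L =
      scale_measure (ennreal (inverse \<bar>a\<bar> ^ card I)) (scale_measure (ennreal (\<bar>a\<bar> ^ card I)) (distr ?L ?L ?T))"
    by simp
  also have "\<dots> = distr ?L ?L ?T"
    using a by (simp add: scale_scale_measure ennreal_mult[symmetric] power_mult_distrib[symmetric])
  finally show ?thesis ..
qed

text \<open>The integral of \<open>1\<^sub>A(x) 1\<^sub>B(x + y)\<close> over \<open>M\<close> and Lebesgue measure is evaluated in both orders:
  the invariance of Lebesgue measure under translations gives the left side, that of \<open>M\<close>, together with the
  invariance of Lebesgue measure under \<open>y \<mapsto> x - y\<close>, the right side.\<close>

lemma translation_invariant_unique:
  assumes I: "finite I" and sets: "sets M = sets (lebesgue_on I)" and "sigma_finite_measure M"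
    and inv: "\<And>b. distr M M (\<lambda>x. \<lambda>i\<in>I. x i + b i) = M"
    and A: "A \<in> sets (lebesgue_on I)" and B: "B \<in> sets (lebesgue_on I)"
  shows "emeasure M A * emeasure (lebesgue_on I) B = emeasure M B * emeasure (lebesgue_on I) A"
proof -
  let ?L = "lebesgue_on I"
  interpret M: sigma_finite_measure M by fact
  interpret L: sigma_finite_measure ?L by (rule sigma_finite_PiM_lborel[OF I])
  interpret pair_sigma_finite M ?L ..
  have space: "space M = space ?L" using sets by (rule sets_eq_imp_space_eq)
  note [measurable_cong] = sets
  have [measurable]: "A \<in> sets ?L" "B \<in> sets ?L" "A \<in> sets M" "B \<in> sets M" using A B sets by auto
  let ?p = "\<lambda>x y. \<lambda>i\<in>I. x i + y i :: real"
  let ?m = "\<lambda>x y. \<lambda>i\<in>I. - 1 * y i + x i :: real"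
  have L_plus: "(\<integral>\<^sup>+y. indicator B (?p x y) \<partial>?L) = emeasure ?L B" if "x \<in> space ?L" for x
  proof -
    have *: "distr ?L ?L (\<lambda>y. \<lambda>i\<in>I. 1 * y i + x i) = ?L"
      by (subst PiM_lborel_affine[OF I]) auto
    have "emeasure ?L B = (\<integral>\<^sup>+y. indicator B y \<partial>(distr ?L ?L (\<lambda>y. \<lambda>i\<in>I. 1 * y i + x i)))"
      unfolding * by simp
    also have "\<dots> = (\<integral>\<^sup>+y. indicator B (\<lambda>i\<in>I. 1 * y i + x i) \<partial>?L)"
      by (rule nn_integral_distr) measurable
    finally show ?thesis by (simp add: add.commute cong: restrict_cong)
  qed
  have L_minus: "(\<integral>\<^sup>+y. indicator A (?m x y) \<partial>?L) = emeasure ?L A" if "x \<in> space ?L" for x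
  proof -
    have *: "distr ?L ?L (?m x) = ?L"
      by (subst PiM_lborel_affine[OF I]) auto
    have "emeasure ?L A = (\<integral>\<^sup>+y. indicator A y \<partial>(distr ?L ?L (?m x)))"
      unfolding * by simp
    also have "\<dots> = (\<integral>\<^sup>+y. indicator A (?m x y) \<partial>?L)"
      by (rule nn_integral_distr) measurable
    finally show ?thesis by simp
  qed
  have M_shift: "(\<integral>\<^sup>+x. indicator A (?m x y) * indicator B x \<partial>M) = (\<integral>\<^sup>+x. indicator A x * indicator B (?p x y) \<partial>M)"
    if y: "y \<in> space ?L" for y
  proof -
    have "(\<integral>\<^sup>+x. indicator A (?m x y) * indicator B x \<partial>M) = (\<integral>\<^sup>+x. indicator A (?m x y) * indicator B x \<partial>(distr M M (\<lambda>x. ?p x y)))"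
      unfolding inv ..
    also have "\<dots> = (\<integral>\<^sup>+x. indicator A (?m (?p x y) y) * indicator B (?p x y) \<partial>M)"
      by (rule nn_integral_distr) measurable
    also have "\<dots> = (\<integral>\<^sup>+x. indicator A x * indicator B (?p x y) \<partial>M)"
    proof (rule nn_integral_cong)
      fix x assume "x \<in> space M"
      then have "?m (?p x y) y = x"
        unfolding space by (auto simp: space_PiM PiE_iff extensional_def fun_eq_iff)
      then show "indicator A (?m (?p x y) y) * indicator B (?p x y) = indicator A x * (indicator B (?p x y) :: ennreal)"
        by simp
    qed
    finally show ?thesis .
  qed
  have "emeasure M A * emeasure ?L B = (\<integral>\<^sup>+x. indicator A x * emeasure ?L B \<partial>M)"
    by (simp add: nn_integral_multc)
  also have "\<dots> = (\<integral>\<^sup>+x. \<integral>\<^sup>+y. indicator A x * indicator B (?p x y) \<partial>?L \<partial>M)"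
    using space by (intro nn_integral_cong) (simp add: nn_integral_cmult L_plus)
  also have "\<dots> = (\<integral>\<^sup>+y. \<integral>\<^sup>+x. indicator A x * indicator B (?p x y) \<partial>M \<partial>?L)"
    by (rule Fubini'[symmetric]) measurable
  also have "\<dots> = (\<integral>\<^sup>+y. \<integral>\<^sup>+x. indicator A (?m x y) * indicator B x \<partial>M \<partial>?L)"
    by (rule nn_integral_cong) (rule M_shift[symmetric])
  also have "\<dots> = (\<integral>\<^sup>+x. \<integral>\<^sup>+y. indicator A (?m x y) * indicator B x \<partial>?L \<partial>M)"
    by (rule Fubini') measurable
  also have "\<dots> = (\<integral>\<^sup>+x. emeasure ?L A * indicator B x \<partial>M)"
  proof (rule nn_integral_cong)
    fix x assume "x \<in> space M"
    then have x: "x \<in> space ?L" by (simp add: space)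
    have "(\<integral>\<^sup>+y. indicator A (?m x y) * indicator B x \<partial>?L) = (\<integral>\<^sup>+y. indicator A (?m x y) \<partial>?L) * indicator B x"
      by (rule nn_integral_multc) measurable
    then show "(\<integral>\<^sup>+y. indicator A (?m x y) * indicator B x \<partial>?L) = emeasure ?L A * indicator B x"
      by (simp only: L_minus[OF x])
  qed
  also have "\<dots> = emeasure M B * emeasure ?L A"
    by (subst nn_integral_cmult) (auto simp: mult.commute)
  finally show ?thesis .
qed

definition ball_set :: "'i set \<Rightarrow> real \<Rightarrow> ('i \<Rightarrow> real) set" where
  "ball_set I r = {x \<in> space (lebesgue_on I). (\<Sum>i\<in>I. (x i)\<^sup>2) < r}"

lemma ball_set_measurable [measurable]: "finite I \<Longrightarrow> ball_set I r \<in> sets (lebesgue_on I)"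
  unfolding ball_set_def by measurable

lemma ball_set_finite:
  assumes I: "finite I"
  shows "emeasure (lebesgue_on I) (ball_set I r) < \<infinity>"
proof -
  have "ball_set I r \<subseteq> (\<Pi>\<^sub>E i\<in>I. {- sqrt \<bar>r\<bar> .. sqrt \<bar>r\<bar>})"
  proof
    fix x assume x: "x \<in> ball_set I r"
    have "x i \<in> {- sqrt \<bar>r\<bar> .. sqrt \<bar>r\<bar>}" if i: "i \<in> I" for i
    proof -
      have "(x i)\<^sup>2 \<le> (\<Sum>i\<in>I. (x i)\<^sup>2)"
        using i I by (intro member_le_sum) auto
      also have "\<dots> \<le> \<bar>r\<bar>" using x by (auto simp: ball_set_def)
      finally have "\<bar>x i\<bar> \<le> sqrt \<bar>r\<bar>" by (simp add: real_le_rsqrt)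
      then show ?thesis by (auto simp: abs_le_iff)
    qed
    then show "x \<in> (\<Pi>\<^sub>E i\<in>I. {- sqrt \<bar>r\<bar> .. sqrt \<bar>r\<bar>})"
      using x by (auto simp: ball_set_def space_PiM PiE_iff)
  qed
  then have "emeasure (lebesgue_on I) (ball_set I r) \<le> emeasure (lebesgue_on I) (\<Pi>\<^sub>E i\<in>I. {- sqrt \<bar>r\<bar> .. sqrt \<bar>r\<bar>})"
    using I by (intro emeasure_mono) (auto intro!: sets_PiM_I_finite)
  also have "\<dots> = (\<Prod>i\<in>I. emeasure lborel {- sqrt \<bar>r\<bar> .. sqrt \<bar>r\<bar>})"
    by (rule lborel_product.emeasure_PiM[OF I]) auto
  also have "\<dots> < \<infinity>"
    by (simp add: ennreal_power[symmetric] ennreal_mult_less_top power_less_top_ennreal)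
  finally show ?thesis .
qed

lemma ball_set_positive:
  assumes I: "finite I"
  shows "emeasure (lebesgue_on I) (ball_set I 1) > 0"
proof -
  \<comment> \<open>a cube inside the ball: each coordinate contributes at most \<open>e\<^sup>2 \<le> e\<close> to the squared norm\<close>
  define e :: real where "e = 1 / (1 + real (card I))"
  have e: "0 < e" "e \<le> 1" by (auto simp: e_def)
  have "(\<Pi>\<^sub>E i\<in>I. {0..e}) \<subseteq> ball_set I 1"
  proof
    fix x assume x: "x \<in> (\<Pi>\<^sub>E i\<in>I. {0..e})"
    have "(\<Sum>i\<in>I. (x i)\<^sup>2) \<le> (\<Sum>i\<in>I. e)"
    proof (rule sum_mono)
      fix i assume "i \<in> I"
      then have "0 \<le> x i" "x i \<le> e" using x by (auto simp: PiE_iff)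
      then have "x i * x i \<le> e * 1" using e by (intro mult_mono) auto
      then show "(x i)\<^sup>2 \<le> e" by (simp add: power2_eq_square)
    qed
    also have "\<dots> < 1" by (simp add: e_def)
    finally show "x \<in> ball_set I 1"
      using x by (auto simp: ball_set_def space_PiM PiE_iff)
  qed
  then have le: "emeasure (lebesgue_on I) (\<Pi>\<^sub>E i\<in>I. {0..e}) \<le> emeasure (lebesgue_on I) (ball_set I 1)"
    using I by (intro emeasure_mono) auto
  have "emeasure (lebesgue_on I) (\<Pi>\<^sub>E i\<in>I. {0..e}) = (\<Prod>i\<in>I. emeasure lborel {0..e})"
    by (rule lborel_product.emeasure_PiM[OF I]) auto
  also have "\<dots> = ennreal (e ^ card I)"
    using e by (simp add: ennreal_power)
  finally have "0 < emeasure (lebesgue_on I) (\<Pi>\<^sub>E i\<in>I. {0..e})"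
    using e by simp
  from order_less_le_trans[OF this le] show ?thesis .
qed

text \<open>The image measure is translation invariant, hence proportional to Lebesgue measure, and
  the factor is \<open>1\<close> because the unit ball is its own preimage.\<close>

lemma isometry_preserves_lebesgue:
  assumes I: "finite I"
    and T: "T \<in> measurable (lebesgue_on I) (lebesgue_on I)" and S: "S \<in> measurable (lebesgue_on I) (lebesgue_on I)"
    and TS: "\<And>x. x \<in> space (lebesgue_on I) \<Longrightarrow> T (S x) = x" and ST: "\<And>x. x \<in> space (lebesgue_on I) \<Longrightarrow> S (T x) = x"
    and add: "\<And>x b. T (\<lambda>i\<in>I. x i + b i) = (\<lambda>i\<in>I. T x i + T b i)"
    and norm: "\<And>x. x \<in> space (lebesgue_on I) \<Longrightarrow> (\<Sum>i\<in>I. (T x i)\<^sup>2) = (\<Sum>i\<in>I. (x i)\<^sup>2)"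
  shows "distr (lebesgue_on I) (lebesgue_on I) T = lebesgue_on I"
proof -
  let ?L = "lebesgue_on I"
  let ?M = "distr ?L ?L T"
  interpret L: sigma_finite_measure ?L by (rule sigma_finite_PiM_lborel[OF I])
  note [measurable] = T S
  have distr: "distr ?M ?M g = distr ?L ?L (\<lambda>x. g (T x))" if "g \<in> measurable ?L ?L" for g
    using that by (subst distr_distr) (auto simp: comp_def cong: distr_cong)
  have SM: "distr ?M ?L S = ?L"
  proof -
    have "distr ?M ?L S = distr ?L ?L (\<lambda>x. S (T x))"
      by (subst distr_distr) (auto simp: comp_def)
    also have "\<dots> = distr ?L ?L (\<lambda>x. x)"
      using ST by (intro distr_cong) auto
    finally show ?thesis by (simp add: distr_id2)
  qed
  \<comment> \<open>\<open>T\<close> is invertible, so the image measure inherits sigma-finiteness\<close>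
  have sf: "sigma_finite_measure ?M"
  proof -
    have "sigma_finite_measure (distr ?M ?L S)" unfolding SM ..
    then show ?thesis
      by (rule sigma_finite_measure_distr) auto
  qed
  have inv: "distr ?M ?M (\<lambda>x. \<lambda>i\<in>I. x i + b i) = ?M" for b
  proof -
    define c where "c = S (\<lambda>i\<in>I. b i)"
    have c: "T c = (\<lambda>i\<in>I. b i)" unfolding c_def by (rule TS) (auto simp: space_PiM)
    have "distr ?M ?M (\<lambda>x. \<lambda>i\<in>I. x i + b i) = distr ?L ?L (\<lambda>x. \<lambda>i\<in>I. T x i + b i)"
      by (rule distr) measurable
    also have "\<dots> = distr ?L ?L (\<lambda>x. T (\<lambda>i\<in>I. 1 * x i + c i))"
      by (simp add: add c cong: restrict_cong)
    also have "\<dots> = distr (distr ?L ?L (\<lambda>x. \<lambda>i\<in>I. 1 * x i + c i)) ?L T"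
      by (subst distr_distr) (auto simp: comp_def)
    also have "distr ?L ?L (\<lambda>x. \<lambda>i\<in>I. 1 * x i + c i) = ?L"
      by (subst PiM_lborel_affine[OF I]) auto
    finally show ?thesis .
  qed
  have ball: "emeasure ?M (ball_set I 1) = emeasure ?L (ball_set I 1)"
  proof -
    have "T -` ball_set I 1 \<inter> space ?L = ball_set I 1"
      using norm measurable_space[OF T] by (auto simp: ball_set_def)
    then show ?thesis using I by (subst emeasure_distr) auto
  qed
  show ?thesis
  proof (rule measure_eqI)
    fix A assume A: "A \<in> sets ?M"
    have "emeasure ?M A * emeasure ?L (ball_set I 1) = emeasure ?L A * emeasure ?L (ball_set I 1)"
      using translation_invariant_unique[OF I _ sf inv, of A "ball_set I 1"] A I
      by (simp add: ball mult.commute)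
    then show "emeasure ?M A = emeasure ?L A"
      using ball_set_positive[OF I] ball_set_finite[OF I, of 1]
      by (auto simp: mult.commute[of _ "emeasure ?L (ball_set I 1)"] ennreal_mult_cancel_left)
  qed simp
qed

section \<open>Gaussian matrices\<close>

definition std_gauss :: "real measure" where
  "std_gauss = density lborel (\<lambda>x. ennreal (std_normal_density x))"

lemma prob_space_std_gauss: "prob_space std_gauss"
  unfolding std_gauss_def by (rule prob_space_normal_density) simp

lemma sets_std_gauss [simp, measurable_cong]: "sets std_gauss = sets borel"
  by (simp add: std_gauss_def)

lemma space_std_gauss [simp]: "space std_gauss = UNIV"
  by (simp add: std_gauss_def)

interpretation gauss_product: product_sigma_finite "\<lambda>i. std_gauss"
  by (simp add: product_sigma_finite_def prob_space_std_gauss prob_space_imp_sigma_finite)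

text \<open>The density of a standard Gaussian vector in dimension \<open>d\<close>, as a function of the squared norm.\<close>

definition gauss_weight :: "nat \<Rightarrow> real \<Rightarrow> real" where
  "gauss_weight d r = (1 / sqrt (2 * pi)) ^ d * exp (- r / 2)"

text \<open>The joint density depends on the norm only; this is why the law is invariant under rotations.\<close>

lemma PiM_std_gauss:
  assumes I: "finite I"
  shows "(\<Pi>\<^sub>M i\<in>I. std_gauss) = density (\<Pi>\<^sub>M i\<in>I. lborel) (\<lambda>x. ennreal (gauss_weight (card I) (\<Sum>i\<in>I. (x i)\<^sup>2)))"
proof (rule gauss_product.PiM_eqI[OF I, symmetric])
  fix A :: "'a \<Rightarrow> real set" assume A: "\<And>i. i \<in> I \<Longrightarrow> A i \<in> sets std_gauss"
  have w: "gauss_weight (card I) (\<Sum>i\<in>I. (x i)\<^sup>2) = (\<Prod>i\<in>I. std_normal_density (x i))" for x :: "'a \<Rightarrow> real"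
    by (simp add: gauss_weight_def std_normal_density_def prod.distrib exp_sum[OF I, symmetric]
        sum_negf sum_divide_distrib power_divide prod_dividef)
  have "emeasure (density (\<Pi>\<^sub>M i\<in>I. lborel) (\<lambda>x. ennreal (gauss_weight (card I) (\<Sum>i\<in>I. (x i)\<^sup>2)))) (\<Pi>\<^sub>E i\<in>I. A i)
      = (\<integral>\<^sup>+x. ennreal (\<Prod>i\<in>I. std_normal_density (x i)) * indicator (\<Pi>\<^sub>E i\<in>I. A i) x \<partial>(\<Pi>\<^sub>M i\<in>I. lborel))"
    unfolding w using I A by (intro emeasure_density) (auto intro!: sets_PiM_I_finite)
  also have "\<dots> = (\<integral>\<^sup>+x. (\<Prod>i\<in>I. ennreal (std_normal_density (x i)) * indicator (A i) (x i)) \<partial>(\<Pi>\<^sub>M i\<in>I. lborel))"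
  proof (rule nn_integral_cong)
    fix x assume "x \<in> space (\<Pi>\<^sub>M i\<in>I. (lborel :: real measure))"
    then have x: "x \<in> extensional I" by (auto simp: space_PiM PiE_iff)
    have "indicator (\<Pi>\<^sub>E i\<in>I. A i) x = (\<Prod>i\<in>I. indicator (A i) (x i) :: ennreal)"
    proof (cases "x \<in> (\<Pi>\<^sub>E i\<in>I. A i)")
      case True
      then have "(\<Prod>i\<in>I. indicator (A i) (x i) :: ennreal) = (\<Prod>i\<in>I. 1)"
        by (intro prod.cong) (auto simp: PiE_iff)
      then show ?thesis using True by simp
    next
      case False
      then obtain i where "i \<in> I" "x i \<notin> A i" using x by (auto simp: PiE_iff)
      then have "(\<Prod>i\<in>I. indicator (A i) (x i) :: ennreal) = 0"
        using I by (intro prod_zero bexI[of _ i]) auto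
      then show ?thesis using False by simp
    qed
    then show "ennreal (\<Prod>i\<in>I. std_normal_density (x i)) * indicator (\<Pi>\<^sub>E i\<in>I. A i) x =
        (\<Prod>i\<in>I. ennreal (std_normal_density (x i)) * indicator (A i) (x i))"
      by (simp add: prod.distrib prod_ennreal)
  qed
  also have "\<dots> = (\<Prod>i\<in>I. \<integral>\<^sup>+x. ennreal (std_normal_density x) * indicator (A i) x \<partial>lborel)"
    using A by (intro lborel_product.product_nn_integral_prod[OF I]) auto
  also have "\<dots> = (\<Prod>i\<in>I. emeasure std_gauss (A i))"
    using A unfolding std_gauss_def by (intro prod.cong refl emeasure_density[symmetric]) auto
  finally show "emeasure (density (\<Pi>\<^sub>M i\<in>I. lborel) (\<lambda>x. ennreal (gauss_weight (card I) (\<Sum>i\<in>I. (x i)\<^sup>2)))) (\<Pi>\<^sub>E i\<in>I. A i)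
      = (\<Prod>i\<in>I. emeasure std_gauss (A i))" .
qed (auto intro!: sets_PiM_cong)

abbreviation (input) entry_set :: "nat \<Rightarrow> nat \<Rightarrow> (nat \<times> nat) set" where
  "entry_set n m \<equiv> {..<n} \<times> {..<m}"

definition gauss_mat :: "nat \<Rightarrow> nat \<Rightarrow> real mat measure" where
  "gauss_mat n m = distr (\<Pi>\<^sub>M ij\<in>entry_set n m. std_gauss) (mat_borel n m) (Matrix.mat n m)"

lemma measurable_mat_of_entries:
  assumes "sets M = sets (\<Pi>\<^sub>M ij\<in>entry_set n m. (borel :: real measure))"
  shows "Matrix.mat n m \<in> measurable M (mat_borel n m)"
proof -
  have "Matrix.mat n m \<in> measurable (\<Pi>\<^sub>M ij\<in>entry_set n m. (borel :: real measure)) (mat_borel n m)"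
    by (rule measurable_mat_borelI) auto
  then show ?thesis by (simp add: measurable_cong_sets[OF assms refl])
qed

lemma measurable_entries:
  assumes f: "f \<in> measurable M (mat_borel n m)" and N: "sets N = sets (\<Pi>\<^sub>M ij\<in>entry_set n m. (borel :: real measure))"
  shows "(\<lambda>x. \<lambda>ij\<in>entry_set n m. f x $$ ij) \<in> measurable M N"
  unfolding measurable_cong_sets[OF refl N]
  by (intro measurable_restrict) (auto intro: measurable_entry[OF f])

lemma sets_PiM_std_gauss: "sets (\<Pi>\<^sub>M i\<in>I. std_gauss) = sets (\<Pi>\<^sub>M i\<in>I. (borel :: real measure))"
  by (intro sets_PiM_cong) auto

lemma sets_gauss_mat [simp, measurable_cong]: "sets (gauss_mat n m) = sets (mat_borel n m)"
  by (simp add: gauss_mat_def)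

lemma space_gauss_mat [simp]: "space (gauss_mat n m) = carrier_mat n m"
  by (simp add: gauss_mat_def)

lemma prob_space_gauss_mat: "prob_space (gauss_mat n m)"
  unfolding gauss_mat_def
  by (intro prob_space.prob_space_distr prob_space_PiM prob_space_std_gauss measurable_mat_of_entries sets_PiM_std_gauss)

lemma sum_squares_entries:
  fixes A :: "real mat"
  assumes "A \<in> carrier_mat n m"
  shows "(\<Sum>ij\<in>entry_set n m. (A $$ ij)\<^sup>2) = (\<Sum>j<m. (A\<^sup>T * A) $$ (j,j))"
proof -
  have "(\<Sum>ij\<in>entry_set n m. (A $$ ij)\<^sup>2) = (\<Sum>i<n. \<Sum>j<m. (A $$ (i,j))\<^sup>2)"
    by (simp add: sum.cartesian_product)
  also have "\<dots> = (\<Sum>j<m. \<Sum>i<n. (A $$ (i,j))\<^sup>2)"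
    by (rule sum.swap)
  also have "\<dots> = (\<Sum>j<m. (A\<^sup>T * A) $$ (j,j))"
    using assms by (intro sum.cong refl) (simp add: scalar_prod_def lessThan_atLeast0 flip: power2_eq_square)
  finally show ?thesis .
qed

text \<open>The product with \<open>g\<close> preserves the sum of the squares of all entries, since this is the trace
  of the Gram matrix.\<close>

lemma gauss_mat_rotation:
  assumes g: "g \<in> orthogonal_group n"
  shows "distr (gauss_mat n m) (mat_borel n m) (\<lambda>A. g * A) = gauss_mat n m"
proof -
  let ?I = "entry_set n m"
  let ?L = "\<Pi>\<^sub>M ij\<in>?I. (lborel :: real measure)" and ?G = "\<Pi>\<^sub>M ij\<in>?I. std_gauss"
  define T where "T h x = (\<lambda>ij\<in>?I. (h * Matrix.mat n m x) $$ ij)" for h and x :: "nat \<times> nat \<Rightarrow> real"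
  have I: "finite ?I" by simp
  note gd = orthogonalD(1,4,5)[OF g]
  have g': "g\<^sup>T \<in> orthogonal_group n" by (rule orthogonal_transpose[OF g])
  have mat_T: "Matrix.mat n m (T h x) = h * Matrix.mat n m x" if "h \<in> carrier_mat n n" for h x
    using that by (intro eq_matI) (auto simp: T_def simp del: index_mult_mat(1))
  have meas: "T h \<in> measurable ?L ?L" if "h \<in> carrier_mat n n" for h
    unfolding T_def using that
    by (intro measurable_entries measurable_mat_mult[of _ _ n n] measurable_mat_const measurable_mat_of_entries sets_PiM_lborel)
  have T_T: "T h (T h' x) = x" if "h \<in> orthogonal_group n" "h' = h\<^sup>T" "x \<in> space ?L" for h h' x
  proof -
    have "T h (T h' x) = (\<lambda>ij\<in>?I. (h * (h\<^sup>T * Matrix.mat n m x)) $$ ij)"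
      using that orthogonalD[OF that(1)] by (simp add: T_def[of h] mat_T)
    also have "\<dots> = (\<lambda>ij\<in>?I. x ij)"
      using orthogonal_cancel(2)[OF that(1), of "Matrix.mat n m x"] by auto
    finally show ?thesis using that(3) by (auto simp: space_PiM PiE_iff extensional_def fun_eq_iff)
  qed
  have norm: "(\<Sum>ij\<in>?I. (T g x ij)\<^sup>2) = (\<Sum>ij\<in>?I. (x ij)\<^sup>2)" for x
  proof -
    have "(\<Sum>ij\<in>?I. (T g x ij)\<^sup>2) = (\<Sum>ij\<in>?I. ((g * Matrix.mat n m x) $$ ij)\<^sup>2)"
      by (intro sum.cong) (auto simp: T_def simp del: index_mult_mat(1))
    also have "\<dots> = (\<Sum>j<m. ((g * Matrix.mat n m x)\<^sup>T * (g * Matrix.mat n m x)) $$ (j,j))"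
      using gd by (intro sum_squares_entries) auto
    also have "(g * Matrix.mat n m x)\<^sup>T * (g * Matrix.mat n m x) = (Matrix.mat n m x)\<^sup>T * Matrix.mat n m x"
      using gd orthogonal_cancel(1)[OF g, of "Matrix.mat n m x"] by (simp add: mat_transpose_mult mat_assoc)
    also have "(\<Sum>j<m. ((Matrix.mat n m x)\<^sup>T * Matrix.mat n m x) $$ (j,j)) = (\<Sum>ij\<in>?I. (Matrix.mat n m x $$ ij)\<^sup>2)"
      by (intro sum_squares_entries[symmetric]) auto
    also have "\<dots> = (\<Sum>ij\<in>?I. (x ij)\<^sup>2)"
      by (intro sum.cong) auto
    finally show ?thesis .
  qed
  have add: "T g (\<lambda>i\<in>?I. x i + b i) = (\<lambda>i\<in>?I. T g x i + T g b i)" for x b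
  proof -
    have "Matrix.mat n m (\<lambda>i\<in>?I. x i + b i) = Matrix.mat n m x + Matrix.mat n m b"
      by (intro eq_matI) auto
    then show ?thesis
      using gd by (auto simp: T_def mat_distrib_left fun_eq_iff simp del: index_mult_mat(1))
  qed
  have L: "distr ?L ?L (T g) = ?L"
    using I meas[of g] meas[of "g\<^sup>T"] gd T_T[OF g refl] T_T[OF g', of g] add norm
    by (intro isometry_preserves_lebesgue[where S="T (g\<^sup>T)"]) auto
  let ?f = "\<lambda>x. ennreal (gauss_weight (card ?I) (\<Sum>i\<in>?I. (x i)\<^sup>2))"
  have f: "?f \<in> borel_measurable ?L"
    unfolding gauss_weight_def by measurable
  have "distr ?G ?L (T g) = distr (density ?L (\<lambda>x. ?f (T g x))) ?L (T g)"
    unfolding PiM_std_gauss[OF I] norm ..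
  also have "\<dots> = density (distr ?L ?L (T g)) ?f"
    using f meas[of g] gd by (intro density_distr[symmetric]) auto
  also have "\<dots> = ?G"
    unfolding L PiM_std_gauss[OF I] ..
  finally have G: "distr ?G ?L (T g) = ?G" .
  have meas_G: "T g \<in> measurable ?G ?L"
    using meas[of g] gd by (simp add: measurable_cong_sets[OF sets_PiM_std_gauss refl] measurable_cong_sets[OF sets_PiM_lborel refl])
  have mg: "(\<lambda>A. g * A) \<in> measurable (mat_borel n m) (mat_borel n m)"
    using gd by (intro measurable_mat_mult[of _ _ n n] measurable_mat_const) auto
  have "distr (gauss_mat n m) (mat_borel n m) (\<lambda>A. g * A) = distr ?G (mat_borel n m) (\<lambda>x. g * Matrix.mat n m x)"
    unfolding gauss_mat_def using mg
    by (subst distr_distr) (auto simp: comp_def measurable_mat_of_entries sets_PiM_std_gauss)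
  also have "\<dots> = distr ?G (mat_borel n m) (\<lambda>x. Matrix.mat n m (T g x))"
    using gd by (simp add: mat_T)
  also have "\<dots> = distr (distr ?G ?L (T g)) (mat_borel n m) (Matrix.mat n m)"
    using meas_G by (subst distr_distr) (auto simp: comp_def measurable_mat_of_entries sets_PiM_lborel)
  also have "\<dots> = gauss_mat n m"
    unfolding G gauss_mat_def ..
  finally show ?thesis .
qed

definition mat_box :: "nat \<Rightarrow> nat \<Rightarrow> (nat \<times> nat \<Rightarrow> real set) \<Rightarrow> real mat set" where
  "mat_box n m E = {A \<in> carrier_mat n m. \<forall>i<n. \<forall>j<m. A $$ (i,j) \<in> E (i,j)}"

lemma mat_box_eq: "mat_box n m E = (\<lambda>A. \<lambda>ij\<in>entry_set n m. A $$ ij) -` (\<Pi>\<^sub>E ij\<in>entry_set n m. E ij) \<inter> carrier_mat n m"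
  by (auto simp: mat_box_def PiE_iff)

lemma sets_mat_box:
  assumes "\<And>ij. E ij \<in> sets borel"
  shows "mat_box n m E \<in> sets (mat_borel n m)"
proof -
  have "(\<lambda>A. \<lambda>ij\<in>entry_set n m. A $$ ij) -` (\<Pi>\<^sub>E ij\<in>entry_set n m. E ij) \<inter> space (mat_borel n m) \<in> sets (mat_borel n m)"
    using assms measurable_entries[of "\<lambda>x. x" "mat_borel n m" n m, OF _ refl]
    by (intro measurable_sets[where A="\<Pi>\<^sub>M ij\<in>entry_set n m. (borel :: real measure)"] sets_PiM_I_finite) auto
  then show ?thesis by (simp add: mat_box_eq)
qed

lemma emeasure_gauss_mat_box:
  assumes "\<And>ij. E ij \<in> sets borel"
  shows "emeasure (gauss_mat n m) (mat_box n m E) = (\<Prod>i<n. \<Prod>j<m. emeasure std_gauss (E (i,j)))"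
proof -
  let ?I = "entry_set n m"
  have "Matrix.mat n m -` mat_box n m E \<inter> space (\<Pi>\<^sub>M ij\<in>?I. std_gauss) = (\<Pi>\<^sub>E ij\<in>?I. E ij)"
    by (auto simp: mat_box_def space_PiM PiE_iff)
  then have "emeasure (gauss_mat n m) (mat_box n m E) = emeasure (\<Pi>\<^sub>M ij\<in>?I. std_gauss) (\<Pi>\<^sub>E ij\<in>?I. E ij)"
    unfolding gauss_mat_def using assms
    by (subst emeasure_distr) (auto simp: sets_mat_box measurable_mat_of_entries sets_PiM_std_gauss)
  also have "\<dots> = (\<Prod>ij\<in>?I. emeasure std_gauss (E ij))"
    using assms by (intro gauss_product.emeasure_PiM) auto
  also have "\<dots> = (\<Prod>i<n. \<Prod>j<m. emeasure std_gauss (E (i,j)))"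
    by (simp add: prod.cartesian_product)
  finally show ?thesis .
qed

text \<open>Boxes determine the law of independent entries.\<close>

lemma gauss_mat_eqI:
  assumes sets: "sets M = sets (mat_borel n m)"
    and box: "\<And>E. (\<And>ij. E ij \<in> sets borel) \<Longrightarrow>
      emeasure M (mat_box n m E) = (\<Prod>i<n. \<Prod>j<m. emeasure std_gauss (E (i,j)))"
  shows "M = gauss_mat n m"
proof -
  let ?I = "entry_set n m"
  let ?G = "\<Pi>\<^sub>M ij\<in>?I. std_gauss"
  let ?e = "\<lambda>A. \<lambda>ij\<in>?I. (A :: real mat) $$ ij"
  have space: "space M = carrier_mat n m"
    using sets_eq_imp_space_eq[OF sets] by simp
  have e: "?e \<in> measurable M ?G"
    using measurable_entries[of "\<lambda>x. x" M n m ?G] sets by (simp add: sets_PiM_std_gauss measurable_cong_sets[OF sets refl])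
  have mat: "Matrix.mat n m \<in> measurable ?G (mat_borel n m)"
    by (rule measurable_mat_of_entries[OF sets_PiM_std_gauss])
  have "distr M ?G ?e = ?G"
  proof (rule gauss_product.PiM_eqI)
    fix E :: "nat \<times> nat \<Rightarrow> real set" assume "\<And>ij. ij \<in> ?I \<Longrightarrow> E ij \<in> sets std_gauss"
    then have E: "\<And>ij. (if ij \<in> ?I then E ij else {}) \<in> sets borel" by auto
    have "mat_box n m (\<lambda>ij. if ij \<in> ?I then E ij else {}) = ?e -` (\<Pi>\<^sub>E ij\<in>?I. E ij) \<inter> space M"
      unfolding space mat_box_def by (auto simp: PiE_iff)
    then have "emeasure (distr M ?G ?e) (\<Pi>\<^sub>E ij\<in>?I. E ij) = emeasure M (mat_box n m (\<lambda>ij. if ij \<in> ?I then E ij else {}))"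
      using e \<open>\<And>ij. ij \<in> ?I \<Longrightarrow> E ij \<in> sets std_gauss\<close>
      by (subst emeasure_distr) (auto intro!: sets_PiM_I_finite)
    also have "\<dots> = (\<Prod>i<n. \<Prod>j<m. emeasure std_gauss (E (i,j)))"
      by (subst box[OF E]) auto
    also have "\<dots> = (\<Prod>ij\<in>?I. emeasure std_gauss (E ij))"
      by (simp add: prod.cartesian_product)
    finally show "emeasure (distr M ?G ?e) (\<Pi>\<^sub>E ij\<in>?I. E ij) = (\<Prod>ij\<in>?I. emeasure std_gauss (E ij))" .
  qed auto
  then have "gauss_mat n m = distr (distr M ?G ?e) (mat_borel n m) (Matrix.mat n m)"
    by (simp add: gauss_mat_def)
  also have "\<dots> = distr M (mat_borel n m) (\<lambda>A. Matrix.mat n m (?e A))"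
    using e mat by (subst distr_distr) (auto simp: comp_def)
  also have "\<dots> = distr M M (\<lambda>A. A)"
    using sets by (intro distr_cong) (auto simp: space intro!: eq_matI)
  finally show ?thesis by (simp add: distr_id)
qed

lemma gauss_mat_snoc_col:
  "distr (gauss_mat n m \<Otimes>\<^sub>M gauss_mat n 1) (mat_borel n (Suc m)) (\<lambda>(Z,y). snoc_col Z y) = gauss_mat n (Suc m)"
proof (rule gauss_mat_eqI)
  interpret Y: prob_space "gauss_mat n 1" by (rule prob_space_gauss_mat)
  fix E :: "nat \<times> nat \<Rightarrow> real set" assume E: "\<And>ij. E ij \<in> sets borel"
  have meas: "(\<lambda>(Z,y). snoc_col Z y) \<in> measurable (gauss_mat n m \<Otimes>\<^sub>M gauss_mat n 1) (mat_borel n (Suc m))"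
    by measurable
  have "(\<lambda>(Z,y). snoc_col Z y) -` mat_box n (Suc m) E \<inter> space (gauss_mat n m \<Otimes>\<^sub>M gauss_mat n 1)
      = mat_box n m E \<times> mat_box n 1 (\<lambda>(i,j). E (i,m))"
    by (auto simp: mat_box_def space_pair_measure snoc_col_index less_Suc_eq)
  then have "emeasure (distr (gauss_mat n m \<Otimes>\<^sub>M gauss_mat n 1) (mat_borel n (Suc m)) (\<lambda>(Z,y). snoc_col Z y)) (mat_box n (Suc m) E)
      = emeasure (gauss_mat n m \<Otimes>\<^sub>M gauss_mat n 1) (mat_box n m E \<times> mat_box n 1 (\<lambda>(i,j). E (i,m)))"
    using meas E by (subst emeasure_distr) (auto simp: sets_mat_box)
  also have "\<dots> = emeasure (gauss_mat n m) (mat_box n m E) * emeasure (gauss_mat n 1) (mat_box n 1 (\<lambda>(i,j). E (i,m)))"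
    using E by (intro Y.emeasure_pair_measure_Times) (auto intro!: sets_mat_box)
  also have "\<dots> = (\<Prod>i<n. \<Prod>j<m. emeasure std_gauss (E (i,j))) * (\<Prod>i<n. \<Prod>j<(1::nat). emeasure std_gauss (E (i,m)))"
    using E by (subst (1 2) emeasure_gauss_mat_box) auto
  also have "\<dots> = (\<Prod>i<n. \<Prod>j<Suc m. emeasure std_gauss (E (i,j)))"
    by (simp add: prod.distrib One_nat_def del: prod_constant)
  finally show "emeasure (distr (gauss_mat n m \<Otimes>\<^sub>M gauss_mat n 1) (mat_borel n (Suc m)) (\<lambda>(Z,y). snoc_col Z y)) (mat_box n (Suc m) E)
      = (\<Prod>i<n. \<Prod>j<Suc m. emeasure std_gauss (E (i,j)))" .
qed simp

lemma prod_shift_index: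
  fixes h :: "nat \<Rightarrow> 'a :: comm_monoid_mult"
  shows "(\<Prod>i<d + k. if i < d then 1 else h (i - d)) = (\<Prod>i<k. h i)"
  by (induction k) (auto intro: prod.neutral)

lemma gauss_mat_last_rows:
  assumes k: "k \<le> n"
  shows "distr (gauss_mat n m) (mat_borel k m) (\<lambda>A. (last_frame n k)\<^sup>T * A) = gauss_mat k m"
proof (rule gauss_mat_eqI)
  interpret std: prob_space std_gauss by (rule prob_space_std_gauss)
  let ?d = "n - k"
  fix E :: "nat \<times> nat \<Rightarrow> real set" assume E: "\<And>ij. E ij \<in> sets borel"
  have meas: "(\<lambda>A. (last_frame n k)\<^sup>T * A) \<in> measurable (gauss_mat n m) (mat_borel k m)"
    using k by (intro measurable_mat_mult[of _ _ _ n] measurable_mat_const) auto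
  \<comment> \<open>no condition on the first rows, so their factors are \<open>1\<close>\<close>
  define E' where "E' = (\<lambda>(i,j). if i < ?d then UNIV else E (i - ?d, j))"
  have idx: "((last_frame n k)\<^sup>T * A) $$ (i,j) = A $$ (?d + i, j)" if "A \<in> carrier_mat n m" "i < k" "j < m" for A i j
  proof -
    have "((last_frame n k)\<^sup>T * A) $$ (i,j) = (A\<^sup>T * last_frame n k)\<^sup>T $$ (i,j)"
      using that k by (simp add: mat_transpose_mult del: index_mult_mat(1))
    also have "\<dots> = (A\<^sup>T * last_frame n k) $$ (j,i)"
      using that k by simp
    also have "\<dots> = A $$ (?d + i, j)"
      using that k by (subst mult_last_frame_index) auto
    finally show ?thesis .
  qed
  have "(\<lambda>A. (last_frame n k)\<^sup>T * A) -` mat_box k m E \<inter> space (gauss_mat n m) = mat_box n m E'"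
  proof (intro equalityI subsetI)
    fix A assume A: "A \<in> (\<lambda>A. (last_frame n k)\<^sup>T * A) -` mat_box k m E \<inter> space (gauss_mat n m)"
    then have Ac: "A \<in> carrier_mat n m" by simp
    have "A $$ (i,j) \<in> E' (i,j)" if "i < n" "j < m" for i j
    proof (cases "i < ?d")
      case False
      then have "((last_frame n k)\<^sup>T * A) $$ (i - ?d,j) \<in> E (i - ?d, j)"
        using A that k by (auto simp: mat_box_def simp del: index_mult_mat(1))
      then show ?thesis
        using idx[OF Ac, of "i - ?d" j] False that k by (simp add: E'_def del: index_mult_mat(1))
    qed (simp add: E'_def)
    then show "A \<in> mat_box n m E'" using Ac by (simp add: mat_box_def)
  next
    fix A assume A: "A \<in> mat_box n m E'"
    then have Ac: "A \<in> carrier_mat n m" by (simp add: mat_box_def)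
    have "A $$ (?d + i, j) \<in> E (i, j)" if "i < k" "j < m" for i j
    proof -
      have "A $$ (?d + i, j) \<in> E' (?d + i, j)"
        using A that k by (simp add: mat_box_def)
      then show ?thesis by (simp add: E'_def)
    qed
    then show "A \<in> (\<lambda>A. (last_frame n k)\<^sup>T * A) -` mat_box k m E \<inter> space (gauss_mat n m)"
      using Ac k idx[OF Ac] by (simp add: mat_box_def del: index_mult_mat(1))
  qed
  then have "emeasure (distr (gauss_mat n m) (mat_borel k m) (\<lambda>A. (last_frame n k)\<^sup>T * A)) (mat_box k m E) =
      emeasure (gauss_mat n m) (mat_box n m E')"
    using meas E by (subst emeasure_distr) (auto simp: sets_mat_box)
  also have "\<dots> = (\<Prod>i<n. \<Prod>j<m. emeasure std_gauss (E' (i,j)))"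
    using E by (intro emeasure_gauss_mat_box) (auto simp: E'_def split: prod.split)
  also have "\<dots> = (\<Prod>i<?d + k. if i < ?d then 1 else \<Prod>j<m. emeasure std_gauss (E (i - ?d,j)))"
    using k std.emeasure_space_1 by (intro prod.cong) (auto simp: E'_def)
  also have "\<dots> = (\<Prod>i<k. \<Prod>j<m. emeasure std_gauss (E (i,j)))"
    by (rule prod_shift_index)
  finally show "emeasure (distr (gauss_mat n m) (mat_borel k m) (\<lambda>A. (last_frame n k)\<^sup>T * A)) (mat_box k m E) =
      (\<Prod>i<k. \<Prod>j<m. emeasure std_gauss (E (i,j)))" .
qed simp

text \<open>The entries of \<open>a' X\<close> are again independent standard Gaussians. For the last coordinate frame these are the last
  rows of \<open>X\<close>, and any other frame is a rotation of it.\<close>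

lemma gauss_mat_frame:
  assumes b: "b \<in> stiefel n k" and k: "k \<le> n"
  shows "distr (gauss_mat n m) (mat_borel k m) (\<lambda>A. b\<^sup>T * A) = gauss_mat k m"
proof -
  define g where "g = frame_section n k b"
  have g: "g \<in> orthogonal_group n" and b_eq: "g * last_frame n k = b"
    using frame_section[OF b k] by (auto simp: g_def)
  note gd = orthogonalD(4,5)[OF g]
  have m1: "(\<lambda>A. (last_frame n k)\<^sup>T * A) \<in> measurable (mat_borel n m) (mat_borel k m)"
    using k by (intro measurable_mat_mult[of _ _ _ n] measurable_mat_const) auto
  have m2: "(\<lambda>A. g\<^sup>T * A) \<in> measurable (gauss_mat n m) (mat_borel n m)"
    using gd by (intro measurable_mat_mult[of _ _ _ n] measurable_mat_const) auto
  have "distr (gauss_mat n m) (mat_borel k m) (\<lambda>A. b\<^sup>T * A) =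
      distr (gauss_mat n m) (mat_borel k m) (\<lambda>A. (last_frame n k)\<^sup>T * (g\<^sup>T * A))"
    using gd k by (intro distr_cong) (auto simp: b_eq[symmetric] mat_transpose_mult mat_assoc)
  also have "\<dots> = distr (distr (gauss_mat n m) (mat_borel n m) (\<lambda>A. g\<^sup>T * A)) (mat_borel k m) (\<lambda>A. (last_frame n k)\<^sup>T * A)"
    using m1 m2 by (subst distr_distr) (auto simp: comp_def)
  also have "\<dots> = distr (gauss_mat n m) (mat_borel k m) (\<lambda>A. (last_frame n k)\<^sup>T * A)"
    unfolding gauss_mat_rotation[OF orthogonal_transpose[OF g]] ..
  also have "\<dots> = gauss_mat k m"
    by (rule gauss_mat_last_rows[OF k])
  finally show ?thesis .
qed

section \<open>The chi-square distribution\<close>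

lemma emeasure_ball_set:
  assumes I: "finite I" and r: "r > 0"
  shows "emeasure (lebesgue_on I) (ball_set I r) = ennreal (r powr (card I / 2)) * emeasure (lebesgue_on I) (ball_set I 1)"
proof -
  let ?L = "lebesgue_on I" and ?a = "1 / sqrt r"
  let ?T = "\<lambda>x. \<lambda>i\<in>I. ?a * x i + 0"
  have a: "?a \<noteq> 0" using r by simp
  have T: "?T \<in> measurable ?L ?L" by measurable
  have sq: "(\<Sum>i\<in>I. (x i / sqrt r)\<^sup>2) = (\<Sum>i\<in>I. (x i)\<^sup>2) / r" for x :: "'a \<Rightarrow> real"
    using r by (simp add: power_divide sum_divide_distrib)
  have "?T -` ball_set I 1 \<inter> space ?L = ball_set I r"
    using r measurable_space[OF T] unfolding ball_set_def by (auto simp: sq)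
  then have "emeasure ?L (ball_set I r) = emeasure (distr ?L ?L ?T) (ball_set I 1)"
    using T I by (subst emeasure_distr) auto
  also have "\<dots> = ennreal (inverse \<bar>?a\<bar> ^ card I) * emeasure ?L (ball_set I 1)"
    by (subst PiM_lborel_affine[OF I a]) simp
  also have "inverse \<bar>?a\<bar> ^ card I = r powr (card I / 2)"
    using r by (simp add: powr_half_sqrt[symmetric] powr_realpow[symmetric] powr_powr)
  finally show ?thesis .
qed

text \<open>By scaling, the ball \<open>|x|\<^sup>2 < r\<close> has volume \<open>c r\<^bsup>d/2\<^esup>\<close>, where \<open>d\<close> is the dimension; the density is the derivative.\<close>

lemma lebesgue_radial:
  assumes I: "finite I" "I \<noteq> {}"
  obtains \<kappa> where "\<kappa> > 0"
    "distr (lebesgue_on I) borel (\<lambda>x. \<Sum>i\<in>I. (x i)\<^sup>2) =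
      density lborel (\<lambda>r. ennreal (indicator {0..} r * (\<kappa> * r powr (card I / 2 - 1))))"
proof -
  let ?L = "lebesgue_on I" and ?d = "real (card I) / 2"
  let ?q = "\<lambda>x. \<Sum>i\<in>I. (x i)\<^sup>2"
  have d: "?d > 0" using I by (simp add: card_gt_0_iff)
  define c where "c = measure ?L (ball_set I 1)"
  have ball1: "emeasure ?L (ball_set I 1) = ennreal c"
    using ball_set_finite[OF I(1), of 1] by (simp add: c_def emeasure_eq_ennreal_measure)
  have c: "c > 0" using ball_set_positive[OF I(1)] by (simp add: ball1)
  define \<kappa> where "\<kappa> = c * ?d"
  have \<kappa>: "\<kappa> > 0" using c d by (simp add: \<kappa>_def)
  let ?g = "\<lambda>r. ennreal (indicator {0..} r * (\<kappa> * r powr (?d - 1)))"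
  \<comment> \<open>\<open>measure_eqI_lessThan\<close> compares finite upper tails; here the lower tails are finite, so the sign is changed\<close>
  let ?M1 = "distr ?L borel (\<lambda>x. - ?q x)" and ?M2 = "distr (density lborel ?g) borel (\<lambda>r. - r)"
  have q[measurable]: "?q \<in> borel_measurable ?L" by measurable
  have tail1: "emeasure ?M1 {t<..} = emeasure ?L (ball_set I (- t))" for t
  proof -
    have "(\<lambda>x. - ?q x) -` {t<..} \<inter> space ?L = ball_set I (- t)"
      by (auto simp: ball_set_def)
    then show ?thesis by (subst emeasure_distr) auto
  qed
  have tail2: "emeasure ?M2 {t<..} = (\<integral>\<^sup>+r. ?g r * indicator {..<- t} r \<partial>lborel)" for t
  proof -
    have "(\<lambda>r. - r) -` {t<..} \<inter> space (density lborel ?g) = {..<- t}" by auto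
    then show ?thesis by (subst emeasure_distr) (auto simp: emeasure_density)
  qed
  have "?M1 = ?M2"
  proof (rule measure_eqI_lessThan)
    show "emeasure ?M1 {t<..} < \<infinity>" for t
      unfolding tail1 by (rule ball_set_finite[OF I(1)])
    fix t :: real
    show "emeasure ?M1 {t<..} = emeasure ?M2 {t<..}"
    proof (cases "t < 0")
      case False
      have "\<not> ?q x < - t" for x using False sum_nonneg[of I "\<lambda>i. (x i)\<^sup>2"] by (auto simp: not_less intro: order_trans)
      then have "ball_set I (- t) = {}" by (auto simp: ball_set_def)
      moreover have "(\<integral>\<^sup>+r. ?g r * indicator {..<- t} r \<partial>lborel) = (\<integral>\<^sup>+r. 0 \<partial>(lborel :: real measure))"
        using False by (intro nn_integral_cong) (auto split: split_indicator)
      ultimately show ?thesis unfolding tail1 tail2 by simp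
    next
      case True
      let ?R = "- t"
      have "(\<integral>\<^sup>+r. ?g r * indicator {..<?R} r \<partial>lborel) = (\<integral>\<^sup>+r. ennreal (\<kappa> * r powr (?d - 1)) * indicator {0..?R} r \<partial>lborel)"
        using AE_lborel_singleton[of ?R] by (intro nn_integral_cong_AE) (auto split: split_indicator)
      also have "\<dots> = ennreal (\<kappa> * (?R powr (?d - 1 + 1) / (?d - 1 + 1)))"
        using \<kappa> d True by (intro nn_integral_has_integral_lebesgue' has_integral_mult_right has_integral_powr_from_0) auto
      also have "\<dots> = ennreal (?R powr ?d) * ennreal c"
        using d c by (simp add: \<kappa>_def ennreal_mult[symmetric] field_simps)
      also have "\<dots> = emeasure ?L (ball_set I ?R)"
        using True by (subst emeasure_ball_set[OF I(1)]) (auto simp: ball1)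
      finally show ?thesis unfolding tail1 tail2 ..
    qed
  qed auto
  then have "distr ?M1 borel uminus = distr ?M2 borel uminus" by simp
  then have "distr ?L borel ?q = distr (density lborel ?g) borel (\<lambda>r. r)"
    by (simp add: distr_distr comp_def)
  also have "\<dots> = distr (density lborel ?g) (density lborel ?g) (\<lambda>r. r)"
    by (intro distr_cong) auto
  also have "\<dots> = density lborel ?g"
    by (rule distr_id)
  finally show ?thesis using that[OF \<kappa>] by simp
qed

text \<open>The squared norm of a vector, for vectors in the form of matrices with one column.\<close>

definition sq_norm :: "real mat \<Rightarrow> real" where
  "sq_norm y = (y\<^sup>T * y) $$ (0,0)"

lemma measurable_sq_norm [measurable]: "sq_norm \<in> borel_measurable (mat_borel n 1)"
  unfolding sq_norm_def by (rule measurable_entry[of _ _ 1 1]) auto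

lemma sq_norm_nonneg: "dim_col y = 1 \<Longrightarrow> 0 \<le> sq_norm y"
  unfolding sq_norm_def by (auto simp: scalar_prod_def intro!: sum_nonneg)

text \<open>The constant is left open; in \<open>chi_square_moment\<close> the total mass determines it.\<close>

lemma chi_square_law:
  assumes n: "1 \<le> n"
  obtains K where "K > 0"
    "distr (gauss_mat n 1) borel sq_norm =
      density lborel (\<lambda>r. ennreal (indicator {0..} r * (K * r powr (real n / 2 - 1) * exp (- r / 2))))"
proof -
  let ?I = "entry_set n 1"
  let ?L = "\<Pi>\<^sub>M i\<in>?I. (lborel :: real measure)" and ?G = "\<Pi>\<^sub>M i\<in>?I. std_gauss"
  let ?q = "\<lambda>x. \<Sum>i\<in>?I. (x i)\<^sup>2"
  have I: "finite ?I" "?I \<noteq> {}" using n by (auto simp: lessThan_empty_iff)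
  obtain \<kappa> where \<kappa>: "\<kappa> > 0" and rad: "distr ?L borel ?q = density lborel (\<lambda>r. ennreal (indicator {0..} r * (\<kappa> * r powr (card ?I / 2 - 1))))"
    by (rule lebesgue_radial[OF I])
  define K where "K = \<kappa> * (1 / sqrt (2 * pi)) ^ n"
  have q[measurable]: "?q \<in> borel_measurable ?L" by measurable
  have w[measurable]: "(\<lambda>r. ennreal (gauss_weight n r)) \<in> borel_measurable borel"
    unfolding gauss_weight_def by measurable
  have "distr (gauss_mat n 1) borel sq_norm = distr ?G borel (\<lambda>x. sq_norm (Matrix.mat n 1 x))"
    unfolding gauss_mat_def
    by (subst distr_distr) (auto simp: comp_def measurable_mat_of_entries sets_PiM_std_gauss)
  also have "\<dots> = distr ?G borel ?q"
  proof (rule distr_cong)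
    fix x :: "nat \<times> nat \<Rightarrow> real"
    have "?q x = (\<Sum>ij\<in>?I. (Matrix.mat n 1 x $$ ij)\<^sup>2)"
      by (intro sum.cong) auto
    also have "\<dots> = (\<Sum>j<1. ((Matrix.mat n 1 x)\<^sup>T * Matrix.mat n 1 x) $$ (j,j))"
      by (intro sum_squares_entries) auto
    finally show "sq_norm (Matrix.mat n 1 x) = ?q x"
      by (simp add: sq_norm_def One_nat_def del: index_mult_mat(1))
  qed auto
  also have "\<dots> = distr (density ?L (\<lambda>x. ennreal (gauss_weight n (?q x)))) borel ?q"
    by (simp add: PiM_std_gauss[OF I(1)] card_cartesian_product)
  also have "\<dots> = density (distr ?L borel ?q) (\<lambda>r. ennreal (gauss_weight n r))"
    by (intro density_distr[symmetric]) measurable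
  also have "\<dots> = density lborel (\<lambda>r. ennreal (indicator {0..} r * (\<kappa> * r powr (card ?I / 2 - 1))) * ennreal (gauss_weight n r))"
    unfolding rad by (intro density_density_eq) (auto simp: gauss_weight_def)
  also have "\<dots> = density lborel (\<lambda>r. ennreal (indicator {0..} r * (K * r powr (real n / 2 - 1) * exp (- r / 2))))"
    using \<kappa> by (intro arg_cong[where f="density lborel"] ext, subst ennreal_mult[symmetric])
      (auto simp: K_def gauss_weight_def card_cartesian_product split: split_indicator)
  finally show ?thesis
    using that[of K] \<kappa> by (simp add: K_def)
qed

text \<open>The complex logarithm of a real number is split into its real part and its argument, which is \<open>0\<close> or \<open>\<pi>\<close>.\<close>

lemma measurable_of_real_powr [measurable (raw)]:
  fixes f :: "'a \<Rightarrow> real" and s :: complex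
  assumes f: "f \<in> borel_measurable M"
  shows "(\<lambda>x. complex_of_real (f x) powr s) \<in> borel_measurable M"
proof -
  have eq: "complex_of_real r powr s = (if r = 0 then 0 else
      exp (s * (complex_of_real (ln \<bar>r\<bar>) + (if r < 0 then pi * \<i> else 0))))" for r :: real
    by (simp add: powr_def Ln_of_real')
  have of_real: "(\<lambda>r. complex_of_real (ln \<bar>r\<bar>)) \<in> borel_measurable borel"
    by (intro measurable_compose[OF _ borel_measurable_continuous_onI[OF continuous_on_of_real_id]]) measurable
  have exp: "(exp :: complex \<Rightarrow> complex) \<in> borel_measurable borel"
    by (intro borel_measurable_continuous_onI continuous_intros)
  have "(\<lambda>r. complex_of_real r powr s) \<in> borel_measurable borel"
    unfolding eq
    by (intro measurable_If measurable_compose[OF _ exp] borel_measurable_times borel_measurable_add of_real) auto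
  from measurable_compose[OF f this] show ?thesis .
qed

lemma gamma_integral_half:
  assumes z: "Re z > 0"
  shows "has_bochner_integral lborel
    (\<lambda>r. indicator {0..} r *\<^sub>R (complex_of_real r powr (z - 1) * of_real (exp (- r / 2)))) (2 powr z * Gamma z)"
proof -
  let ?f = "\<lambda>r. indicator {0<..} r *\<^sub>R (complex_of_real r powr (z - 1) / of_real (exp r))"
  let ?h = "\<lambda>r. indicator {0..} r *\<^sub>R (complex_of_real r powr (z - 1) * of_real (exp (- r / 2)))"
  have f_meas[measurable]: "?f \<in> borel_measurable lborel" by measurable
  have si: "set_integrable lebesgue {0<..} (\<lambda>r. complex_of_real r powr (z - 1) / of_real (exp r))"
    by (rule absolutely_integrable_Gamma_integral'[OF z])
  then have f1: "integrable lborel ?f"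
    unfolding set_integrable_def by (subst integrable_completion[symmetric]) auto
  have "integral\<^sup>L lborel ?f = (LINT r:{0<..}|lebesgue. complex_of_real r powr (z - 1) / of_real (exp r))"
    unfolding set_lebesgue_integral_def by (rule integral_completion[symmetric]) auto
  also have "\<dots> = Gamma z"
    using set_lebesgue_integral_eq_integral(2)[OF si] Gamma_integral_complex'[OF z] by (simp add: integral_unique)
  finally have f2: "integral\<^sup>L lborel ?f = Gamma z" .
  \<comment> \<open>the substitution \<open>r = 2 x\<close>\<close>
  have h: "?h (0 + 2 * x) = 2 powr (z - 1) * ?f x" for x
  proof (cases "x > 0")
    case True
    have "complex_of_real (2 * x) powr (z - 1) = 2 powr (z - 1) * complex_of_real x powr (z - 1)"
      using True by (subst powr_times_real[symmetric]) auto
    then show ?thesis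
      using True by (simp add: exp_minus field_simps)
  qed (auto split: split_indicator)
  have "integrable lborel (\<lambda>x. ?h (0 + 2 * x))"
    unfolding h by (rule integrable_mult_right) (rule f1)
  then have h1: "integrable lborel ?h"
    by (subst (asm) lborel_integrable_real_affine_iff) auto
  have "integral\<^sup>L lborel ?h = \<bar>2\<bar> *\<^sub>R (\<integral>x. ?h (0 + 2 * x) \<partial>lborel)"
    by (rule lborel_integral_real_affine) simp
  also have "\<dots> = 2 * (2 powr (z - 1) * Gamma z)"
    unfolding h integral_mult_right_zero f2 by (simp add: scaleR_conv_of_real)
  also have "\<dots> = 2 powr z * Gamma z"
    by (simp add: powr_diff)
  finally show ?thesis using h1 by (simp add: has_bochner_integral_iff)
qed

text \<open>The case \<open>s = 0\<close>, in which the moment is the total mass, gives the normalizing constant.\<close>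

lemma chi_square_moment:
  assumes n: "1 \<le> n" and s: "Re s > - real n / 2"
  shows "has_bochner_integral (gauss_mat n 1) (\<lambda>y. complex_of_real (sq_norm y) powr s)
    (2 powr s * Gamma (of_nat n / 2 + s) / Gamma (of_nat n / 2))"
proof -
  obtain K where K: "K > 0" and law: "distr (gauss_mat n 1) borel sq_norm =
      density lborel (\<lambda>r. ennreal (indicator {0..} r * (K * r powr (real n / 2 - 1) * exp (- r / 2))))"
    by (rule chi_square_law[OF n])
  let ?g = "\<lambda>r. indicator {0..} r * (K * r powr (real n / 2 - 1) * exp (- r / 2)) :: real"
  interpret G: prob_space "gauss_mat n 1" by (rule prob_space_gauss_mat)
  have mom: "has_bochner_integral (distr (gauss_mat n 1) borel sq_norm) (\<lambda>r. complex_of_real r powr t)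
      (complex_of_real K * (2 powr (of_nat n / 2 + t) * Gamma (of_nat n / 2 + t)))" if t: "Re t > - real n / 2" for t :: complex
  proof -
    let ?z = "of_nat n / 2 + t :: complex"
    have z: "Re ?z > 0" using t by simp
    have eq: "?g r *\<^sub>R complex_of_real r powr t =
        complex_of_real K * (indicator {0..} r *\<^sub>R (complex_of_real r powr (?z - 1) * of_real (exp (- r / 2))))" for r
    proof (cases "r > 0")
      case True
      then have "complex_of_real (r powr (real n / 2 - 1)) = complex_of_real r powr (of_nat n / 2 - 1)"
        by (subst powr_of_real[symmetric]) auto
      then have "complex_of_real (r powr (real n / 2 - 1)) * complex_of_real r powr t = complex_of_real r powr (?z - 1)"
        using True by (simp add: powr_add[symmetric] algebra_simps)
      then show ?thesis using True
        by (simp add: scaleR_conv_of_real mult_ac)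
    qed (auto split: split_indicator simp: less_le)
    have "has_bochner_integral lborel (\<lambda>r. ?g r *\<^sub>R complex_of_real r powr t) (complex_of_real K * (2 powr ?z * Gamma ?z))"
      unfolding eq by (intro has_bochner_integral_mult_right gamma_integral_half[OF z])
    then show ?thesis
      unfolding law using K
      by (auto simp: has_bochner_integral_iff integrable_density integral_density)
  qed
  \<comment> \<open>the exponent \<open>0\<close>; the power is \<open>0\<close> instead of \<open>1\<close> at \<open>r = 0\<close>, which is a null set\<close>
  have zero: "AE r in distr (gauss_mat n 1) borel sq_norm. complex_of_real r powr 0 = 1"
    unfolding law using AE_lborel_singleton[of 0] by (subst AE_density) auto
  have "1 = integral\<^sup>L (distr (gauss_mat n 1) borel sq_norm) (\<lambda>r. 1 :: complex)"
    using prob_space.prob_space[OF G.prob_space_distr[of sq_norm borel]] by simp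
  also have "\<dots> = integral\<^sup>L (distr (gauss_mat n 1) borel sq_norm) (\<lambda>r. complex_of_real r powr 0)"
    using zero by (intro integral_cong_AE) auto
  also have "\<dots> = complex_of_real K * (2 powr (of_nat n / 2) * Gamma (of_nat n / 2))"
    using mom[of 0] n by (simp add: has_bochner_integral_iff)
  finally have K1: "complex_of_real K * (2 powr (of_nat n / 2) * Gamma (of_nat n / 2)) = (1 :: complex)" ..
  then have "Gamma (of_nat n / 2 :: complex) \<noteq> 0" by auto
  then have "complex_of_real K * (2 powr (of_nat n / 2 + s) * Gamma (of_nat n / 2 + s)) =
      (complex_of_real K * (2 powr (of_nat n / 2) * Gamma (of_nat n / 2))) * (2 powr s * Gamma (of_nat n / 2 + s) / Gamma (of_nat n / 2))"
    unfolding powr_add by simp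
  then have val: "complex_of_real K * (2 powr (of_nat n / 2 + s) * Gamma (of_nat n / 2 + s)) =
      2 powr s * Gamma (of_nat n / 2 + s) / Gamma (of_nat n / 2)"
    unfolding K1 by simp
  show ?thesis
    using mom[OF s] unfolding val has_bochner_integral_iff
    by (simp add: integrable_distr_eq[where f="\<lambda>r. complex_of_real r powr s"]
        integral_distr[where f="\<lambda>r. complex_of_real r powr s"])
qed

lemma AE_sq_norm_nonzero:
  assumes n: "1 \<le> n"
  shows "AE y in gauss_mat n 1. sq_norm y \<noteq> 0"
proof -
  obtain K where law: "distr (gauss_mat n 1) borel sq_norm =
      density lborel (\<lambda>r. ennreal (indicator {0..} r * (K * r powr (real n / 2 - 1) * exp (- r / 2))))"
    by (rule chi_square_law[OF n])
  have "AE r in distr (gauss_mat n 1) borel sq_norm. r \<noteq> 0"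
    unfolding law using AE_lborel_singleton[of 0] by (subst AE_density) auto
  then show ?thesis by (subst (asm) AE_distr_iff) auto
qed

section \<open>Existence of invariant measures\<close>

definition invariant_on_stiefel :: "nat \<Rightarrow> nat \<Rightarrow> real mat measure \<Rightarrow> bool" where
  "invariant_on_stiefel n m \<mu> \<longleftrightarrow> sets \<mu> = sets (stiefel_borel n m) \<and> prob_space \<mu> \<and>
     (\<forall>g\<in>orthogonal_group n. distr \<mu> \<mu> (\<lambda>v. g * v) = \<mu>)"

lemma measurable_mult_stiefel:
  assumes g: "g \<in> orthogonal_group n"
  shows "(\<lambda>v. g * v) \<in> measurable (stiefel_borel n m) (stiefel_borel n m)"
proof (rule measurable_stiefel_borelI)
  show "g * v \<in> stiefel n m" if "v \<in> space (stiefel_borel n m)" for v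
    using that orthogonal_mult_stiefel[OF g] by simp
  show "(\<lambda>v. g * v) \<in> measurable (stiefel_borel n m) (mat_borel n m)"
    by (rule measurable_mat_mult[OF measurable_mat_const[OF orthogonalD(1)[OF g]] measurable_stiefel_ident])
qed

lemma measurable_mult_stiefel_right:
  assumes e: "e \<in> stiefel n m"
  shows "(\<lambda>g. g * e) \<in> measurable (stiefel_borel n n) (stiefel_borel n m)"
proof (rule measurable_stiefel_borelI)
  show "g * e \<in> stiefel n m" if "g \<in> space (stiefel_borel n n)" for g
    using that orthogonal_mult_stiefel[OF _ e] by (simp add: stiefel_square)
  show "(\<lambda>g. g * e) \<in> measurable (stiefel_borel n n) (mat_borel n m)"
    by (rule measurable_mat_mult[OF measurable_stiefel_ident measurable_mat_const[OF stiefelD(1)[OF e]]])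
qed

lemma measurable_mult_stiefel_pair [measurable (raw)]:
  assumes "f \<in> measurable M (stiefel_borel n k)" "h \<in> measurable M (stiefel_borel k m)"
  shows "(\<lambda>x. f x * h x) \<in> measurable M (stiefel_borel n m)"
proof (rule measurable_stiefel_borelI)
  show "f x * h x \<in> stiefel n m" if "x \<in> space M" for x
    using measurable_space[OF assms(1) that] measurable_space[OF assms(2) that] by (simp add: stiefel_mult)
qed (rule measurable_mat_mult[OF assms[THEN measurable_stiefel_mat]])

lemma measurable_transpose_stiefel [measurable (raw)]:
  assumes "f \<in> measurable M (stiefel_borel n n)"
  shows "(\<lambda>x. (f x)\<^sup>T) \<in> measurable M (stiefel_borel n n)"
proof (rule measurable_stiefel_borelI)
  show "(f x)\<^sup>T \<in> stiefel n n" if "x \<in> space M" for x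
    using measurable_space[OF assms that] by (simp add: stiefel_square orthogonal_transpose)
qed (rule measurable_mat_transpose[OF measurable_stiefel_mat[OF assms]])

lemma invariantD:
  assumes "invariant_on_stiefel n m \<mu>"
  shows "sets \<mu> = sets (stiefel_borel n m)" "prob_space \<mu>" "space \<mu> = stiefel n m"
  using assms sets_eq_imp_space_eq[of \<mu> "stiefel_borel n m"] by (auto simp: invariant_on_stiefel_def)

lemma invariant_nn_integral:
  assumes \<mu>: "invariant_on_stiefel n m \<mu>" and g: "g \<in> orthogonal_group n"
    and F: "F \<in> borel_measurable (stiefel_borel n m)"
  shows "(\<integral>\<^sup>+v. F (g * v) \<partial>\<mu>) = (\<integral>\<^sup>+v. F v \<partial>\<mu>)"
proof -
  note [measurable_cong] = invariantD(1)[OF \<mu>]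
  note [measurable] = measurable_mult_stiefel[OF g, of m] F
  have "(\<integral>\<^sup>+v. F v \<partial>\<mu>) = (\<integral>\<^sup>+v. F v \<partial>(distr \<mu> \<mu> (\<lambda>v. g * v)))"
    using \<mu> g by (simp add: invariant_on_stiefel_def)
  also have "\<dots> = (\<integral>\<^sup>+v. F (g * v) \<partial>\<mu>)"
    by (rule nn_integral_distr) measurable
  finally show ?thesis ..
qed

lemma invariantI:
  assumes sets: "sets \<mu> = sets (stiefel_borel n m)" and "prob_space \<mu>"
    and inv: "\<And>g F. g \<in> orthogonal_group n \<Longrightarrow> F \<in> borel_measurable (stiefel_borel n m) \<Longrightarrow>
      (\<integral>\<^sup>+v. F (g * v) \<partial>\<mu>) = (\<integral>\<^sup>+v. F v \<partial>\<mu>)"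
  shows "invariant_on_stiefel n m \<mu>"
  unfolding invariant_on_stiefel_def
proof (intro conjI ballI assms)
  fix g assume g: "g \<in> orthogonal_group n"
  note [measurable_cong] = sets
  note [measurable] = measurable_mult_stiefel[OF g, of m]
  show "distr \<mu> \<mu> (\<lambda>v. g * v) = \<mu>"
  proof (rule measure_eqI)
    fix A assume "A \<in> sets (distr \<mu> \<mu> (\<lambda>v. g * v))"
    then have A[measurable]: "A \<in> sets \<mu>" "A \<in> sets (stiefel_borel n m)" using sets by auto
    have "emeasure (distr \<mu> \<mu> (\<lambda>v. g * v)) A = (\<integral>\<^sup>+v. indicator A v \<partial>(distr \<mu> \<mu> (\<lambda>v. g * v)))"
      by simp
    also have "\<dots> = (\<integral>\<^sup>+v. indicator A (g * v) \<partial>\<mu>)"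
      by (rule nn_integral_distr) measurable
    also have "\<dots> = (\<integral>\<^sup>+v. indicator A v \<partial>\<mu>)"
      by (rule inv[OF g]) measurable
    finally show "emeasure (distr \<mu> \<mu> (\<lambda>v. g * v)) A = emeasure \<mu> A"
      by simp
  qed simp
qed

text \<open>A Gaussian vector divided by its norm. The value at the zero vector only has to be a unit vector, since
  the zero vector has probability zero.\<close>

lemma sphere_measure_exists:
  assumes n: "1 \<le> n"
  shows "\<exists>\<mu>. invariant_on_stiefel n 1 \<mu>"
proof -
  let ?G = "gauss_mat n 1"
  define \<phi> where "\<phi> y = (if sq_norm y = 0 then first_frame n 1 else (1 / sqrt (sq_norm y)) \<cdot>\<^sub>m y)" for y
  interpret G: prob_space ?G by (rule prob_space_gauss_mat)
  have \<phi>_mem: "\<phi> y \<in> stiefel n 1" if y: "y \<in> carrier_mat n 1" for y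
  proof (cases "sq_norm y = 0")
    case True
    then show ?thesis using first_frame_stiefel[OF n] by (simp add: \<phi>_def)
  next
    case False
    then have pos: "sq_norm y > 0" using sq_norm_nonneg[of y] y by simp
    have "y\<^sup>T * y = sq_norm y \<cdot>\<^sub>m 1\<^sub>m 1"
      unfolding sq_norm_def using y by (intro mat_1x1) auto
    then have "((1 / sqrt (sq_norm y)) \<cdot>\<^sub>m y)\<^sup>T * ((1 / sqrt (sq_norm y)) \<cdot>\<^sub>m y) = 1\<^sub>m 1"
      using y pos by (simp add: mat_transpose_smult mat_smult_left mat_smult_right mat_smult_smult)
        (auto intro!: eq_matI)
    then show ?thesis using y False by (intro stiefelI) (auto simp: \<phi>_def)
  qed
  have \<phi>_meas: "\<phi> \<in> measurable (mat_borel n 1) (stiefel_borel n 1)"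
  proof (rule measurable_stiefel_borelI[OF \<phi>_mem])
    show "\<phi> \<in> measurable (mat_borel n 1) (mat_borel n 1)"
      unfolding \<phi>_def
    proof (rule measurable_If)
      show "(\<lambda>y. (1 / sqrt (sq_norm y)) \<cdot>\<^sub>m y) \<in> measurable (mat_borel n 1) (mat_borel n 1)"
        by (rule measurable_mat_smult) measurable
      show "{y \<in> space (mat_borel n 1). sq_norm y = 0} \<in> sets (mat_borel n 1)"
        by measurable
    qed (rule measurable_mat_const[OF stiefelD(1)[OF first_frame_stiefel[OF n]]])
  qed simp
  let ?\<mu> = "distr ?G (stiefel_borel n 1) \<phi>"
  have "invariant_on_stiefel n 1 ?\<mu>"
  proof (rule invariantI)
    show "prob_space ?\<mu>"
      using \<phi>_meas by (intro G.prob_space_distr) simp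
    fix g and F :: "real mat \<Rightarrow> ennreal"
    assume g: "g \<in> orthogonal_group n" and F[measurable]: "F \<in> borel_measurable (stiefel_borel n 1)"
    note gd = orthogonalD(4,5)[OF g]
    note [measurable] = \<phi>_meas measurable_mult_stiefel[OF g, of 1]
    have g_meas[measurable]: "(\<lambda>A. g * A) \<in> measurable (mat_borel n 1) (mat_borel n 1)"
      using gd by (intro measurable_mat_mult[of _ _ n n] measurable_mat_const) auto
    have "(\<integral>\<^sup>+v. F (g * v) \<partial>?\<mu>) = (\<integral>\<^sup>+y. F (g * \<phi> y) \<partial>?G)"
      by (rule nn_integral_distr) measurable
    also have "\<dots> = (\<integral>\<^sup>+y. F (\<phi> (g * y)) \<partial>?G)"
    proof (rule nn_integral_cong_AE)
      show "AE y in ?G. F (g * \<phi> y) = F (\<phi> (g * y))"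
        using AE_sq_norm_nonzero[OF n] AE_space
      proof eventually_elim
        case (elim y)
        then have y: "dim_row y = n" "dim_col y = 1" by auto
        have "sq_norm (g * y) = sq_norm y"
          using gd y orthogonal_cancel(1)[OF g y(1)]
          by (simp add: sq_norm_def mat_transpose_mult mat_assoc del: index_mult_mat(1))
        then have "g * \<phi> y = \<phi> (g * y)"
          using elim gd y by (simp add: \<phi>_def mat_smult_right)
        then show ?case by simp
      qed
    qed
    also have "\<dots> = (\<integral>\<^sup>+y. F (\<phi> y) \<partial>(distr ?G (mat_borel n 1) (\<lambda>A. g * A)))"
      by (rule nn_integral_distr[symmetric]) measurable
    also have "\<dots> = (\<integral>\<^sup>+v. F v \<partial>?\<mu>)"
      unfolding gauss_mat_rotation[OF g] by (rule nn_integral_distr[symmetric]) measurable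
    finally show "(\<integral>\<^sup>+v. F (g * v) \<partial>?\<mu>) = (\<integral>\<^sup>+v. F v \<partial>?\<mu>)" .
  qed simp
  then show ?thesis by blast
qed

text \<open>A random frame is built from a random unit vector \<open>c\<close> as its last column and a random frame in the orthogonal
  complement of \<open>c\<close>. If \<open>c\<close> is rotated by \<open>g\<close>, then the rotated complement is identified with
  coordinate space by another section, and the two identifications differ by an orthogonal \<open>h\<close>, which depends
  on \<open>c\<close> but leaves the law of the inner frame unchanged.\<close>

lemma invariant_measure_extend:
  assumes n: "1 \<le> n" and s: "invariant_on_stiefel n 1 \<sigma>" and \<nu>: "invariant_on_stiefel (n - 1) m \<nu>"
  shows "\<exists>\<mu>. invariant_on_stiefel n (Suc m) \<mu>"
proof -
  let ?F = "first_frame n (n - 1)" and ?E = "last_frame n 1"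
  define B where "B w = snoc_col (?F * w) ?E" for w
  define \<Phi> where "\<Phi> = (\<lambda>(c, w). frame_section n 1 c * B w)"
  note [measurable_cong] = invariantD(1)[OF s] invariantD(1)[OF \<nu>]
  interpret s: prob_space \<sigma> by (rule invariantD(2)[OF s])
  interpret \<nu>: prob_space \<nu> by (rule invariantD(2)[OF \<nu>])
  interpret sn: pair_prob_space \<sigma> \<nu> ..
  have B_mem: "B w \<in> stiefel n (Suc m)" if "w \<in> stiefel (n - 1) m" for w
    unfolding B_def by (rule embed_stiefel[OF that n])
  have sec: "frame_section n 1 c \<in> orthogonal_group n" "frame_section n 1 c * ?E = c" if "c \<in> stiefel n 1" for c
    using frame_section[OF that n] by auto
  have \<Phi>_meas[measurable]: "\<Phi> \<in> measurable (\<sigma> \<Otimes>\<^sub>M \<nu>) (stiefel_borel n (Suc m))"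
  proof (rule measurable_stiefel_borelI)
    have c: "(\<lambda>x. fst x) \<in> measurable (\<sigma> \<Otimes>\<^sub>M \<nu>) (stiefel_borel n 1)"
      and w: "(\<lambda>x. snd x) \<in> measurable (\<sigma> \<Otimes>\<^sub>M \<nu>) (stiefel_borel (n - 1) m)"
      by measurable
    show "\<Phi> \<in> measurable (\<sigma> \<Otimes>\<^sub>M \<nu>) (mat_borel n (Suc m))"
      unfolding \<Phi>_def B_def case_prod_beta using n
      by (intro measurable_mat_mult[of _ _ n n] measurable_frame_section measurable_snoc_col
          measurable_mat_mult[of _ _ n "n - 1"] measurable_mat_const measurable_stiefel_mat[OF c] measurable_stiefel_mat[OF w]) auto
    fix x assume "x \<in> space (\<sigma> \<Otimes>\<^sub>M \<nu>)"
    then show "\<Phi> x \<in> stiefel n (Suc m)"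
      using sec(1) B_mem by (auto simp: \<Phi>_def space_pair_measure invariantD(3)[OF s] invariantD(3)[OF \<nu>] intro: orthogonal_mult_stiefel)
  qed
  let ?\<mu> = "distr (\<sigma> \<Otimes>\<^sub>M \<nu>) (stiefel_borel n (Suc m)) \<Phi>"
  have "invariant_on_stiefel n (Suc m) ?\<mu>"
  proof (rule invariantI)
    show "prob_space ?\<mu>" by (intro sn.prob_space_distr) measurable
    fix g and F :: "real mat \<Rightarrow> ennreal"
    assume g: "g \<in> orthogonal_group n" and F[measurable]: "F \<in> borel_measurable (stiefel_borel n (Suc m))"
    note [measurable] = measurable_mult_stiefel[OF g, of "Suc m"] measurable_mult_stiefel[OF g, of 1]
    have inner: "(\<integral>\<^sup>+w. F (g * \<Phi> (c, w)) \<partial>\<nu>) = (\<integral>\<^sup>+w. F (\<Phi> (g * c, w)) \<partial>\<nu>)" if c: "c \<in> stiefel n 1" for c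
    proof -
      have gc: "g * c \<in> stiefel n 1" by (rule orthogonal_mult_stiefel[OF g c])
      let ?a = "frame_section n 1 c" and ?b = "frame_section n 1 (g * c)"
      \<comment> \<open>this fixes the last basis vector, so it is \<open>diag(h, 1)\<close>\<close>
      define k where "k = ?b\<^sup>T * (g * ?a)"
      have k: "k \<in> orthogonal_group n"
        unfolding k_def by (intro orthogonal_mult orthogonal_transpose g sec c gc)
      note d = orthogonalD(4,5)[OF g] orthogonalD(4,5)[OF sec(1)[OF c]] orthogonalD(4,5)[OF sec(1)[OF gc]] orthogonalD(4,5)[OF k]
      have "k * ?E = ?b\<^sup>T * (g * (?a * ?E))"
        unfolding k_def using d n by (simp add: mat_assoc)
      also have "\<dots> = ?b\<^sup>T * (?b * ?E)"
        using sec(2)[OF c] sec(2)[OF gc] by simp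
      also have "\<dots> = ?E"
        using n by (intro orthogonal_cancel(1)[OF sec(1)[OF gc]]) simp
      finally have kE: "k * ?E = ?E" .
      obtain h where h: "h \<in> orthogonal_group (n - 1)" and kF: "k * ?F = ?F * h"
        by (rule last_frame_stabilizer[OF n k kE])
      note hd = orthogonalD(4,5)[OF h]
      have "g * \<Phi> (c, w) = \<Phi> (g * c, h * w)" if w: "w \<in> stiefel (n - 1) m" for w
      proof -
        note wd = stiefelD(3,4)[OF w]
        have Bd: "dim_row (B w) = n" using n by (simp add: B_def)
        have "g * (?a * B w) = ?b * (?b\<^sup>T * (g * (?a * B w)))"
          using d Bd by (intro orthogonal_cancel(2)[OF sec(1)[OF gc], symmetric]) simp
        also have "\<dots> = ?b * (k * B w)"
          unfolding k_def using d Bd by (simp add: mat_assoc)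
        also have "k * B w = snoc_col (k * (?F * w)) (k * ?E)"
          unfolding B_def using d n wd by (intro mult_snoc_col) auto
        also have "k * (?F * w) = ?F * (h * w)"
          using mult_eq_cancel[OF kF, of w] d n wd hd by (simp add: mat_assoc)
        finally show ?thesis
          unfolding \<Phi>_def B_def kE by simp
      qed
      then have "(\<integral>\<^sup>+w. F (g * \<Phi> (c, w)) \<partial>\<nu>) = (\<integral>\<^sup>+w. F (\<Phi> (g * c, h * w)) \<partial>\<nu>)"
        by (intro nn_integral_cong) (simp add: invariantD(3)[OF \<nu>])
      also have "\<dots> = (\<integral>\<^sup>+w. F (\<Phi> (g * c, w)) \<partial>\<nu>)"
      proof (rule invariant_nn_integral[OF \<nu> h])
        have "Pair (g * c) \<in> measurable \<nu> (\<sigma> \<Otimes>\<^sub>M \<nu>)"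
          using gc by (intro measurable_Pair1') (simp add: invariantD(3)[OF s])
        from measurable_compose[OF measurable_compose[OF this \<Phi>_meas] F]
        have "(\<lambda>w. F (\<Phi> (g * c, w))) \<in> borel_measurable \<nu>" .
        then show "(\<lambda>w. F (\<Phi> (g * c, w))) \<in> borel_measurable (stiefel_borel (n - 1) m)"
          by (simp add: measurable_cong_sets[OF invariantD(1)[OF \<nu>] refl])
      qed
      finally show ?thesis .
    qed
    have "(\<integral>\<^sup>+v. F (g * v) \<partial>?\<mu>) = (\<integral>\<^sup>+x. F (g * \<Phi> x) \<partial>(\<sigma> \<Otimes>\<^sub>M \<nu>))"
      by (rule nn_integral_distr) measurable
    also have "\<dots> = (\<integral>\<^sup>+c. \<integral>\<^sup>+w. F (g * \<Phi> (c, w)) \<partial>\<nu> \<partial>\<sigma>)"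
      by (rule \<nu>.nn_integral_fst[symmetric]) measurable
    also have "\<dots> = (\<integral>\<^sup>+c. \<integral>\<^sup>+w. F (\<Phi> (g * c, w)) \<partial>\<nu> \<partial>\<sigma>)"
      by (rule nn_integral_cong) (simp only: inner invariantD(3)[OF s])
    also have "\<dots> = (\<integral>\<^sup>+c. \<integral>\<^sup>+w. F (\<Phi> (c, w)) \<partial>\<nu> \<partial>\<sigma>)"
    proof (rule invariant_nn_integral[OF s g])
      have "(\<lambda>c. \<integral>\<^sup>+w. F (\<Phi> (c, w)) \<partial>\<nu>) \<in> borel_measurable \<sigma>" by measurable
      then show "(\<lambda>c. \<integral>\<^sup>+w. F (\<Phi> (c, w)) \<partial>\<nu>) \<in> borel_measurable (stiefel_borel n 1)"
        by (simp add: measurable_cong_sets[OF invariantD(1)[OF s] refl])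
    qed
    also have "\<dots> = (\<integral>\<^sup>+x. F (\<Phi> x) \<partial>(\<sigma> \<Otimes>\<^sub>M \<nu>))"
      by (rule \<nu>.nn_integral_fst) measurable
    also have "\<dots> = (\<integral>\<^sup>+v. F v \<partial>?\<mu>)"
      by (rule nn_integral_distr[symmetric]) measurable
    finally show "(\<integral>\<^sup>+v. F (g * v) \<partial>?\<mu>) = (\<integral>\<^sup>+v. F v \<partial>?\<mu>)" .
  qed simp
  then show ?thesis by blast
qed

lemma invariant_measure_exists: "m \<le> n \<Longrightarrow> \<exists>\<mu>. invariant_on_stiefel n m \<mu>"
proof (induction m arbitrary: n)
  case 0
  have stiefel0: "stiefel n 0 = {0\<^sub>m n 0}"
    by (auto simp: stiefel_def intro!: eq_matI)
  have "invariant_on_stiefel n 0 (return (stiefel_borel n 0) (0\<^sub>m n 0))"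
  proof (rule invariantI)
    fix g and F :: "real mat \<Rightarrow> ennreal"
    assume g: "g \<in> orthogonal_group n" and F[measurable]: "F \<in> borel_measurable (stiefel_borel n 0)"
    have "g * 0\<^sub>m n 0 = 0\<^sub>m n 0" using orthogonalD(4,5)[OF g] by (simp add: mat_zero_right)
    then show "(\<integral>\<^sup>+v. F (g * v) \<partial>return (stiefel_borel n 0) (0\<^sub>m n 0)) = (\<integral>\<^sup>+v. F v \<partial>return (stiefel_borel n 0) (0\<^sub>m n 0))"
      using measurable_compose[OF measurable_mult_stiefel[OF g, of 0] F]
      by (subst (1 2) nn_integral_return) (auto simp: stiefel0)
  qed (auto intro!: prob_space_return simp: stiefel0)
  then show ?case by blast
next
  case (Suc m)
  then have n: "1 \<le> n" "m \<le> n - 1" by auto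
  show ?case
    using sphere_measure_exists[OF n(1)] Suc.IH[OF n(2)] invariant_measure_extend[OF n(1)] by blast
qed

section \<open>Haar measure and uniqueness\<close>

text \<open>Both frames are images of the last coordinate frame.\<close>

lemma stiefel_transitive:
  assumes "m \<le> n" "v \<in> stiefel n m" "e \<in> stiefel n m"
  obtains p where "p \<in> orthogonal_group n" "p * e = v"
proof
  let ?a = "frame_section n m v" and ?b = "frame_section n m e"
  note a = frame_section[OF assms(2,1)] and b = frame_section[OF assms(3,1)]
  show "?a * ?b\<^sup>T \<in> orthogonal_group n"
    by (intro orthogonal_mult orthogonal_transpose a b)
  have "?b\<^sup>T * e = last_frame n m"
    using orthogonal_cancel(1)[OF b(1), of "last_frame n m"] assms(1) b(2) by simp
  then show "?a * ?b\<^sup>T * e = v"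
    using orthogonalD(4,5)[OF a(1)] orthogonalD(4,5)[OF b(1)] stiefelD(3,4)[OF assms(3)] a(2) by (simp add: mat_assoc)
qed

text \<open>The double integral of \<open>F (h' g)\<close>, evaluated in both orders.\<close>

lemma haar_transpose:
  assumes H: "invariant_on_stiefel n n H" and F: "F \<in> borel_measurable (stiefel_borel n n)"
  shows "(\<integral>\<^sup>+g. F (g\<^sup>T) \<partial>H) = (\<integral>\<^sup>+g. F g \<partial>H)"
proof -
  interpret H: prob_space H by (rule invariantD(2)[OF H])
  interpret pair_prob_space H H ..
  note [measurable_cong] = invariantD(1)[OF H]
  note [measurable] = F
  have "(\<integral>\<^sup>+g. F (g\<^sup>T) \<partial>H) = (\<integral>\<^sup>+g. \<integral>\<^sup>+h. F (h\<^sup>T) \<partial>H \<partial>H)"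
    by (simp add: H.emeasure_space_1)
  also have "\<dots> = (\<integral>\<^sup>+g. \<integral>\<^sup>+h. F ((g\<^sup>T * h)\<^sup>T) \<partial>H \<partial>H)"
  proof (rule nn_integral_cong)
    fix g assume "g \<in> space H"
    then have "g\<^sup>T \<in> orthogonal_group n" by (simp add: invariantD(3)[OF H] stiefel_square orthogonal_transpose)
    then show "(\<integral>\<^sup>+h. F (h\<^sup>T) \<partial>H) = (\<integral>\<^sup>+h. F ((g\<^sup>T * h)\<^sup>T) \<partial>H)"
      by (intro invariant_nn_integral[OF H, symmetric]) measurable
  qed
  also have "\<dots> = (\<integral>\<^sup>+g. \<integral>\<^sup>+h. F (h\<^sup>T * g) \<partial>H \<partial>H)"
    by (intro nn_integral_cong) (auto simp: invariantD(3)[OF H] mat_transpose_mult stiefel_def)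
  also have "\<dots> = (\<integral>\<^sup>+h. \<integral>\<^sup>+g. F (h\<^sup>T * g) \<partial>H \<partial>H)"
    by (rule Fubini'[symmetric]) measurable
  also have "\<dots> = (\<integral>\<^sup>+h. \<integral>\<^sup>+g. F g \<partial>H \<partial>H)"
  proof (rule nn_integral_cong)
    fix h assume "h \<in> space H"
    then have "h\<^sup>T \<in> orthogonal_group n" by (simp add: invariantD(3)[OF H] stiefel_square orthogonal_transpose)
    then show "(\<integral>\<^sup>+g. F (h\<^sup>T * g) \<partial>H) = (\<integral>\<^sup>+g. F g \<partial>H)"
      by (intro invariant_nn_integral[OF H]) measurable
  qed
  also have "\<dots> = (\<integral>\<^sup>+g. F g \<partial>H)"
    by (simp add: H.emeasure_space_1)
  finally show ?thesis .
qed

text \<open>Transposition turns left into right invariance.\<close>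

lemma haar_right:
  assumes H: "invariant_on_stiefel n n H" and F: "F \<in> borel_measurable (stiefel_borel n n)"
    and p: "p \<in> orthogonal_group n"
  shows "(\<integral>\<^sup>+g. F (g * p) \<partial>H) = (\<integral>\<^sup>+g. F g \<partial>H)"
proof -
  note [measurable] = F
  have pm[measurable]: "(\<lambda>g. g * p) \<in> measurable (stiefel_borel n n) (stiefel_borel n n)"
    using p by (intro measurable_mult_stiefel_right) (simp add: stiefel_square)
  have "(\<integral>\<^sup>+g. F (g * p) \<partial>H) = (\<integral>\<^sup>+g. F (g\<^sup>T * p) \<partial>H)"
    by (rule haar_transpose[OF H, symmetric]) measurable
  also have "\<dots> = (\<integral>\<^sup>+g. F ((p\<^sup>T * g)\<^sup>T) \<partial>H)"
    using orthogonalD(4,5)[OF p]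
    by (intro nn_integral_cong) (auto simp: invariantD(3)[OF H] mat_transpose_mult stiefel_def)
  also have "\<dots> = (\<integral>\<^sup>+g. F (g\<^sup>T) \<partial>H)"
    by (rule invariant_nn_integral[OF H orthogonal_transpose[OF p]]) measurable
  also have "\<dots> = (\<integral>\<^sup>+g. F g \<partial>H)"
    by (rule haar_transpose[OF H F])
  finally show ?thesis .
qed

text \<open>For any invariant \<open>\<mu>\<close>, average over \<open>O(n)\<close> and exchange the integrals: the inner integral
  of \<open>F (g v)\<close> over \<open>g\<close> does not depend on the frame \<open>v\<close>, by transitivity and right invariance. This gives both uniqueness
  and a formula.\<close>

lemma invariant_eq_haar:
  assumes H: "invariant_on_stiefel n n H" and \<mu>: "invariant_on_stiefel n m \<mu>" and m: "m \<le> n"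
    and e: "e \<in> stiefel n m" and F: "F \<in> borel_measurable (stiefel_borel n m)"
  shows "(\<integral>\<^sup>+v. F v \<partial>\<mu>) = (\<integral>\<^sup>+g. F (g * e) \<partial>H)"
proof -
  interpret H: prob_space H by (rule invariantD(2)[OF H])
  interpret \<mu>: prob_space \<mu> by (rule invariantD(2)[OF \<mu>])
  interpret pair_prob_space H \<mu> ..
  note [measurable_cong] = invariantD(1)[OF H] invariantD(1)[OF \<mu>]
  note [measurable] = F measurable_mult_stiefel_right[OF e]
  have "(\<integral>\<^sup>+v. F v \<partial>\<mu>) = (\<integral>\<^sup>+g. \<integral>\<^sup>+v. F v \<partial>\<mu> \<partial>H)"
    by (simp add: H.emeasure_space_1)
  also have "\<dots> = (\<integral>\<^sup>+g. \<integral>\<^sup>+v. F (g * v) \<partial>\<mu> \<partial>H)"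
    by (intro nn_integral_cong invariant_nn_integral[OF \<mu>, symmetric] F) (auto simp: invariantD(3)[OF H] stiefel_square)
  also have "\<dots> = (\<integral>\<^sup>+v. \<integral>\<^sup>+g. F (g * v) \<partial>H \<partial>\<mu>)"
    by (rule Fubini'[symmetric]) measurable
  also have "\<dots> = (\<integral>\<^sup>+v. \<integral>\<^sup>+g. F (g * e) \<partial>H \<partial>\<mu>)"
  proof (rule nn_integral_cong)
    fix v assume "v \<in> space \<mu>"
    then have "v \<in> stiefel n m" by (simp add: invariantD(3)[OF \<mu>])
    then obtain p where p: "p \<in> orthogonal_group n" "p * e = v"
      using stiefel_transitive[OF m _ e] by blast
    have "(\<integral>\<^sup>+g. F (g * e) \<partial>H) = (\<integral>\<^sup>+g. F (g * p * e) \<partial>H)"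
      by (rule haar_right[OF H _ p(1), symmetric]) measurable
    also have "\<dots> = (\<integral>\<^sup>+g. F (g * v) \<partial>H)"
      using orthogonalD(4,5)[OF p(1)] stiefelD(3)[OF e]
      by (intro nn_integral_cong) (auto simp: invariantD(3)[OF H] mat_assoc p(2)[symmetric] stiefel_def)
    finally show "(\<integral>\<^sup>+g. F (g * v) \<partial>H) = (\<integral>\<^sup>+g. F (g * e) \<partial>H)" ..
  qed
  also have "\<dots> = (\<integral>\<^sup>+g. F (g * e) \<partial>H)"
    by (simp add: \<mu>.emeasure_space_1)
  finally show ?thesis .
qed

lemma invariant_unique:
  assumes m: "m \<le> n" and \<mu>: "invariant_on_stiefel n m \<mu>" and \<nu>: "invariant_on_stiefel n m \<nu>"
  shows "\<mu> = \<nu>"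
proof (rule measure_eqI)
  obtain H where H: "invariant_on_stiefel n n H" using invariant_measure_exists by blast
  note e = first_frame_stiefel[OF m]
  fix A assume "A \<in> sets \<mu>"
  then have [measurable]: "A \<in> sets (stiefel_borel n m)" and A: "A \<in> sets \<mu>" "A \<in> sets \<nu>"
    using invariantD(1)[OF \<mu>] invariantD(1)[OF \<nu>] by auto
  have "(\<integral>\<^sup>+v. indicator A v \<partial>\<mu>) = (\<integral>\<^sup>+v. indicator A v \<partial>\<nu>)"
    by (subst invariant_eq_haar[OF H \<mu> m e] invariant_eq_haar[OF H \<nu> m e], measurable)+
  then show "emeasure \<mu> A = emeasure \<nu> A" using A by simp
qed (simp add: invariantD(1)[OF \<mu>] invariantD(1)[OF \<nu>])

lemma stiefel_measure_invariant:
  assumes "m \<le> n"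
  shows "invariant_on_stiefel n m (stiefel_measure n m)"
proof -
  have "stiefel_measure n m = (THE \<mu>. invariant_on_stiefel n m \<mu>)"
    by (simp add: stiefel_measure_def invariant_on_stiefel_def)
  moreover have "\<exists>!\<mu>. invariant_on_stiefel n m \<mu>"
    using invariant_measure_exists[OF assms] invariant_unique[OF assms] by blast
  ultimately show ?thesis by (simp add: theI')
qed

lemma sets_stiefel_measure: "m \<le> n \<Longrightarrow> sets (stiefel_measure n m) = sets (stiefel_borel n m)"
  by (rule invariantD(1)[OF stiefel_measure_invariant])

lemma space_stiefel_measure: "m \<le> n \<Longrightarrow> space (stiefel_measure n m) = stiefel n m"
  by (rule invariantD(3)[OF stiefel_measure_invariant])

lemma prob_space_stiefel_measure: "m \<le> n \<Longrightarrow> prob_space (stiefel_measure n m)"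
  by (rule invariantD(2)[OF stiefel_measure_invariant])

lemma measurable_stiefel_measure_iff:
  assumes "m \<le> n"
  shows "f \<in> measurable (stiefel_measure n m) N \<longleftrightarrow> f \<in> measurable (stiefel_borel n m) N"
    "g \<in> measurable N (stiefel_measure n m) \<longleftrightarrow> g \<in> measurable N (stiefel_borel n m)"
  using measurable_cong_sets[OF sets_stiefel_measure[OF assms] refl, of N]
    measurable_cong_sets[OF refl sets_stiefel_measure[OF assms], of N] by auto

abbreviation (input) haar :: "nat \<Rightarrow> real mat measure" where
  "haar n \<equiv> stiefel_measure n n"

lemma stiefel_nn_integral_haar:
  assumes "m \<le> n" "e \<in> stiefel n m" "F \<in> borel_measurable (stiefel_borel n m)"
  shows "(\<integral>\<^sup>+v. F v \<partial>stiefel_measure n m) = (\<integral>\<^sup>+g. F (g * e) \<partial>haar n)"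
  by (rule invariant_eq_haar[OF stiefel_measure_invariant[OF order_refl] stiefel_measure_invariant[OF assms(1)] assms])

lemma measurable_gram_det [measurable (raw)]:
  "f \<in> measurable M (mat_borel n m) \<Longrightarrow> (\<lambda>x. gram_det (f x)) \<in> borel_measurable M"
  unfolding gram_det_def by (intro measurable_det measurable_mat_mult[of _ _ _ n] measurable_mat_transpose)

lemma measurable_gram_det_ident [measurable]: "gram_det \<in> borel_measurable (mat_borel n m)"
  using measurable_gram_det[of "\<lambda>x. x" "mat_borel n m" n m] by simp

lemma measurable_gram_det_left_frame:
  assumes "a \<in> carrier_mat n k"
  shows "(\<lambda>v. gram_det (a\<^sup>T * v)) \<in> borel_measurable (stiefel_borel n m)"
proof -
  have "a\<^sup>T \<in> carrier_mat k n" using assms by simp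
  then show ?thesis
    by (rule measurable_gram_det[OF measurable_mat_mult[OF measurable_mat_const measurable_stiefel_ident]])
qed

lemma measurable_gram_det_right_frame:
  assumes "q \<in> carrier_mat n m"
  shows "(\<lambda>t. gram_det (t\<^sup>T * q)) \<in> borel_measurable (stiefel_borel n k)"
  by (rule measurable_gram_det[OF measurable_mat_mult[OF measurable_mat_transpose[OF measurable_stiefel_ident] measurable_mat_const[OF assms]]])

lemma measure_eqI_nn_integral:
  assumes sets: "sets M = sets N"
    and eq: "\<And>F. F \<in> borel_measurable M \<Longrightarrow> (\<integral>\<^sup>+x. F x \<partial>M) = (\<integral>\<^sup>+x. F x \<partial>N)"
  shows "M = N"
proof (rule measure_eqI[OF sets])
  fix A assume A: "A \<in> sets M"
  then have "(\<integral>\<^sup>+x. indicator A x \<partial>M) = (\<integral>\<^sup>+x. indicator A x \<partial>N)"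
    by (intro eq) auto
  then show "emeasure M A = emeasure N A" using A sets by simp
qed

section \<open>Moments of Gram determinants\<close>

text \<open>The last column \<open>y\<close> is fixed first. The other columns are Gaussian, so their projection to the complement of \<open>y\<close> is, in
  coordinates, an \<open>n - 1\<close> by \<open>m\<close> Gaussian matrix whose law does not depend on \<open>y\<close>.\<close>

lemma gauss_gram_det_law:
  assumes n: "1 \<le> n"
  shows "distr (gauss_mat n (Suc m)) borel gram_det =
    distr (gauss_mat n 1 \<Otimes>\<^sub>M gauss_mat (n - 1) m) borel (\<lambda>(y, W). sq_norm y * gram_det W)"
proof (rule measure_eqI_nn_integral)
  fix F :: "real \<Rightarrow> ennreal" assume "F \<in> borel_measurable (distr (gauss_mat n (Suc m)) borel gram_det)"
  then have F[measurable]: "F \<in> borel_measurable borel" by simp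
  let ?Z = "gauss_mat n m" and ?Y = "gauss_mat n 1" and ?W = "gauss_mat (n - 1) m"
  interpret Z: prob_space ?Z by (rule prob_space_gauss_mat)
  interpret Y: prob_space ?Y by (rule prob_space_gauss_mat)
  interpret W: prob_space ?W by (rule prob_space_gauss_mat)
  interpret ZY: pair_prob_space ?Z ?Y ..
  have m1[measurable]: "(\<lambda>(Z, y). snoc_col Z y) \<in> measurable (?Z \<Otimes>\<^sub>M ?Y) (mat_borel n (Suc m))"
    by measurable
  have meas[measurable]: "(\<lambda>x. gram_det (snoc_col (fst x) (snd x))) \<in> borel_measurable (?Z \<Otimes>\<^sub>M ?Y)"
    by measurable
  have "(\<integral>\<^sup>+x. F x \<partial>distr (gauss_mat n (Suc m)) borel gram_det) = (\<integral>\<^sup>+X. F (gram_det X) \<partial>gauss_mat n (Suc m))"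
    by (rule nn_integral_distr) auto
  also have "\<dots> = (\<integral>\<^sup>+x. F (gram_det (case x of (Z, y) \<Rightarrow> snoc_col Z y)) \<partial>(?Z \<Otimes>\<^sub>M ?Y))"
    unfolding gauss_mat_snoc_col[symmetric] by (rule nn_integral_distr[OF m1]) simp
  also have "\<dots> = (\<integral>\<^sup>+y. \<integral>\<^sup>+Z. F (gram_det (snoc_col Z y)) \<partial>?Z \<partial>?Y)"
    by (subst ZY.nn_integral_snd[symmetric]) (auto simp: case_prod_beta)
  also have "\<dots> = (\<integral>\<^sup>+y. \<integral>\<^sup>+W. F (sq_norm y * gram_det W) \<partial>?W \<partial>?Y)"
  proof (rule nn_integral_cong)
    fix y assume "y \<in> space ?Y"
    then have y: "dim_row y = n" "dim_col y = 1" by auto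
    obtain c t where c: "c \<in> stiefel n 1" and yc: "y = t \<cdot>\<^sub>m c" and t: "t\<^sup>2 = (y\<^sup>T * y) $$ (0,0)"
      by (rule scaled_unit_vector[OF y n])
    let ?g = "frame_section n 1 c"
    note g = frame_section[OF c n]
    define b where "b = ?g * first_frame n (n - 1)"
    have b: "b \<in> stiefel n (n - 1)"
      unfolding b_def by (intro orthogonal_mult_stiefel g first_frame_stiefel) simp
    have "gram_det (snoc_col Z y) = sq_norm y * gram_det (b\<^sup>T * Z)" if Z: "Z \<in> carrier_mat n m" for Z
    proof -
      have "b\<^sup>T * Z = (first_frame n (n - 1))\<^sup>T * (?g\<^sup>T * Z)"
        using Z orthogonalD(4,5)[OF g(1)] by (simp add: b_def mat_transpose_mult mat_assoc)
      moreover have "y = t \<cdot>\<^sub>m (?g * last_frame n 1)" by (simp add: g(2) yc)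
      ultimately show ?thesis
        using gram_det_snoc_col[OF _ _ n g(1), of Z m t] Z t unfolding sq_norm_def
        by (simp del: index_mult_mat(1))
    qed
    then have "(\<integral>\<^sup>+Z. F (gram_det (snoc_col Z y)) \<partial>?Z) = (\<integral>\<^sup>+Z. F (sq_norm y * gram_det (b\<^sup>T * Z)) \<partial>?Z)"
      by (intro nn_integral_cong) simp
    also have "\<dots> = (\<integral>\<^sup>+W. F (sq_norm y * gram_det W) \<partial>distr ?Z (mat_borel (n - 1) m) (\<lambda>Z. b\<^sup>T * Z))"
    proof (rule nn_integral_distr[symmetric])
      show "(\<lambda>Z. b\<^sup>T * Z) \<in> measurable ?Z (mat_borel (n - 1) m)"
        using stiefelD(1)[OF b] by (intro measurable_mat_mult[of _ _ _ n] measurable_mat_const) auto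
    qed measurable
    also have "\<dots> = (\<integral>\<^sup>+W. F (sq_norm y * gram_det W) \<partial>?W)"
      by (subst gauss_mat_frame[OF b]) auto
    finally show "(\<integral>\<^sup>+Z. F (gram_det (snoc_col Z y)) \<partial>?Z) = (\<integral>\<^sup>+W. F (sq_norm y * gram_det W) \<partial>?W)" .
  qed
  also have "\<dots> = (\<integral>\<^sup>+x. F (case x of (y, W) \<Rightarrow> sq_norm y * gram_det W) \<partial>(?Y \<Otimes>\<^sub>M ?W))"
    by (subst W.nn_integral_fst[symmetric]) auto
  also have "\<dots> = (\<integral>\<^sup>+x. F x \<partial>distr (?Y \<Otimes>\<^sub>M ?W) borel (\<lambda>(y, W). sq_norm y * gram_det W))"
    by (rule nn_integral_distr[symmetric]) measurable
  finally show "(\<integral>\<^sup>+x. F x \<partial>distr (gauss_mat n (Suc m)) borel gram_det) =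
      (\<integral>\<^sup>+x. F x \<partial>distr (?Y \<Otimes>\<^sub>M ?W) borel (\<lambda>(y, W). sq_norm y * gram_det W))" .
qed simp

lemma (in pair_sigma_finite) has_bochner_integral_prod_mult:
  fixes f :: "'a \<Rightarrow> complex" and g :: "'b \<Rightarrow> complex"
  assumes f: "has_bochner_integral M1 f a" and g: "has_bochner_integral M2 g b"
  shows "has_bochner_integral (M1 \<Otimes>\<^sub>M M2) (\<lambda>(x, y). f x * g y) (a * b)"
proof -
  have fi: "integrable M1 f" "integral\<^sup>L M1 f = a" and gi: "integrable M2 g" "integral\<^sup>L M2 g = b"
    using f g by (auto simp: has_bochner_integral_iff)
  have [measurable]: "f \<in> borel_measurable M1" "g \<in> borel_measurable M2" using fi gi by auto
  have int: "integrable (M1 \<Otimes>\<^sub>M M2) (\<lambda>(x, y). f x * g y)"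
  proof (rule Fubini_integrable)
    show "integrable M1 (\<lambda>x. LINT y|M2. norm (case (x, y) of (x, y) \<Rightarrow> f x * g y))"
      using fi by (simp add: norm_mult)
    show "AE x in M1. integrable M2 (\<lambda>y. case (x, y) of (x, y) \<Rightarrow> f x * g y)"
      using gi by simp
  qed measurable
  have "integral\<^sup>L (M1 \<Otimes>\<^sub>M M2) (\<lambda>(x, y). f x * g y) = (LINT x|M1. LINT y|M2. f x * g y)"
    using integral_fst'[OF int] by simp
  also have "\<dots> = a * b" by (simp add: fi gi)
  finally show ?thesis using int by (simp add: has_bochner_integral_iff)
qed

lemma of_real_mult_powr:
  "0 \<le> a \<Longrightarrow> 0 \<le> b \<Longrightarrow> complex_of_real (a * b) powr s = complex_of_real a powr s * complex_of_real b powr s"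
  by (simp add: powr_times_real)

lemma has_bochner_integral_distr_of_real_powr:
  assumes "g \<in> borel_measurable M"
  shows "has_bochner_integral (distr M borel g) (\<lambda>r. complex_of_real r powr s) z \<longleftrightarrow>
    has_bochner_integral M (\<lambda>x. complex_of_real (g x) powr s) z"
  using assms by (simp add: has_bochner_integral_iff integrable_distr_eq[where f="\<lambda>r. complex_of_real r powr s"]
        integral_distr[where f="\<lambda>r. complex_of_real r powr s"])

definition gauss_moment :: "nat \<Rightarrow> nat \<Rightarrow> complex \<Rightarrow> complex" where
  "gauss_moment n m s = (\<Prod>j<m. 2 powr s * Gamma (of_nat (n - j) / 2 + s) / Gamma (of_nat (n - j) / 2))"

text \<open>The moments of chi-square variables with \<open>n\<close>, \<open>n - 1\<close>, ..., \<open>n - m + 1\<close> degrees of freedom are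
  multiplied. The condition on \<open>s\<close> is the one for the last of them.\<close>

lemma gauss_gram_det_moment:
  assumes "m \<le> n" "Re s > (real m - 1 - real n) / 2"
  shows "has_bochner_integral (gauss_mat n m) (\<lambda>X. complex_of_real (gram_det X) powr s) (gauss_moment n m s)"
  using assms
proof (induction m arbitrary: n)
  case 0
  interpret prob_space "gauss_mat n 0" by (rule prob_space_gauss_mat)
  have "has_bochner_integral (gauss_mat n 0) (\<lambda>X. 1 :: complex) 1"
    using prob_space by (simp add: has_bochner_integral_iff)
  also have "?this \<longleftrightarrow> ?case"
    unfolding gauss_moment_def
    by (intro has_bochner_integral_cong) (auto simp: gram_det_def det_dim_zero)
  finally show ?case .
next
  case (Suc m)
  have n: "1 \<le> n" and mn: "m \<le> n - 1" and s: "Re s > (real m - real n) / 2" using Suc.prems by auto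
  let ?Y = "gauss_mat n 1" and ?W = "gauss_mat (n - 1) m"
  interpret Y: prob_space ?Y by (rule prob_space_gauss_mat)
  interpret W: prob_space ?W by (rule prob_space_gauss_mat)
  interpret YW: pair_prob_space ?Y ?W ..
  have "has_bochner_integral ?W (\<lambda>X. complex_of_real (gram_det X) powr s) (gauss_moment (n - 1) m s)"
    using n s by (intro Suc.IH[OF mn]) (simp add: of_nat_diff)
  moreover have "has_bochner_integral ?Y (\<lambda>y. complex_of_real (sq_norm y) powr s)
      (2 powr s * Gamma (of_nat n / 2 + s) / Gamma (of_nat n / 2))"
    using s by (intro chi_square_moment[OF n]) (simp add: field_simps)
  ultimately have "has_bochner_integral (?Y \<Otimes>\<^sub>M ?W)
      (\<lambda>(y, W). complex_of_real (sq_norm y) powr s * complex_of_real (gram_det W) powr s)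
      (2 powr s * Gamma (of_nat n / 2 + s) / Gamma (of_nat n / 2) * gauss_moment (n - 1) m s)"
    by (rule YW.has_bochner_integral_prod_mult[rotated])
  also have "2 powr s * Gamma (of_nat n / 2 + s) / Gamma (of_nat n / 2) * gauss_moment (n - 1) m s = gauss_moment n (Suc m) s"
    unfolding gauss_moment_def prod.lessThan_Suc_shift by (simp add: Suc_eq_plus1_left)
  also have "has_bochner_integral (?Y \<Otimes>\<^sub>M ?W)
      (\<lambda>(y, W). complex_of_real (sq_norm y) powr s * complex_of_real (gram_det W) powr s) (gauss_moment n (Suc m) s) \<longleftrightarrow>
      has_bochner_integral (?Y \<Otimes>\<^sub>M ?W) (\<lambda>x. complex_of_real (case x of (y, W) \<Rightarrow> sq_norm y * gram_det W) powr s) (gauss_moment n (Suc m) s)"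
    using mn by (intro has_bochner_integral_cong)
      (auto simp: space_pair_measure of_real_mult_powr sq_norm_nonneg gram_det_nonneg simp del: of_real_mult)
  also have "\<dots> \<longleftrightarrow> has_bochner_integral (distr (?Y \<Otimes>\<^sub>M ?W) borel (\<lambda>(y, W). sq_norm y * gram_det W))
      (\<lambda>r. complex_of_real r powr s) (gauss_moment n (Suc m) s)"
    by (rule has_bochner_integral_distr_of_real_powr[symmetric]) measurable
  also have "\<dots> \<longleftrightarrow> has_bochner_integral (gauss_mat n (Suc m)) (\<lambda>X. complex_of_real (gram_det X) powr s) (gauss_moment n (Suc m) s)"
    unfolding gauss_gram_det_law[OF n, symmetric] by (rule has_bochner_integral_distr_of_real_powr) measurable
  finally show ?case .
qed

lemma Gamma_nonzero_right_half_plane: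
  assumes "Re z > 0"
  shows "Gamma z \<noteq> 0"
proof -
  have "z \<notin> \<int>\<^sub>\<le>\<^sub>0"
  proof
    assume "z \<in> \<int>\<^sub>\<le>\<^sub>0"
    then obtain l where "z = of_int l" "l \<le> 0" by (elim nonpos_Ints_cases)
    then show False using assms by simp
  qed
  then show ?thesis by (simp add: Gamma_eq_zero_iff)
qed

lemma gauss_moment_nonzero:
  assumes "m \<le> n" "Re s > (real m - 1 - real n) / 2"
  shows "gauss_moment n m s \<noteq> 0"
proof -
  have "Gamma (of_nat (n - j) / 2 + s) \<noteq> 0" "Gamma (of_nat (n - j) / 2 :: complex) \<noteq> 0" if j: "j < m" for j
  proof -
    have "real (Suc j) \<le> real m"
      using j by (intro of_nat_mono) simp
    then have pos: "Re (of_nat (n - j) / 2 + s) > 0" "Re (of_nat (n - j) / 2 :: complex) > 0"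
      using j assms by (auto simp: of_nat_diff field_simps)
    from pos[THEN Gamma_nonzero_right_half_plane]
    show "Gamma (of_nat (n - j) / 2 + s) \<noteq> 0" "Gamma (of_nat (n - j) / 2 :: complex) \<noteq> 0" .
  qed
  then show ?thesis by (auto simp: gauss_moment_def)
qed

text \<open>Replace \<open>X\<close> by \<open>h X\<close> with a random rotation \<open>h\<close>, which does not change its law, and fix \<open>X\<close>. If
  \<open>X = Q R\<close>, then \<open>h Q\<close> is a uniform frame.\<close>

lemma gauss_gram_det_frame_law:
  assumes mk: "m \<le> k" and kn: "k \<le> n" and a: "a \<in> stiefel n k"
  shows "distr (gauss_mat k m) borel gram_det =
    distr (gauss_mat n m \<Otimes>\<^sub>M stiefel_measure n m) borel (\<lambda>(X, v). gram_det X * gram_det (a\<^sup>T * v))"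
proof (rule measure_eqI_nn_integral)
  fix F :: "real \<Rightarrow> ennreal" assume "F \<in> borel_measurable (distr (gauss_mat k m) borel gram_det)"
  then have F[measurable]: "F \<in> borel_measurable borel" by simp
  have mn: "m \<le> n" using mk kn by simp
  let ?X = "gauss_mat n m" and ?V = "stiefel_measure n m" and ?H = "stiefel_measure n n"
  note [measurable_cong] = sets_stiefel_measure[OF mn] sets_stiefel_measure[OF order_refl, of n]
  interpret X: prob_space ?X by (rule prob_space_gauss_mat)
  interpret V: prob_space ?V by (rule prob_space_stiefel_measure[OF mn])
  interpret H: prob_space ?H by (rule prob_space_stiefel_measure) simp
  interpret HX: pair_prob_space ?H ?X ..
  have aT: "(\<lambda>x. a\<^sup>T) \<in> measurable N (mat_borel k n)" for N :: "'z measure"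
    using stiefelD(1)[OF a] by (intro measurable_mat_const) auto
  have a1[measurable]: "(\<lambda>X. a\<^sup>T * X) \<in> measurable (mat_borel n m) (mat_borel k m)"
    by (intro measurable_mat_mult[OF aT]) simp
  have V1[measurable]: "(\<lambda>v. gram_det (a\<^sup>T * v)) \<in> borel_measurable (stiefel_borel n m)"
    by (rule measurable_gram_det_left_frame[OF stiefelD(1)[OF a]])
  have H1: "(\<lambda>x. fst x) \<in> measurable (?H \<Otimes>\<^sub>M ?X) (mat_borel n n)"
    by (rule measurable_stiefel_mat) measurable
  have H2: "(\<lambda>x. snd x) \<in> measurable (?H \<Otimes>\<^sub>M ?X) (mat_borel n m)"
    by measurable
  have HX1[measurable]: "(\<lambda>x. gram_det (a\<^sup>T * (fst x * snd x))) \<in> borel_measurable (?H \<Otimes>\<^sub>M ?X)"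
    by (rule measurable_gram_det[OF measurable_mat_mult[OF aT measurable_mat_mult[OF H1 H2]]])
  have "(\<integral>\<^sup>+x. F x \<partial>distr (gauss_mat k m) borel gram_det) = (\<integral>\<^sup>+Y. F (gram_det Y) \<partial>gauss_mat k m)"
    by (rule nn_integral_distr) auto
  also have "\<dots> = (\<integral>\<^sup>+X. F (gram_det (a\<^sup>T * X)) \<partial>?X)"
    unfolding gauss_mat_frame[OF a kn, symmetric] by (rule nn_integral_distr) measurable
  also have "\<dots> = (\<integral>\<^sup>+h. \<integral>\<^sup>+X. F (gram_det (a\<^sup>T * X)) \<partial>?X \<partial>?H)"
    by (simp add: H.emeasure_space_1)
  also have "\<dots> = (\<integral>\<^sup>+h. \<integral>\<^sup>+X. F (gram_det (a\<^sup>T * (h * X))) \<partial>?X \<partial>?H)"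
  proof (rule nn_integral_cong)
    fix h assume "h \<in> space ?H"
    then have h: "h \<in> orthogonal_group n" by (simp add: space_stiefel_measure stiefel_square)
    have "(\<integral>\<^sup>+X. F (gram_det (a\<^sup>T * X)) \<partial>?X) = (\<integral>\<^sup>+X. F (gram_det (a\<^sup>T * X)) \<partial>distr ?X (mat_borel n m) (\<lambda>X. h * X))"
      by (subst gauss_mat_rotation[OF h]) simp
    also have "\<dots> = (\<integral>\<^sup>+X. F (gram_det (a\<^sup>T * (h * X))) \<partial>?X)"
    proof (rule nn_integral_distr)
      show "(\<lambda>X. h * X) \<in> measurable ?X (mat_borel n m)"
        using orthogonalD(1)[OF h] by (intro measurable_mat_mult[of _ _ _ n] measurable_mat_const) auto
    qed measurable
    finally show "(\<integral>\<^sup>+X. F (gram_det (a\<^sup>T * X)) \<partial>?X) = (\<integral>\<^sup>+X. F (gram_det (a\<^sup>T * (h * X))) \<partial>?X)" .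
  qed
  also have "\<dots> = (\<integral>\<^sup>+X. \<integral>\<^sup>+h. F (gram_det (a\<^sup>T * (h * X))) \<partial>?H \<partial>?X)"
    by (rule HX.Fubini'[symmetric]) (simp add: case_prod_beta, measurable)
  also have "\<dots> = (\<integral>\<^sup>+X. \<integral>\<^sup>+v. F (gram_det X * gram_det (a\<^sup>T * v)) \<partial>?V \<partial>?X)"
  proof (rule nn_integral_cong)
    fix X assume "X \<in> space ?X"
    then have X: "X \<in> carrier_mat n m" by simp
    obtain Q where Q: "Q \<in> stiefel n m" and fac: "\<And>P. dim_col P = n \<Longrightarrow> gram_det (P * X) = gram_det X * gram_det (P * Q)"
      by (rule gram_det_frame_factor[OF mn X]) blast
    have "(\<integral>\<^sup>+h. F (gram_det (a\<^sup>T * (h * X))) \<partial>?H) = (\<integral>\<^sup>+h. F (gram_det X * gram_det (a\<^sup>T * (h * Q))) \<partial>?H)"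
    proof (rule nn_integral_cong)
      fix h assume "h \<in> space ?H"
      then have "dim_row h = n" "dim_col h = n" by (auto simp: space_stiefel_measure stiefel_def)
      then show "F (gram_det (a\<^sup>T * (h * X))) = F (gram_det X * gram_det (a\<^sup>T * (h * Q)))"
        using fac[of "a\<^sup>T * h"] X stiefelD(3,4)[OF Q] stiefelD(3,4)[OF a] by (simp add: mat_assoc)
    qed
    also have "\<dots> = (\<integral>\<^sup>+v. F (gram_det X * gram_det (a\<^sup>T * v)) \<partial>?V)"
      by (rule stiefel_nn_integral_haar[OF mn Q, symmetric]) measurable
    finally show "(\<integral>\<^sup>+h. F (gram_det (a\<^sup>T * (h * X))) \<partial>?H) = (\<integral>\<^sup>+v. F (gram_det X * gram_det (a\<^sup>T * v)) \<partial>?V)" .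
  qed
  also have "\<dots> = (\<integral>\<^sup>+x. F (case x of (X, v) \<Rightarrow> gram_det X * gram_det (a\<^sup>T * v)) \<partial>(?X \<Otimes>\<^sub>M ?V))"
    by (subst V.nn_integral_fst[symmetric]) (auto simp: case_prod_beta)
  also have "\<dots> = (\<integral>\<^sup>+x. F x \<partial>distr (?X \<Otimes>\<^sub>M ?V) borel (\<lambda>(X, v). gram_det X * gram_det (a\<^sup>T * v)))"
    by (rule nn_integral_distr[symmetric]) measurable
  finally show "(\<integral>\<^sup>+x. F x \<partial>distr (gauss_mat k m) borel gram_det) =
      (\<integral>\<^sup>+x. F x \<partial>distr (?X \<Otimes>\<^sub>M ?V) borel (\<lambda>(X, v). gram_det X * gram_det (a\<^sup>T * v)))" .
qed simp

text \<open>By \<open>stiefel_gram_det_moment\<close> this is the expectation of \<open>|v' a a' v|\<^sup>s\<close> for a \<open>k\<close>-frame \<open>a\<close> and a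
  uniform \<open>m\<close>-frame \<open>v\<close>. The constant \<open>c\<close> of the introduction is its value for \<open>n - m\<close> in place of \<open>n\<close>.\<close>

definition frame_moment :: "nat \<Rightarrow> nat \<Rightarrow> nat \<Rightarrow> complex \<Rightarrow> complex" where
  "frame_moment n m k s = gauss_moment k m s / gauss_moment n m s"

text \<open>The two factors in \<open>gauss_gram_det_frame_law\<close> are independent. The moment of the Gaussian factor
  is finite and nonzero, so integrability of the product implies that of the other factor.\<close>

lemma stiefel_gram_det_moment:
  assumes mk: "m \<le> k" and kn: "k \<le> n" and a: "a \<in> stiefel n k" and s: "Re s > (real m - 1 - real k) / 2"
  shows "has_bochner_integral (stiefel_measure n m) (\<lambda>v. complex_of_real (gram_det (a\<^sup>T * v)) powr s) (frame_moment n m k s)"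
proof -
  have mn: "m \<le> n" and sn: "Re s > (real m - 1 - real n) / 2" using mk kn s by auto
  let ?X = "gauss_mat n m" and ?V = "stiefel_measure n m"
  note [measurable_cong] = sets_stiefel_measure[OF mn]
  interpret X: prob_space ?X by (rule prob_space_gauss_mat)
  interpret V: prob_space ?V by (rule prob_space_stiefel_measure[OF mn])
  interpret XV: pair_prob_space ?X ?V ..
  let ?A = "\<lambda>X. complex_of_real (gram_det X) powr s" and ?B = "\<lambda>v. complex_of_real (gram_det (a\<^sup>T * v)) powr s"
  have V1[measurable]: "(\<lambda>v. gram_det (a\<^sup>T * v)) \<in> borel_measurable (stiefel_borel n m)"
    by (rule measurable_gram_det_left_frame[OF stiefelD(1)[OF a]])
  have "has_bochner_integral (gauss_mat k m) (\<lambda>X. complex_of_real (gram_det X) powr s) (gauss_moment k m s)"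
    by (rule gauss_gram_det_moment[OF mk s])
  then have "has_bochner_integral (distr (gauss_mat k m) borel gram_det) (\<lambda>r. complex_of_real r powr s) (gauss_moment k m s)"
    by (subst has_bochner_integral_distr_of_real_powr) auto
  then have "has_bochner_integral (?X \<Otimes>\<^sub>M ?V) (\<lambda>x. complex_of_real (case x of (X, v) \<Rightarrow> gram_det X * gram_det (a\<^sup>T * v)) powr s) (gauss_moment k m s)"
    unfolding gauss_gram_det_frame_law[OF mk kn a] by (subst (asm) has_bochner_integral_distr_of_real_powr) auto
  also have "?this \<longleftrightarrow> has_bochner_integral (?X \<Otimes>\<^sub>M ?V) (\<lambda>(X, v). ?A X * ?B v) (gauss_moment k m s)"
    using mn mk stiefelD(3,4)[OF a]
    by (intro has_bochner_integral_cong refl)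
      (auto simp: space_pair_measure space_stiefel_measure[OF mn] stiefel_def simp del: of_real_mult intro!: of_real_mult_powr gram_det_nonneg)
  finally have pair: "integrable (?X \<Otimes>\<^sub>M ?V) (\<lambda>(X, v). ?A X * ?B v)" "(LINT (X, v)|(?X \<Otimes>\<^sub>M ?V). ?A X * ?B v) = gauss_moment k m s"
    by (auto simp: has_bochner_integral_iff)
  have A: "integrable ?X ?A" "integral\<^sup>L ?X ?A = gauss_moment n m s"
    using gauss_gram_det_moment[OF mn sn] by (auto simp: has_bochner_integral_iff)
  have B: "integrable ?V ?B"
  proof (rule ccontr)
    assume nB: "\<not> integrable ?V ?B"
    have "AE X in ?X. integrable ?V (\<lambda>v. ?A X * ?B v)"
      using XV.AE_integrable_fst'[OF pair(1)] by simp
    moreover have "?A X = 0" if int: "integrable ?V (\<lambda>v. ?A X * ?B v)" for X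
    proof (rule ccontr)
      assume nz: "?A X \<noteq> 0"
      have "integrable ?V (\<lambda>v. inverse (?A X) * (?A X * ?B v))"
        by (rule integrable_mult_right) (rule int)
      moreover have "inverse (?A X) * (?A X * b) = b" for b
        using nz by (simp add: mult.assoc[symmetric] del: powr_eq_0_iff)
      ultimately show False using nB by simp
    qed
    ultimately have "AE X in ?X. ?A X = 0"
      by (rule eventually_mono)
    then have "integral\<^sup>L ?X ?A = 0"
      by (subst integral_cong_AE[where g="\<lambda>_. 0"]) auto
    then show False using A(2) gauss_moment_nonzero[OF mn sn] by simp
  qed
  have "gauss_moment k m s = (LINT X|?X. LINT v|?V. ?A X * ?B v)"
    using XV.integral_fst'[OF pair(1)] pair(2) by simp
  also have "\<dots> = gauss_moment n m s * integral\<^sup>L ?V ?B"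
    by (simp add: A(2))
  finally show ?thesis
    using B gauss_moment_nonzero[OF mn sn] by (simp add: has_bochner_integral_iff frame_moment_def field_simps)
qed

text \<open>Both are laws of \<open>|q' g a a' g' q|\<close> for a Haar distributed \<open>g\<close>, up to transposition of \<open>g\<close>.\<close>

lemma stiefel_gram_det_law_swap:
  assumes mk: "m \<le> k" and kn: "k \<le> n" and a: "a \<in> stiefel n k" and q: "q \<in> stiefel n m"
  shows "distr (stiefel_measure n k) borel (\<lambda>t. gram_det (t\<^sup>T * q)) = distr (stiefel_measure n m) borel (\<lambda>v. gram_det (a\<^sup>T * v))"
proof (rule measure_eqI_nn_integral)
  fix F :: "real \<Rightarrow> ennreal" assume "F \<in> borel_measurable (distr (stiefel_measure n k) borel (\<lambda>t. gram_det (t\<^sup>T * q)))"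
  then have F[measurable]: "F \<in> borel_measurable borel" by simp
  have mn: "m \<le> n" using mk kn by simp
  note [measurable_cong] = sets_stiefel_measure[OF mn] sets_stiefel_measure[OF kn] sets_stiefel_measure[OF order_refl, of n]
  have V1[measurable]: "(\<lambda>v. gram_det (a\<^sup>T * v)) \<in> borel_measurable (stiefel_borel n m)"
    by (rule measurable_gram_det_left_frame[OF stiefelD(1)[OF a]])
  have T1[measurable]: "(\<lambda>t. gram_det (t\<^sup>T * q)) \<in> borel_measurable (stiefel_borel n k)"
    by (rule measurable_gram_det_right_frame[OF stiefelD(1)[OF q]])
  have H1[measurable]: "(\<lambda>g. gram_det (a\<^sup>T * (g * q))) \<in> borel_measurable (stiefel_borel n n)"
    using measurable_compose[OF measurable_mult_stiefel_right[OF q] V1] .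
  have "(\<integral>\<^sup>+x. F x \<partial>distr (stiefel_measure n k) borel (\<lambda>t. gram_det (t\<^sup>T * q))) = (\<integral>\<^sup>+t. F (gram_det (t\<^sup>T * q)) \<partial>stiefel_measure n k)"
    by (rule nn_integral_distr) measurable
  also have "\<dots> = (\<integral>\<^sup>+g. F (gram_det ((g * a)\<^sup>T * q)) \<partial>haar n)"
    by (rule stiefel_nn_integral_haar[OF kn a]) measurable
  also have "\<dots> = (\<integral>\<^sup>+g. F (gram_det (a\<^sup>T * (g\<^sup>T * q))) \<partial>haar n)"
    using stiefelD(3,4)[OF a] stiefelD(3,4)[OF q]
    by (intro nn_integral_cong) (auto simp: space_stiefel_measure mat_transpose_mult mat_assoc stiefel_def)
  also have "\<dots> = (\<integral>\<^sup>+g. F (gram_det (a\<^sup>T * (g * q))) \<partial>haar n)"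
    by (rule haar_transpose[OF stiefel_measure_invariant]) (simp, measurable)
  also have "\<dots> = (\<integral>\<^sup>+v. F (gram_det (a\<^sup>T * v)) \<partial>stiefel_measure n m)"
    by (rule stiefel_nn_integral_haar[OF mn q, symmetric]) measurable
  also have "\<dots> = (\<integral>\<^sup>+x. F x \<partial>distr (stiefel_measure n m) borel (\<lambda>v. gram_det (a\<^sup>T * v)))"
    by (rule nn_integral_distr[symmetric]) measurable
  finally show "(\<integral>\<^sup>+x. F x \<partial>distr (stiefel_measure n k) borel (\<lambda>t. gram_det (t\<^sup>T * q))) =
    (\<integral>\<^sup>+x. F x \<partial>distr (stiefel_measure n m) borel (\<lambda>v. gram_det (a\<^sup>T * v)))" .
qed simp

text \<open>The invariance argument of the introduction: the factor \<open>|A' A|\<close> comes out, and what remains is the same for all frames.\<close>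

lemma stiefel_projection_moment:
  assumes mk: "m \<le> k" and kn: "k \<le> n" and A: "A \<in> carrier_mat n m" and s: "Re s > (real m - 1 - real k) / 2"
  shows "has_bochner_integral (stiefel_measure n k) (\<lambda>t. complex_of_real (gram_det (t\<^sup>T * A)) powr s)
    (frame_moment n m k s * complex_of_real (gram_det A) powr s)"
proof -
  have mn: "m \<le> n" using mk kn by simp
  note [measurable_cong] = sets_stiefel_measure[OF mn] sets_stiefel_measure[OF kn]
  have a: "first_frame n k \<in> stiefel n k" (is "?a \<in> _") by (rule first_frame_stiefel[OF kn])
  obtain Q where Q: "Q \<in> stiefel n m" and fac: "\<And>P. dim_col P = n \<Longrightarrow> gram_det (P * A) = gram_det A * gram_det (P * Q)"
    by (rule gram_det_frame_factor[OF mn A]) blast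
  have V1[measurable]: "(\<lambda>v. gram_det (?a\<^sup>T * v)) \<in> borel_measurable (stiefel_borel n m)"
    by (rule measurable_gram_det_left_frame[OF stiefelD(1)[OF a]])
  have T1[measurable]: "(\<lambda>t. gram_det (t\<^sup>T * Q)) \<in> borel_measurable (stiefel_borel n k)"
    by (rule measurable_gram_det_right_frame[OF stiefelD(1)[OF Q]])
  have "has_bochner_integral (distr (stiefel_measure n m) borel (\<lambda>v. gram_det (?a\<^sup>T * v))) (\<lambda>r. complex_of_real r powr s) (frame_moment n m k s)"
    using stiefel_gram_det_moment[OF mk kn a s] by (subst has_bochner_integral_distr_of_real_powr) auto
  then have "has_bochner_integral (stiefel_measure n k) (\<lambda>t. complex_of_real (gram_det (t\<^sup>T * Q)) powr s) (frame_moment n m k s)"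
    unfolding stiefel_gram_det_law_swap[OF mk kn a Q, symmetric] by (subst (asm) has_bochner_integral_distr_of_real_powr) auto
  then have "has_bochner_integral (stiefel_measure n k) (\<lambda>t. complex_of_real (gram_det (t\<^sup>T * Q)) powr s * complex_of_real (gram_det A) powr s)
      (frame_moment n m k s * complex_of_real (gram_det A) powr s)"
    by (rule has_bochner_integral_mult_left)
  also have "?this \<longleftrightarrow> ?thesis"
  proof (intro has_bochner_integral_cong refl)
    fix t assume "t \<in> space (stiefel_measure n k)"
    then have t: "dim_row t = n" "dim_col t = k" by (auto simp: space_stiefel_measure[OF kn] stiefel_def)
    have "0 \<le> gram_det A" "0 \<le> gram_det (t\<^sup>T * Q)"
      using A mn mk t stiefelD(3,4)[OF Q] by (auto intro!: gram_det_nonneg)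
    then show "complex_of_real (gram_det (t\<^sup>T * Q)) powr s * complex_of_real (gram_det A) powr s = complex_of_real (gram_det (t\<^sup>T * A)) powr s"
      using fac[of "t\<^sup>T"] t by (simp add: of_real_mult_powr mult.commute del: of_real_mult)
  qed
  finally show ?thesis .
qed

text \<open>The powers of \<open>2\<close> and of \<open>\<pi>\<close> cancel.\<close>

lemma frame_moment_Gamma:
  assumes mk: "m \<le> k" and kn: "k \<le> n"
  shows "frame_moment n m k s = Gamma_m m (of_nat n / 2) * Gamma_m m (of_nat k / 2 + s) /
    (Gamma_m m (of_nat k / 2) * Gamma_m m (of_nat n / 2 + s))"
proof -
  have eq: "gauss_moment l m s = (\<Prod>j<m. 2 powr s) * (\<Prod>j<m. Gamma (of_nat l / 2 + s - of_nat j / 2)) / (\<Prod>j<m. Gamma (of_nat l / 2 - of_nat j / 2))"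
    if "m \<le> l" for l
  proof -
    have "gauss_moment l m s = (\<Prod>j<m. 2 powr s * Gamma (of_nat l / 2 + s - of_nat j / 2) / Gamma (of_nat l / 2 - of_nat j / 2))"
      unfolding gauss_moment_def using that
      by (intro prod.cong refl) (simp add: of_nat_diff diff_divide_distrib algebra_simps)
    then show ?thesis by (simp add: prod.distrib prod_dividef)
  qed
  have p: "complex_of_real (pi powr (real m * (real m - 1) / 4)) \<noteq> 0" by simp
  have "(\<Prod>j<m. (2 :: complex) powr s) \<noteq> 0" by simp
  then show ?thesis
    using mk kn p unfolding frame_moment_def Gamma_m_def
    by (subst (1 2) eq) (auto simp: field_simps)
qed

section \<open>Pairs of orthogonal frames and the Funk transform\<close>

text \<open>The matrix \<open>diag(h, I)\<close>.\<close>

lemma block_orthogonal: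
  assumes k: "k \<le> n" and h: "h \<in> orthogonal_group (n - k)"
  obtains p where "p \<in> orthogonal_group n" "p * last_frame n k = last_frame n k"
    "p * first_frame n (n - k) = first_frame n (n - k) * h"
proof
  let ?F = "first_frame n (n - k)" and ?E = "last_frame n k"
  let ?p = "?F * (h * ?F\<^sup>T) + ?E * ?E\<^sup>T"
  note hd = orthogonalD(4,5)[OF h]
  have EE: "?E\<^sup>T * ?E = 1\<^sub>m k" and FF: "?F\<^sup>T * ?F = 1\<^sub>m (n - k)"
    using stiefelD(2)[OF last_frame_stiefel[OF k]] stiefelD(2)[OF first_frame_stiefel[of "n-k" n]] by auto
  have EF: "?E\<^sup>T * ?F = 0\<^sub>m k (n - k)" and FE: "?F\<^sup>T * ?E = 0\<^sub>m (n - k) k"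
    using k by (auto intro!: last_first_orthogonal first_last_orthogonal)
  have d: "dim_row ?p = n" "dim_col ?p = n" using k hd by auto
  have pX: "?p * X = ?F * (h * (?F\<^sup>T * X)) + ?E * (?E\<^sup>T * X)" if "dim_row X = n" for X
    using that k hd by (simp add: mat_distrib_right mat_assoc)
  show pE: "?p * ?E = ?E"
    using k hd by (subst pX) (simp_all add: EE FE mat_zero_right mat_one_right)
  show pF: "?p * ?F = ?F * h"
    using k hd by (subst pX) (simp_all add: FF EF mat_zero_right mat_one_right)
  have pT: "?p\<^sup>T = ?F * (h\<^sup>T * ?F\<^sup>T) + ?E * ?E\<^sup>T"
    using k hd by (subst transpose_add[of _ n n]) (simp_all add: mat_transpose_mult mat_assoc)
  have FFX: "?F\<^sup>T * (?F * X) = X" and EFX: "?E\<^sup>T * (?F * X) = 0\<^sub>m k (dim_col X)" if "dim_row X = n - k" for X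
    using that k mult_eq_cancel[OF FF, of X] mult_eq_cancel[OF EF, of X] by (auto simp: mat_one_left mat_zero_left)
  have EEX: "?E\<^sup>T * (?E * X) = X" and FEX: "?F\<^sup>T * (?E * X) = 0\<^sub>m (n - k) (dim_col X)" if "dim_row X = k" for X
    using that k mult_eq_cancel[OF EE, of X] mult_eq_cancel[OF FE, of X] by (auto simp: mat_one_left mat_zero_left)
  have pTX: "?p\<^sup>T * X = ?F * (h\<^sup>T * (?F\<^sup>T * X)) + ?E * (?E\<^sup>T * X)" if "dim_row X = n" for X
    unfolding pT using that k hd by (simp add: mat_distrib_right mat_assoc)
  have 1: "?p\<^sup>T * (?F * (h * ?F\<^sup>T)) = ?F * ?F\<^sup>T"
    using k hd orthogonal_cancel(1)[OF h, of "?F\<^sup>T"]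
    by (subst pTX) (simp_all add: FFX EFX mat_zero_right)
  have 2: "?p\<^sup>T * (?E * ?E\<^sup>T) = ?E * ?E\<^sup>T"
    using k hd by (subst pTX) (simp_all add: EEX FEX mat_zero_right)
  have "?p\<^sup>T * ?p = ?p\<^sup>T * (?F * (h * ?F\<^sup>T)) + ?p\<^sup>T * (?E * ?E\<^sup>T)"
    using k hd by (intro mat_distrib_left) auto
  then have "?p\<^sup>T * ?p = 1\<^sub>m n"
    unfolding 1 2 frames_complete[OF k] .
  then show "?p \<in> orthogonal_group n"
    using d by (simp add: orthogonal_group_def)
qed

lemma first_frame_first_frame:
  assumes "m \<le> l" "l \<le> n"
  shows "first_frame n l * first_frame l m = first_frame n m"
  using assms by (intro eq_matI) (auto simp: mult_first_frame_index first_frame_index simp del: index_mult_mat(1))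

text \<open>The orthogonal group acts transitively on pairs of orthogonal frames. Complete \<open>a\<close> to an orthogonal matrix \<open>g\<close>; then \<open>g' b\<close> has
  zeros in its last \<open>k\<close> rows, and some \<open>diag(h, I)\<close> brings its upper part into standard position.\<close>

lemma orthonormal_pair:
  assumes km: "k + m \<le> n" and a: "a \<in> stiefel n k" and b: "b \<in> stiefel n m" and ab: "a\<^sup>T * b = 0\<^sub>m k m"
  obtains p where "p \<in> orthogonal_group n" "p * last_frame n k = a" "p * first_frame n m = b"
proof -
  have k: "k \<le> n" and m: "m \<le> n - k" and mn: "m \<le> n" using km by auto
  let ?F = "first_frame n (n - k)" and ?E = "last_frame n k"
  define g where "g = frame_section n k a"
  have g: "g \<in> orthogonal_group n" and gE: "g * ?E = a"
    using frame_section[OF a k] by (auto simp: g_def)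
  note gd = orthogonalD(4,5)[OF g] and ad = stiefelD(3,4)[OF a] and bd = stiefelD(3,4)[OF b]
  define c where "c = ?F\<^sup>T * (g\<^sup>T * b)"
  have cd: "dim_row c = n - k" "dim_col c = m" using bd gd by (auto simp: c_def)
  have "?E\<^sup>T * (g\<^sup>T * b) = a\<^sup>T * b"
    using gd bd k by (simp add: gE[symmetric] mat_transpose_mult mat_assoc)
  then have "?E * (?E\<^sup>T * (g\<^sup>T * b)) = 0\<^sub>m n m"
    using k by (simp add: ab mat_zero_right)
  with resolve_frames[OF k, of "g\<^sup>T * b"] have Fc: "?F * c = g\<^sup>T * b"
    unfolding c_def[symmetric] using gd bd k cd right_add_zero_mat[of "?F * c" n m] by simp
  have FF: "?F\<^sup>T * ?F = 1\<^sub>m (n - k)"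
    using stiefelD(2)[OF first_frame_stiefel[of "n-k" n]] by auto
  have "c\<^sup>T * c = c\<^sup>T * (?F\<^sup>T * (?F * c))"
    using mult_eq_cancel[OF FF, of c] cd by (simp add: mat_one_left)
  also have "\<dots> = (?F * c)\<^sup>T * (?F * c)"
    using cd by (simp add: mat_transpose_mult mat_assoc)
  also have "\<dots> = b\<^sup>T * b"
    unfolding Fc using gd bd orthogonal_cancel(2)[OF g, of b] by (simp add: mat_transpose_mult mat_assoc)
  finally have "c \<in> stiefel (n - k) m"
    using cd stiefelD(2)[OF b] by (intro stiefelI) auto
  then obtain h where h: "h \<in> orthogonal_group (n - k)" "h * first_frame (n - k) m = c"
    using stiefel_transitive[OF m _ first_frame_stiefel[OF m]] by blast
  obtain q where q: "q \<in> orthogonal_group n" "q * ?E = ?E" "q * ?F = ?F * h"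
    by (rule block_orthogonal[OF k h(1)])
  note qd = orthogonalD(4,5)[OF q(1)] and hd = orthogonalD(4,5)[OF h(1)]
  have "g * q * ?E = a"
    using gd qd k by (simp add: mat_assoc q(2) gE)
  moreover have "g * q * first_frame n m = b"
  proof -
    have "q * first_frame n m = (q * ?F) * first_frame (n - k) m"
      using qd m k first_frame_first_frame[OF m, of n] by (simp add: mat_assoc)
    also have "\<dots> = g\<^sup>T * b"
      unfolding q(3) using hd m by (simp add: mat_assoc h(2) Fc)
    finally show ?thesis
      using gd qd mn bd orthogonal_cancel(2)[OF g, of b] by (simp add: mat_assoc)
  qed
  ultimately show ?thesis
    using that[OF orthogonal_mult[OF g q(1)]] by blast
qed

text \<open>The quotient \<open>g2' g1\<close> fixes the last basis vectors, so it is \<open>diag(h, I)\<close>.\<close>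

lemma same_completion:
  assumes k: "k \<le> n" and g: "g1 \<in> orthogonal_group n" "g2 \<in> orthogonal_group n"
    and eq: "g1 * last_frame n k = g2 * last_frame n k"
  obtains h where "h \<in> orthogonal_group (n - k)"
    "\<And>w. dim_row w = n - k \<Longrightarrow> g1 * (first_frame n (n - k) * w) = g2 * (first_frame n (n - k) * (h * w))"
proof -
  let ?E = "last_frame n k" and ?F = "first_frame n (n - k)"
  note d = orthogonalD(4,5)[OF g(1)] orthogonalD(4,5)[OF g(2)]
  define p where "p = g2\<^sup>T * g1"
  have p: "p \<in> orthogonal_group n"
    unfolding p_def by (intro orthogonal_mult orthogonal_transpose g)
  note pd = orthogonalD(4,5)[OF p]
  have "p * ?E = g2\<^sup>T * (g2 * ?E)"
    using d k by (simp add: p_def mat_assoc eq)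
  also have "\<dots> = ?E"
    using k by (intro orthogonal_cancel(1)[OF g(2)]) simp
  finally have pE: "p * ?E = ?E" .
  obtain h where h: "h \<in> orthogonal_group (n - k)" and pF: "p * ?F = ?F * h"
    by (rule last_frame_stabilizer[OF k p pE])
  have "g1 * (?F * w) = g2 * (?F * (h * w))" if w: "dim_row w = n - k" for w
  proof -
    have "g1 * (?F * w) = g2 * (p * (?F * w))"
      using d w k orthogonal_cancel(2)[OF g(2), of "g1 * (?F * w)"] by (simp add: p_def mat_assoc)
    also have "p * (?F * w) = ?F * (h * w)"
      using mult_eq_cancel[OF pF, of w] pd w k orthogonalD(4,5)[OF h] by (simp add: mat_assoc)
    finally show ?thesis .
  qed
  with h show ?thesis by (rule that)
qed

lemma stiefel_integral_invariant:
  fixes F :: "real mat \<Rightarrow> complex"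
  assumes m: "m \<le> n" and h: "h \<in> orthogonal_group n" and F: "F \<in> borel_measurable (stiefel_borel n m)"
  shows "(LINT v|stiefel_measure n m. F (h * v)) = (LINT v|stiefel_measure n m. F v)"
proof -
  let ?V = "stiefel_measure n m"
  note [measurable_cong] = sets_stiefel_measure[OF m]
  note [measurable] = F measurable_mult_stiefel[OF h, of m]
  have "distr ?V ?V (\<lambda>v. h * v) = ?V"
    using stiefel_measure_invariant[OF m] h by (simp add: invariant_on_stiefel_def)
  then have "(LINT v|?V. F v) = (LINT v|distr ?V ?V (\<lambda>v. h * v). F v)"
    by simp
  also have "\<dots> = (LINT v|?V. F (h * v))"
    by (rule integral_distr) measurable
  finally show ?thesis ..
qed

lemma embed_first_frame_stiefel:
  assumes g: "g \<in> orthogonal_group n" and k: "l \<le> n" and w: "w \<in> stiefel l m"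
  shows "g * (first_frame n l * w) \<in> stiefel n m"
  by (rule orthogonal_mult_stiefel[OF g stiefel_mult[OF first_frame_stiefel[OF k] w]])

lemma measurable_first_frame_mult:
  assumes l: "l \<le> n"
  shows "(\<lambda>w. first_frame n l * w) \<in> measurable (stiefel_borel l m) (stiefel_borel n m)"
proof (rule measurable_stiefel_borelI)
  note F = first_frame_stiefel[OF l]
  show "(\<lambda>w. first_frame n l * w) \<in> measurable (stiefel_borel l m) (mat_borel n m)"
    by (rule measurable_mat_mult[OF measurable_mat_const[OF stiefelD(1)[OF F]] measurable_stiefel_ident])
  show "first_frame n l * w \<in> stiefel n m" if "w \<in> space (stiefel_borel l m)" for w
    using that stiefel_mult[OF F] by simp
qed

lemma measurable_embed_first_frame:
  assumes g: "g \<in> orthogonal_group n" and l: "l \<le> n"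
  shows "(\<lambda>w. g * (first_frame n l * w)) \<in> measurable (stiefel_borel l m) (stiefel_borel n m)"
  by (rule measurable_compose[OF measurable_first_frame_mult[OF l] measurable_mult_stiefel[OF g]])

text \<open>A change of the completion of \<open>u\<close> replaces \<open>w\<close> by \<open>h w\<close> with an orthogonal \<open>h\<close>, and the law of \<open>w\<close> is
  invariant. So the measurable completion may be used in place of the arbitrary one.\<close>

lemma funk_eq:
  assumes km: "k + m \<le> n" and u: "u \<in> stiefel n k" and g: "g \<in> orthogonal_group n" "g * last_frame n k = u"
    and f: "f \<in> borel_measurable (stiefel_borel n m)"
  shows "funk n m k f u = (LINT w|stiefel_measure (n - k) m. f (g * (first_frame n (n - k) * w)))"
proof -
  have k: "k \<le> n" and m: "m \<le> n - k" using km by auto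
  note c = frame_completion[OF u k]
  obtain h where h: "h \<in> orthogonal_group (n - k)"
    "\<And>w. dim_row w = n - k \<Longrightarrow> frame_completion n k u * (first_frame n (n - k) * w) = g * (first_frame n (n - k) * (h * w))"
    using same_completion[OF k c(1) g(1)] c(2) g(2) by auto
  have "funk n m k f u = (LINT w|stiefel_measure (n - k) m. f (g * (first_frame n (n - k) * (h * w))))"
    unfolding funk_def
  proof (rule Bochner_Integration.integral_cong[OF refl])
    fix w assume "w \<in> space (stiefel_measure (n - k) m)"
    then have w: "dim_row w = n - k" "dim_col w = m" by (auto simp: space_stiefel_measure[OF m] stiefel_def)
    have "w @\<^sub>r 0\<^sub>m k m = first_frame n (n - k) * w"
      using w k by (intro append_zero_rows) auto
    then show "f (frame_completion n k u * (w @\<^sub>r 0\<^sub>m k m)) = f (g * (first_frame n (n - k) * (h * w)))"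
      using h(2)[OF w(1)] by simp
  qed
  also have "\<dots> = (LINT w|stiefel_measure (n - k) m. f (g * (first_frame n (n - k) * w)))"
  proof (rule stiefel_integral_invariant[OF m h(1)])
    show "(\<lambda>w. f (g * (first_frame n (n - k) * w))) \<in> borel_measurable (stiefel_borel (n - k) m)"
      by (rule measurable_compose[OF measurable_embed_first_frame[OF g(1)] f]) simp
  qed
  finally show ?thesis .
qed

text \<open>For \<open>x = (u, w)\<close> this is the frame \<open>g\<^sub>u [w; 0]\<close>, with the measurable choice of \<open>g\<^sub>u\<close>. It is orthogonal to \<open>u\<close>.\<close>

definition section_embed :: "nat \<Rightarrow> nat \<Rightarrow> real mat \<times> real mat \<Rightarrow> real mat" where
  "section_embed n k x = frame_section n k (fst x) * (first_frame n (n - k) * snd x)"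

lemma measurable_section_embed:
  assumes k: "k \<le> n"
  shows "section_embed n k \<in> measurable (stiefel_borel n k \<Otimes>\<^sub>M stiefel_borel (n - k) m) (stiefel_borel n m)"
proof (rule measurable_stiefel_borelI)
  let ?P = "stiefel_borel n k \<Otimes>\<^sub>M stiefel_borel (n - k) m"
  have c: "fst \<in> measurable ?P (mat_borel n k)" and w: "snd \<in> measurable ?P (mat_borel (n - k) m)"
    by (rule measurable_stiefel_mat, measurable)+
  have F: "first_frame n (n - k) \<in> carrier_mat n (n - k)"
    by simp
  show "section_embed n k \<in> measurable ?P (mat_borel n m)"
    unfolding section_embed_def[abs_def]
    by (rule measurable_mat_mult[OF measurable_frame_section[OF c k] measurable_mat_mult[OF measurable_mat_const[OF F] w]])
  show "section_embed n k x \<in> stiefel n m" if "x \<in> space ?P" for x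
    using that k unfolding section_embed_def
    by (intro embed_first_frame_stiefel frame_section) (auto simp: space_pair_measure)
qed

text \<open>With the measurable completion the integrand is jointly measurable in \<open>u\<close> and \<open>w\<close>.\<close>

lemma measurable_funk:
  assumes km: "k + m \<le> n" and f: "f \<in> borel_measurable (stiefel_borel n m)"
  shows "funk n m k f \<in> borel_measurable (stiefel_borel n k)"
proof -
  have k: "k \<le> n" and m: "m \<le> n - k" using km by auto
  interpret W: prob_space "stiefel_measure (n - k) m" by (rule prob_space_stiefel_measure[OF m])
  have sets: "sets (stiefel_borel n k \<Otimes>\<^sub>M stiefel_measure (n - k) m) = sets (stiefel_borel n k \<Otimes>\<^sub>M stiefel_borel (n - k) m)"
    by (intro sets_pair_measure_cong sets_stiefel_measure[OF m] refl)
  have "(\<lambda>x. f (section_embed n k x)) \<in> borel_measurable (stiefel_borel n k \<Otimes>\<^sub>M stiefel_measure (n - k) m)"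
    using measurable_compose[OF measurable_section_embed[OF k, of m] f] by (simp add: measurable_cong_sets[OF sets refl])
  then have "(\<lambda>u. LINT w|stiefel_measure (n - k) m. f (section_embed n k (u, w))) \<in> borel_measurable (stiefel_borel n k)"
    by (intro W.borel_measurable_lebesgue_integral) (simp add: case_prod_beta)
  also have "?this \<longleftrightarrow> ?thesis"
  proof (rule measurable_cong)
    fix u assume "u \<in> space (stiefel_borel n k)"
    then have u: "u \<in> stiefel n k" by simp
    show "(LINT w|stiefel_measure (n - k) m. f (section_embed n k (u, w))) = funk n m k f u"
      using funk_eq[OF km u frame_section[OF u k] f] by (simp add: section_embed_def)
  qed
  finally show ?thesis .
qed

text \<open>Let \<open>u = g [0; I]\<close> with Haar distributed \<open>g\<close>. Then \<open>g\<close> may serve as the completion of \<open>u\<close>, and for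
  fixed \<open>w\<close> a right translation of \<open>g\<close> moves \<open>[w; 0]\<close> to the first coordinate frame.\<close>

lemma frame_pair_law:
  assumes km: "k + m \<le> n"
  shows "distr (stiefel_measure n k \<Otimes>\<^sub>M stiefel_measure (n - k) m) (stiefel_borel n k \<Otimes>\<^sub>M stiefel_borel n m)
      (\<lambda>x. (fst x, section_embed n k x)) =
    distr (haar n) (stiefel_borel n k \<Otimes>\<^sub>M stiefel_borel n m) (\<lambda>g. (g * last_frame n k, g * first_frame n m))"
proof (rule measure_eqI_nn_integral)
  have k: "k \<le> n" and m: "m \<le> n - k" and mn: "m \<le> n" using km by auto
  let ?E = "last_frame n k" and ?F = "first_frame n (n - k)"
  let ?U = "stiefel_measure n k" and ?W = "stiefel_measure (n - k) m" and ?H = "stiefel_measure n n"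
  let ?S = "stiefel_borel n k \<Otimes>\<^sub>M stiefel_borel n m"
  interpret U: prob_space ?U by (rule prob_space_stiefel_measure[OF k])
  interpret W: prob_space ?W by (rule prob_space_stiefel_measure[OF m])
  interpret H: prob_space ?H by (rule prob_space_stiefel_measure) simp
  interpret HW: pair_prob_space ?H ?W ..
  note [measurable_cong] = sets_stiefel_measure[OF k] sets_stiefel_measure[OF m] sets_stiefel_measure[OF order_refl, of n]
  have E: "?E \<in> stiefel n k" and F0: "first_frame n m \<in> stiefel n m" and F: "?F \<in> stiefel n (n - k)"
    using k mn by (auto intro!: last_frame_stiefel first_frame_stiefel)
  note [measurable] = measurable_section_embed[OF k, of m] measurable_mult_stiefel_right[OF E] measurable_mult_stiefel_right[OF F0]
    measurable_mult_stiefel_right[OF F]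
  fix G :: "real mat \<times> real mat \<Rightarrow> ennreal"
  assume "G \<in> borel_measurable (distr (?U \<Otimes>\<^sub>M ?W) ?S (\<lambda>x. (fst x, section_embed n k x)))"
  then have G[measurable]: "G \<in> borel_measurable ?S" by simp
  have meas1[measurable]: "(\<lambda>x. (fst x, section_embed n k x)) \<in> measurable (?U \<Otimes>\<^sub>M ?W) ?S"
    by measurable
  have inner[measurable]: "(\<lambda>u. \<integral>\<^sup>+w. G (u, section_embed n k (u, w)) \<partial>?W) \<in> borel_measurable (stiefel_borel n k)"
    by measurable
  have HWm[measurable]: "(\<lambda>x. (fst x * ?E, fst x * (?F * snd x))) \<in> measurable (?H \<Otimes>\<^sub>M ?W) ?S"
  proof -
    have w: "(\<lambda>w. ?F * w) \<in> measurable (stiefel_borel (n - k) m) (stiefel_borel n m)"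
      by (rule measurable_first_frame_mult) simp
    note [measurable] = w
    show ?thesis by measurable
  qed
  \<comment> \<open>from here on \<open>u\<close> is written as \<open>g * ?E\<close>, the section is replaced by \<open>g\<close>, and the integrals are exchanged\<close>
  have "(\<integral>\<^sup>+y. G y \<partial>distr (?U \<Otimes>\<^sub>M ?W) ?S (\<lambda>x. (fst x, section_embed n k x))) =
      (\<integral>\<^sup>+x. G (fst x, section_embed n k x) \<partial>(?U \<Otimes>\<^sub>M ?W))"
    by (rule nn_integral_distr[OF meas1]) simp
  also have "\<dots> = (\<integral>\<^sup>+u. \<integral>\<^sup>+w. G (u, section_embed n k (u, w)) \<partial>?W \<partial>?U)"
    by (subst W.nn_integral_fst[symmetric]) (auto intro!: measurable_compose[OF meas1 G])
  also have "\<dots> = (\<integral>\<^sup>+g. \<integral>\<^sup>+w. G (g * ?E, section_embed n k (g * ?E, w)) \<partial>?W \<partial>?H)"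
    by (rule stiefel_nn_integral_haar[OF k E inner])
  also have "\<dots> = (\<integral>\<^sup>+g. \<integral>\<^sup>+w. G (g * ?E, g * (?F * w)) \<partial>?W \<partial>?H)"
  proof (rule nn_integral_cong)
    fix g assume "g \<in> space ?H"
    then have g: "g \<in> orthogonal_group n" by (simp add: space_stiefel_measure stiefel_square)
    have gE: "g * ?E \<in> stiefel n k" by (rule orthogonal_mult_stiefel[OF g E])
    note sec = frame_section[OF gE k]
    obtain h where h: "h \<in> orthogonal_group (n - k)"
      "\<And>w. dim_row w = n - k \<Longrightarrow> frame_section n k (g * ?E) * (?F * w) = g * (?F * (h * w))"
      using same_completion[OF k sec(1) g sec(2)] by blast
    have "(\<integral>\<^sup>+w. G (g * ?E, section_embed n k (g * ?E, w)) \<partial>?W) = (\<integral>\<^sup>+w. G (g * ?E, g * (?F * (h * w))) \<partial>?W)"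
      by (intro nn_integral_cong) (auto simp: space_stiefel_measure[OF m] section_embed_def h(2) stiefel_def)
    also have "\<dots> = (\<integral>\<^sup>+w. G (g * ?E, g * (?F * w)) \<partial>?W)"
    proof (rule invariant_nn_integral[OF stiefel_measure_invariant[OF m] h(1)])
      show "(\<lambda>w. G (g * ?E, g * (?F * w))) \<in> borel_measurable (stiefel_borel (n - k) m)"
        using gE k by (intro measurable_compose[OF measurable_Pair[OF measurable_const measurable_embed_first_frame[OF g]] G]) auto
    qed
    finally show "(\<integral>\<^sup>+w. G (g * ?E, section_embed n k (g * ?E, w)) \<partial>?W) = (\<integral>\<^sup>+w. G (g * ?E, g * (?F * w)) \<partial>?W)" .
  qed
  also have "\<dots> = (\<integral>\<^sup>+w. \<integral>\<^sup>+g. G (g * ?E, g * (?F * w)) \<partial>?H \<partial>?W)"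
    using measurable_compose[OF HWm G] by (intro HW.Fubini'[symmetric]) (simp add: case_prod_beta)
  also have "\<dots> = (\<integral>\<^sup>+w. \<integral>\<^sup>+g. G (g * ?E, g * first_frame n m) \<partial>?H \<partial>?W)"
  proof (rule nn_integral_cong)
    fix w assume "w \<in> space ?W"
    then have w: "w \<in> stiefel (n - k) m" by (simp add: space_stiefel_measure[OF m])
    have Fw: "?F * w \<in> stiefel n m" by (rule stiefel_mult[OF F w])
    have "?E\<^sup>T * (?F * w) = 0\<^sub>m k m"
      using mult_eq_cancel[OF last_first_orthogonal[of k "n - k" n], of w] k stiefelD(3,4)[OF w] by (simp add: mat_zero_left)
    then obtain p where p: "p \<in> orthogonal_group n" "p * ?E = ?E" "p * first_frame n m = ?F * w"
      by (rule orthonormal_pair[OF km E Fw])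
    have "(\<integral>\<^sup>+g. G (g * ?E, g * (?F * w)) \<partial>?H) = (\<integral>\<^sup>+g. G (g * p * ?E, g * p * first_frame n m) \<partial>?H)"
      using orthogonalD(4,5)[OF p(1)] k mn
      by (intro nn_integral_cong) (auto simp: space_stiefel_measure stiefel_def mat_assoc p(2,3))
    also have "\<dots> = (\<integral>\<^sup>+g. G (g * ?E, g * first_frame n m) \<partial>?H)"
    proof (rule haar_right[OF stiefel_measure_invariant[OF order_refl] _ p(1)])
      show "(\<lambda>g. G (g * ?E, g * first_frame n m)) \<in> borel_measurable (stiefel_borel n n)"
        by (rule measurable_compose[OF measurable_Pair[OF measurable_mult_stiefel_right[OF E] measurable_mult_stiefel_right[OF F0]] G])
    qed
    finally show "(\<integral>\<^sup>+g. G (g * ?E, g * (?F * w)) \<partial>?H) = (\<integral>\<^sup>+g. G (g * ?E, g * first_frame n m) \<partial>?H)" .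
  qed
  also have "\<dots> = (\<integral>\<^sup>+g. G (g * ?E, g * first_frame n m) \<partial>?H)"
    by (simp add: W.emeasure_space_1)
  also have "\<dots> = (\<integral>\<^sup>+y. G y \<partial>distr ?H ?S (\<lambda>g. (g * ?E, g * first_frame n m)))"
    by (rule nn_integral_distr[symmetric]) measurable
  finally show "(\<integral>\<^sup>+y. G y \<partial>distr (?U \<Otimes>\<^sub>M ?W) ?S (\<lambda>x. (fst x, section_embed n k x))) =
      (\<integral>\<^sup>+y. G y \<partial>distr ?H ?S (\<lambda>g. (g * ?E, g * first_frame n m)))" .
qed simp

text \<open>Both sides are laws of pairs of orthogonal coordinate frames moved by a Haar distributed \<open>g\<close>: the first \<open>m\<close> and the
  last \<open>k\<close> basis vectors on the left, the last \<open>m\<close> and the first \<open>k\<close> on the right. By transitivity the choice of the pair does not matter.\<close>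

lemma frame_pair_law_swap:
  assumes km: "k + m \<le> n"
  shows "distr (stiefel_measure n k \<Otimes>\<^sub>M stiefel_measure (n - k) m) (stiefel_borel n m \<Otimes>\<^sub>M stiefel_borel n k)
      (\<lambda>x. (section_embed n k x, fst x)) =
    distr (stiefel_measure n m \<Otimes>\<^sub>M stiefel_measure (n - m) k) (stiefel_borel n m \<Otimes>\<^sub>M stiefel_borel n k)
      (\<lambda>x. (fst x, section_embed n m x))"
proof -
  have k: "k \<le> n" and m: "m \<le> n" and mk: "m \<le> n - k" "k \<le> n - m" and km': "m + k \<le> n" using km by auto
  let ?H = "stiefel_measure n n"
  let ?S1 = "stiefel_borel n k \<Otimes>\<^sub>M stiefel_borel n m" and ?S2 = "stiefel_borel n m \<Otimes>\<^sub>M stiefel_borel n k"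
  note [measurable_cong] = sets_stiefel_measure[OF k] sets_stiefel_measure[OF m] sets_stiefel_measure[OF mk(1)]
    sets_stiefel_measure[OF mk(2)] sets_stiefel_measure[OF order_refl, of n]
  note frames = last_frame_stiefel[OF k] first_frame_stiefel[OF m] last_frame_stiefel[OF m] first_frame_stiefel[OF k]
  note [measurable] = measurable_section_embed[OF k, of m] frames[THEN measurable_mult_stiefel_right]
  have sw[measurable]: "(\<lambda>x. (snd x, fst x)) \<in> measurable ?S1 ?S2"
    by measurable
  have e[measurable]: "(\<lambda>x. (fst x, section_embed n k x)) \<in> measurable (stiefel_measure n k \<Otimes>\<^sub>M stiefel_measure (n - k) m) ?S1"
    by measurable
  have h[measurable]: "(\<lambda>g. (g * last_frame n k, g * first_frame n m)) \<in> measurable ?H ?S1"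
    by measurable
  have "distr (stiefel_measure n k \<Otimes>\<^sub>M stiefel_measure (n - k) m) ?S2 (\<lambda>x. (section_embed n k x, fst x)) =
      distr (distr (stiefel_measure n k \<Otimes>\<^sub>M stiefel_measure (n - k) m) ?S1 (\<lambda>x. (fst x, section_embed n k x))) ?S2 (\<lambda>x. (snd x, fst x))"
    by (subst distr_distr[OF sw e]) (simp add: comp_def)
  also have "\<dots> = distr ?H ?S2 (\<lambda>g. (g * first_frame n m, g * last_frame n k))"
    unfolding frame_pair_law[OF km] by (subst distr_distr[OF sw h]) (simp add: comp_def)
  also have "\<dots> = distr ?H ?S2 (\<lambda>g. (g * last_frame n m, g * first_frame n k))"
  proof (rule measure_eqI_nn_integral)
    fix G :: "real mat \<times> real mat \<Rightarrow> ennreal"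
    assume "G \<in> borel_measurable (distr ?H ?S2 (\<lambda>g. (g * first_frame n m, g * last_frame n k)))"
    then have G[measurable]: "G \<in> borel_measurable ?S2" by simp
    have "(first_frame n k)\<^sup>T * last_frame n m = 0\<^sub>m k m"
      using km' by (rule first_last_orthogonal)
    then obtain p where p: "p \<in> orthogonal_group n" "p * last_frame n k = first_frame n k" "p * first_frame n m = last_frame n m"
      by (rule orthonormal_pair[OF km frames(4,3)])
    have "(\<integral>\<^sup>+y. G y \<partial>distr ?H ?S2 (\<lambda>g. (g * first_frame n m, g * last_frame n k))) = (\<integral>\<^sup>+g. G (g * first_frame n m, g * last_frame n k) \<partial>?H)"
      by (rule nn_integral_distr) measurable
    also have "\<dots> = (\<integral>\<^sup>+g. G (g * p * first_frame n m, g * p * last_frame n k) \<partial>?H)"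
    proof (rule haar_right[OF stiefel_measure_invariant[OF order_refl] _ p(1), symmetric])
      show "(\<lambda>g. G (g * first_frame n m, g * last_frame n k)) \<in> borel_measurable (stiefel_borel n n)"
        by (rule measurable_compose[OF measurable_Pair[OF measurable_mult_stiefel_right[OF frames(2)] measurable_mult_stiefel_right[OF frames(1)]] G])
    qed
    also have "\<dots> = (\<integral>\<^sup>+g. G (g * last_frame n m, g * first_frame n k) \<partial>?H)"
      using orthogonalD(4,5)[OF p(1)] k m
      by (intro nn_integral_cong) (auto simp: space_stiefel_measure stiefel_def mat_assoc p(2,3))
    also have "\<dots> = (\<integral>\<^sup>+y. G y \<partial>distr ?H ?S2 (\<lambda>g. (g * last_frame n m, g * first_frame n k)))"
      by (rule nn_integral_distr[symmetric]) measurable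
    finally show "(\<integral>\<^sup>+y. G y \<partial>distr ?H ?S2 (\<lambda>g. (g * first_frame n m, g * last_frame n k))) =
      (\<integral>\<^sup>+y. G y \<partial>distr ?H ?S2 (\<lambda>g. (g * last_frame n m, g * first_frame n k)))" .
  qed simp
  also have "\<dots> = distr (stiefel_measure n m \<Otimes>\<^sub>M stiefel_measure (n - m) k) ?S2 (\<lambda>x. (fst x, section_embed n m x))"
    by (rule frame_pair_law[OF km', symmetric])
  finally show ?thesis .
qed

section \<open>The kernels\<close>

lemma absdet_cosine:
  assumes u: "u \<in> stiefel n k" and v: "v \<in> stiefel n m" and mk: "m \<le> k"
  shows "absdet (transpose_mat v * u * transpose_mat u * v) = complex_of_real (gram_det (u\<^sup>T * v))"
proof -
  note d = stiefelD(3,4)[OF u] stiefelD(3,4)[OF v]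
  have "v\<^sup>T * u * u\<^sup>T * v = (u\<^sup>T * v)\<^sup>T * (u\<^sup>T * v)"
    using d by (simp add: mat_assoc mat_transpose_mult)
  moreover have "0 \<le> gram_det (u\<^sup>T * v)"
    using d mk by (intro gram_det_nonneg) simp
  ultimately show ?thesis by (simp add: absdet_def gram_det_def)
qed

text \<open>The determinant \<open>|I - w' v v' w|\<close> in the kernel of the sine transform.\<close>

definition sine_det :: "nat \<Rightarrow> real mat \<Rightarrow> real mat \<Rightarrow> real" where
  "sine_det m v w = Determinant.det (1\<^sub>m m - (v\<^sup>T * w)\<^sup>T * (v\<^sup>T * w))"

text \<open>Pythagoras: \<open>w' w = I\<close> is the sum of the Gram matrices of the components of \<open>w\<close> along \<open>v\<close> and along its orthogonal complement.\<close>

lemma gram_det_complement: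
  assumes m: "m \<le> n" and g: "g \<in> orthogonal_group n" "g * last_frame n m = v" and w: "w \<in> stiefel n m"
  shows "gram_det ((first_frame n (n - m))\<^sup>T * (g\<^sup>T * w)) = sine_det m v w"
proof -
  let ?F = "first_frame n (n - m)" and ?E = "last_frame n m"
  note gd = orthogonalD(4,5)[OF g(1)] and wd = stiefelD(3,4)[OF w]
  define X where "X = g\<^sup>T * w"
  have X: "dim_row X = n" "dim_col X = m" using gd wd by (auto simp: X_def)
  have v: "v\<^sup>T * w = ?E\<^sup>T * X"
    using gd wd m by (simp add: g(2)[symmetric] mat_transpose_mult mat_assoc X_def)
  have "1\<^sub>m m = X\<^sup>T * X"
    using gd wd orthogonal_cancel(2)[OF g(1), of w] stiefelD(2)[OF w] by (simp add: X_def mat_transpose_mult mat_assoc)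
  also have "\<dots> = X\<^sup>T * (?F * (?F\<^sup>T * X) + ?E * (?E\<^sup>T * X))"
    using resolve_frames[OF m X(1)] by simp
  also have "\<dots> = (?F\<^sup>T * X)\<^sup>T * (?F\<^sup>T * X) + (?E\<^sup>T * X)\<^sup>T * (?E\<^sup>T * X)"
    using X m by (simp add: mat_distrib_left mat_transpose_mult mat_assoc)
  finally have "1\<^sub>m m - (?E\<^sup>T * X)\<^sup>T * (?E\<^sup>T * X) =
      ((?F\<^sup>T * X)\<^sup>T * (?F\<^sup>T * X) + (?E\<^sup>T * X)\<^sup>T * (?E\<^sup>T * X)) - (?E\<^sup>T * X)\<^sup>T * (?E\<^sup>T * X)"
    by simp
  also have "\<dots> = (?F\<^sup>T * X)\<^sup>T * (?F\<^sup>T * X)"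
    using X m by (intro eq_matI) (auto simp del: index_mult_mat(1))
  finally show ?thesis
    unfolding sine_det_def v gram_det_def X_def[symmetric] by simp
qed

lemma sine_det_sym:
  assumes v: "v \<in> stiefel n m" and w: "w \<in> stiefel n m"
  shows "sine_det m v w = sine_det m w v"
  using det_one_minus_swap[of "w\<^sup>T * v" m "v\<^sup>T * w"] stiefelD(3,4)[OF v] stiefelD(3,4)[OF w]
  by (simp add: sine_det_def mat_transpose_mult)

lemma sine_det_nonneg:
  assumes "2 * m \<le> n" and v: "v \<in> stiefel n m" and w: "w \<in> stiefel n m"
  shows "0 \<le> sine_det m v w"
proof -
  have m: "m \<le> n" using assms(1) by simp
  note g = frame_section[OF v m]
  have "0 \<le> gram_det ((first_frame n (n - m))\<^sup>T * ((frame_section n m v)\<^sup>T * w))"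
    using assms(1) stiefelD(3,4)[OF w] orthogonalD(4,5)[OF g(1)] by (intro gram_det_nonneg) auto
  then show ?thesis unfolding gram_det_complement[OF m g w] .
qed

lemma absdet_sine:
  assumes "2 * m \<le> n" and v: "v \<in> stiefel n m" and w: "w \<in> stiefel n m"
  shows "absdet (1\<^sub>m m - transpose_mat w * v * transpose_mat v * w) = complex_of_real (sine_det m v w)"
proof -
  note d = stiefelD(3,4)[OF v] stiefelD(3,4)[OF w]
  have "w\<^sup>T * v * v\<^sup>T * w = (v\<^sup>T * w)\<^sup>T * (v\<^sup>T * w)"
    using d by (simp add: mat_assoc mat_transpose_mult)
  then show ?thesis
    using sine_det_nonneg[OF assms] by (simp add: absdet_def sine_det_def)
qed

lemma measurable_gram_det_pair:
  assumes "f \<in> measurable M (stiefel_borel n k)" "g \<in> measurable M (stiefel_borel n m)"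
  shows "(\<lambda>x. gram_det ((f x)\<^sup>T * g x)) \<in> borel_measurable M"
  by (rule measurable_gram_det[OF measurable_mat_mult[OF measurable_mat_transpose[OF measurable_stiefel_mat[OF assms(1)]]
        measurable_stiefel_mat[OF assms(2)]]])

lemma measurable_sine_det_pair:
  assumes f: "f \<in> measurable M (stiefel_borel n m)" and g: "g \<in> measurable M (stiefel_borel n m)"
  shows "(\<lambda>x. sine_det m (f x) (g x)) \<in> borel_measurable M"
proof -
  have fg: "(\<lambda>x. (f x)\<^sup>T * g x) \<in> measurable M (mat_borel m m)"
    by (rule measurable_mat_mult[OF measurable_mat_transpose[OF measurable_stiefel_mat[OF f]] measurable_stiefel_mat[OF g]])
  show ?thesis
    unfolding sine_det_def
    by (rule measurable_det[OF measurable_mat_minus[OF measurable_mat_const measurable_mat_mult[OF measurable_mat_transpose[OF fg] fg]]]) simp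
qed

lemma norm_of_real_powr_eq:
  "0 \<le> x \<Longrightarrow> complex_of_real (norm (complex_of_real x powr s)) = complex_of_real x powr of_real (Re s)"
  by (simp add: norm_powr_real_powr powr_of_real)

text \<open>The absolute value of a power is the power with the real part of the exponent. So the absolute
  moments are special cases of the complex ones.\<close>

lemma has_bochner_integral_norm_powr:
  assumes "has_bochner_integral M (\<lambda>x. complex_of_real (g x) powr of_real (Re s)) c"
    and "\<And>x. x \<in> space M \<Longrightarrow> 0 \<le> g x"
  shows "has_bochner_integral M (\<lambda>x. norm (complex_of_real (g x) powr s)) (Re c)"
proof -
  have "has_bochner_integral M (\<lambda>x. Re (complex_of_real (g x) powr of_real (Re s))) (Re c)"
    using assms(1) by (simp add: has_bochner_integral_iff integrable_Re integral_Re)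
  also have "?this \<longleftrightarrow> ?thesis"
    using assms(2) by (intro has_bochner_integral_cong) (auto simp: norm_of_real_powr_eq[symmetric])
  finally show ?thesis .
qed

text \<open>The kernel \<open>K(v, w)\<close> of the introduction, where \<open>g\<close> is a completion of \<open>v\<close>.\<close>

lemma complement_moment:
  assumes mk: "m \<le> k" and km: "k + m \<le> n" and s: "Re s > (real m - 1 - real k) / 2"
    and g: "g \<in> orthogonal_group n" "g * last_frame n m = v" and w: "w \<in> stiefel n m"
  shows "has_bochner_integral (stiefel_measure (n - m) k)
    (\<lambda>t. complex_of_real (gram_det ((g * (first_frame n (n - m) * t))\<^sup>T * w)) powr s)
    (frame_moment (n - m) m k s * complex_of_real (sine_det m v w) powr s)"
proof -
  have m: "m \<le> n" and kn: "k \<le> n - m" using km by auto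
  note d = orthogonalD(4,5)[OF g(1)] stiefelD(3,4)[OF w]
  let ?A = "(first_frame n (n - m))\<^sup>T * (g\<^sup>T * w)"
  have A: "?A \<in> carrier_mat (n - m) m" using d by simp
  have "has_bochner_integral (stiefel_measure (n - m) k) (\<lambda>t. complex_of_real (gram_det (t\<^sup>T * ?A)) powr s)
      (frame_moment (n - m) m k s * complex_of_real (sine_det m v w) powr s)"
    using stiefel_projection_moment[OF mk kn A s] unfolding gram_det_complement[OF m g w] .
  also have "?this \<longleftrightarrow> ?thesis"
    using d by (intro has_bochner_integral_cong refl)
      (auto simp: space_stiefel_measure[OF kn] stiefel_def mat_transpose_mult mat_assoc)
  finally show ?thesis .
qed

lemma complement_moment_norm:
  assumes mk: "m \<le> k" and km: "k + m \<le> n" and s: "Re s > (real m - 1 - real k) / 2"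
    and g: "g \<in> orthogonal_group n" "g * last_frame n m = v" and w: "w \<in> stiefel n m" and v: "v \<in> stiefel n m"
  shows "(LINT t|stiefel_measure (n - m) k.
      norm (complex_of_real (gram_det ((g * (first_frame n (n - m) * t))\<^sup>T * w)) powr s)) =
    Re (frame_moment (n - m) m k (of_real (Re s))) * norm (complex_of_real (sine_det m v w) powr s)"
proof -
  have m: "m \<le> n" and kn: "k \<le> n - m" and mm: "2 * m \<le> n" using km mk by auto
  note d = orthogonalD(4,5)[OF g(1)] stiefelD(3,4)[OF w]
  have "has_bochner_integral (stiefel_measure (n - m) k)
    (\<lambda>t. norm (complex_of_real (gram_det ((g * (first_frame n (n - m) * t))\<^sup>T * w)) powr s))
    (Re (frame_moment (n - m) m k (of_real (Re s)) * complex_of_real (sine_det m v w) powr of_real (Re s)))"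
    using s d mk by (intro has_bochner_integral_norm_powr complement_moment[OF mk km _ g w] gram_det_nonneg)
      (auto simp: space_stiefel_measure[OF kn] stiefel_def)
  then show ?thesis
    using norm_of_real_powr_eq[OF sine_det_nonneg[OF mm v w], of s, symmetric]
    by (simp add: has_bochner_integral_iff)
qed

text \<open>The sine kernel of \<open>v\<close> is the cosine kernel of an \<open>(n - m)\<close>-frame that spans the complement of \<open>v\<close>,
  so its integrability is the case \<open>k = n - m\<close> of \<open>stiefel_gram_det_moment\<close>.\<close>

lemma sine_moment_norm:
  assumes mk: "m \<le> k" and km: "k + m \<le> n" and s: "Re s > (real m - 1 - real k) / 2" and v: "v \<in> stiefel n m"
  shows "has_bochner_integral (stiefel_measure n m) (\<lambda>w. norm (complex_of_real (sine_det m v w) powr s))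
    (Re (frame_moment n m (n - m) (of_real (Re s))))"
proof -
  have m: "m \<le> n" and mm: "m \<le> n - m" "2 * m \<le> n" and nm: "n - m \<le> n" using km mk by auto
  note g = frame_section[OF v m]
  let ?a = "frame_section n m v * first_frame n (n - m)"
  have a: "?a \<in> stiefel n (n - m)"
    by (rule orthogonal_mult_stiefel[OF g(1) first_frame_stiefel[OF nm]])
  have s': "Re (of_real (Re s)) > (real m - 1 - real (n - m)) / 2"
    using s km by (simp add: of_nat_diff field_simps)
  have "has_bochner_integral (stiefel_measure n m) (\<lambda>w. complex_of_real (gram_det (?a\<^sup>T * w)) powr of_real (Re s))
      (frame_moment n m (n - m) (of_real (Re s)))"
    by (rule stiefel_gram_det_moment[OF mm(1) nm a s'])
  also have "?this \<longleftrightarrow> has_bochner_integral (stiefel_measure n m) (\<lambda>w. complex_of_real (sine_det m v w) powr of_real (Re s))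
      (frame_moment n m (n - m) (of_real (Re s)))"
  proof (rule has_bochner_integral_cong[OF refl _ refl])
    fix w assume "w \<in> space (stiefel_measure n m)"
    then have w: "w \<in> stiefel n m" by (simp add: space_stiefel_measure[OF m])
    have "?a\<^sup>T * w = (first_frame n (n - m))\<^sup>T * ((frame_section n m v)\<^sup>T * w)"
      using orthogonalD(4,5)[OF g(1)] stiefelD(3,4)[OF w] by (simp add: mat_transpose_mult mat_assoc)
    then show "complex_of_real (gram_det (?a\<^sup>T * w)) powr of_real (Re s) = complex_of_real (sine_det m v w) powr of_real (Re s)"
      using gram_det_complement[OF m g w] by simp
  qed
  finally show ?thesis
    using sine_det_nonneg[OF mm(2) v]
    by (intro has_bochner_integral_norm_powr) (auto simp: space_stiefel_measure[OF m])
qed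

text \<open>\<open>Q_transform\<close> in terms of the exponent of its kernel.\<close>

definition sine_transform :: "nat \<Rightarrow> nat \<Rightarrow> complex \<Rightarrow> (real mat \<Rightarrow> complex) \<Rightarrow> real mat \<Rightarrow> complex" where
  "sine_transform n m s f v = (LINT w|stiefel_measure n m. f w * complex_of_real (sine_det m v w) powr s)"

text \<open>The integral of the absolute value of the kernel over \<open>v\<close> does not depend on \<open>w\<close>, so the theorem of Fubini
  applies to \<open>f w\<close> times the kernel.\<close>

lemma sine_transform_integrable:
  assumes mk: "m \<le> k" and km: "k + m \<le> n" and s: "Re s > (real m - 1 - real k) / 2"
    and f: "integrable (stiefel_measure n m) f"
  shows "integrable (stiefel_measure n m) (sine_transform n m s f)"
    "AE v in stiefel_measure n m. integrable (stiefel_measure n m) (\<lambda>w. f w * complex_of_real (sine_det m v w) powr s)"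
proof -
  have m: "m \<le> n" using km by simp
  let ?V = "stiefel_measure n m"
  note [measurable_cong] = sets_stiefel_measure[OF m]
  interpret V: prob_space ?V by (rule prob_space_stiefel_measure[OF m])
  interpret VV: pair_prob_space ?V ?V ..
  have f_meas[measurable]: "f \<in> borel_measurable ?V" using f by auto
  have sine[measurable]: "(\<lambda>x. sine_det m (snd x) (fst x)) \<in> borel_measurable (?V \<Otimes>\<^sub>M ?V)"
    by (rule measurable_sine_det_pair) measurable
  have "integrable (?V \<Otimes>\<^sub>M ?V) (\<lambda>x. f (fst x) * complex_of_real (sine_det m (snd x) (fst x)) powr s)"
  proof (rule VV.Fubini_integrable)
    have bound: "has_bochner_integral ?V (\<lambda>v. norm (complex_of_real (sine_det m v w) powr s)) (Re (frame_moment n m (n - m) (of_real (Re s))))"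
      if w: "w \<in> stiefel n m" for w
    proof -
      have "has_bochner_integral ?V (\<lambda>v. norm (complex_of_real (sine_det m v w) powr s)) (Re (frame_moment n m (n - m) (of_real (Re s)))) \<longleftrightarrow>
         has_bochner_integral ?V (\<lambda>v. norm (complex_of_real (sine_det m w v) powr s)) (Re (frame_moment n m (n - m) (of_real (Re s))))"
        by (rule has_bochner_integral_cong[OF refl _ refl])
          (simp only: space_stiefel_measure[OF m] sine_det_sym[OF w])
      then show ?thesis using sine_moment_norm[OF mk km s w] by blast
    qed
    have "integrable ?V (\<lambda>w. norm (f w) * Re (frame_moment n m (n - m) (of_real (Re s))))"
      using f by simp
    also have "?this \<longleftrightarrow> integrable ?V (\<lambda>w. LINT v|?V. norm (f (fst (w, v)) * complex_of_real (sine_det m (snd (w, v)) (fst (w, v))) powr s))"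
      by (intro Bochner_Integration.integrable_cong refl)
        (use bound in \<open>simp add: space_stiefel_measure[OF m] norm_mult has_bochner_integral_iff\<close>)
    finally show "integrable ?V (\<lambda>w. LINT v|?V. norm (f (fst (w, v)) * complex_of_real (sine_det m (snd (w, v)) (fst (w, v))) powr s))" .
    have "integrable ?V (\<lambda>v. f w * complex_of_real (sine_det m v w) powr s)" if w: "w \<in> stiefel n m" for w
    proof (rule integrable_mult_right, rule Bochner_Integration.integrable_bound)
      show "integrable ?V (\<lambda>v. norm (complex_of_real (sine_det m v w) powr s))"
        using bound[OF w] by (simp add: has_bochner_integral_iff)
      have "(\<lambda>v. sine_det m v w) \<in> borel_measurable ?V"
        using w by (intro measurable_sine_det_pair[of _ _ n]) auto
      then show "(\<lambda>v. complex_of_real (sine_det m v w) powr s) \<in> borel_measurable ?V"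
        by measurable
    qed auto
    then show "AE w in ?V. integrable ?V (\<lambda>v. f (fst (w, v)) * complex_of_real (sine_det m (snd (w, v)) (fst (w, v))) powr s)"
      by (auto simp: space_stiefel_measure[OF m])
  qed measurable
  then have int: "integrable (?V \<Otimes>\<^sub>M ?V) (\<lambda>(w, v). f w * complex_of_real (sine_det m v w) powr s)"
    by (simp add: case_prod_beta')
  show "integrable ?V (sine_transform n m s f)"
    unfolding sine_transform_def[abs_def] by (rule VV.integrable_snd[OF int])
  show "AE v in ?V. integrable ?V (\<lambda>w. f w * complex_of_real (sine_det m v w) powr s)"
    by (rule VV.AE_integrable_snd[OF int])
qed

section \<open>The composed transforms\<close>

lemma cosine_transform_eq:
  assumes mk: "m \<le> k" and m: "m \<le> n" and u: "u \<in> stiefel n k"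
  shows "cosine_transform n m k \<alpha> f u =
    (LINT w|stiefel_measure n m. f w * complex_of_real (gram_det (u\<^sup>T * w)) powr ((\<alpha> - of_nat k) / 2))"
  unfolding cosine_transform_def
  by (intro Bochner_Integration.integral_cong refl) (simp add: space_stiefel_measure[OF m] absdet_cosine[OF u _ mk])

lemma dual_cosine_transform_eq:
  assumes mk: "m \<le> k" and k: "k \<le> n" and v: "v \<in> stiefel n m"
  shows "dual_cosine_transform n m k \<alpha> \<phi> v =
    (LINT u|stiefel_measure n k. \<phi> u * complex_of_real (gram_det (u\<^sup>T * v)) powr ((\<alpha> - of_nat k) / 2))"
  unfolding dual_cosine_transform_def
  by (intro Bochner_Integration.integral_cong refl) (simp add: space_stiefel_measure[OF k] absdet_cosine[OF _ v mk])

text \<open>The two definitions differ in the roles of \<open>m\<close> and \<open>k\<close> only.\<close>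

lemma dual_funk_is_funk: "dual_funk n m k = funk n k m"
  by (intro ext) (simp add: dual_funk_def funk_def)

lemma measurable_cosine_transform:
  assumes mk: "m \<le> k" and m: "m \<le> n" and f: "f \<in> borel_measurable (stiefel_borel n m)"
  shows "cosine_transform n m k \<alpha> f \<in> borel_measurable (stiefel_borel n k)"
proof -
  let ?V = "stiefel_measure n m"
  note [measurable_cong] = sets_stiefel_measure[OF m]
  note [measurable] = f
  interpret V: prob_space ?V by (rule prob_space_stiefel_measure[OF m])
  have [measurable]: "(\<lambda>x. gram_det ((fst x)\<^sup>T * snd x)) \<in> borel_measurable (stiefel_borel n k \<Otimes>\<^sub>M ?V)"
    by (rule measurable_gram_det_pair) measurable
  have "(\<lambda>u. LINT w|?V. f w * complex_of_real (gram_det (u\<^sup>T * w)) powr ((\<alpha> - of_nat k) / 2)) \<in> borel_measurable (stiefel_borel n k)"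
    by (rule V.borel_measurable_lebesgue_integral) (simp add: case_prod_beta', measurable)
  also have "?this \<longleftrightarrow> ?thesis"
    by (rule measurable_cong) (simp add: cosine_transform_eq[OF mk m])
  finally show ?thesis .
qed

lemma measurable_dual_cosine_transform:
  assumes mk: "m \<le> k" and k: "k \<le> n" and \<phi>: "\<phi> \<in> borel_measurable (stiefel_borel n k)"
  shows "dual_cosine_transform n m k \<alpha> \<phi> \<in> borel_measurable (stiefel_borel n m)"
proof -
  let ?U = "stiefel_measure n k"
  note [measurable_cong] = sets_stiefel_measure[OF k]
  note [measurable] = \<phi>
  interpret U: prob_space ?U by (rule prob_space_stiefel_measure[OF k])
  have [measurable]: "(\<lambda>x. gram_det ((snd x)\<^sup>T * fst x)) \<in> borel_measurable (stiefel_borel n m \<Otimes>\<^sub>M ?U)"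
    by (rule measurable_gram_det_pair) measurable
  have "(\<lambda>v. LINT u|?U. \<phi> u * complex_of_real (gram_det (u\<^sup>T * v)) powr ((\<alpha> - of_nat k) / 2)) \<in> borel_measurable (stiefel_borel n m)"
    by (rule U.borel_measurable_lebesgue_integral) (simp add: case_prod_beta', measurable)
  also have "?this \<longleftrightarrow> ?thesis"
    by (rule measurable_cong) (simp add: dual_cosine_transform_eq[OF mk k])
  finally show ?thesis .
qed

text \<open>The step that both compositions share. It exchanges integrals when the integral of a power of \<open>T\<close> over
  its second argument is a multiple of the same power of \<open>S\<close>, likewise for absolute values, and \<open>f\<close> is
  integrable against the latter.\<close>

lemma integrable_pair_kernel:
  fixes f :: "real mat \<Rightarrow> complex" and T :: "real mat \<Rightarrow> real mat \<Rightarrow> real" and S :: "real mat \<Rightarrow> real"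
  assumes m: "m \<le> n" and kl: "k \<le> l" and f: "f \<in> borel_measurable (stiefel_measure n m)"
    and T: "(\<lambda>x. T (fst x) (snd x)) \<in> borel_measurable (stiefel_measure n m \<Otimes>\<^sub>M stiefel_measure l k)"
    and int: "\<And>w. w \<in> stiefel n m \<Longrightarrow> has_bochner_integral (stiefel_measure l k) (\<lambda>t. complex_of_real (T w t) powr s) (c * complex_of_real (S w) powr s)"
    and norm: "\<And>w. w \<in> stiefel n m \<Longrightarrow> (LINT t|stiefel_measure l k. norm (complex_of_real (T w t) powr s)) = C * norm (complex_of_real (S w) powr s)"
    and fS: "integrable (stiefel_measure n m) (\<lambda>w. f w * complex_of_real (S w) powr s)"
  shows "integrable (stiefel_measure n m \<Otimes>\<^sub>M stiefel_measure l k) (\<lambda>(w, t). f w * complex_of_real (T w t) powr s)"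
    "(LINT w|stiefel_measure n m. LINT t|stiefel_measure l k. f w * complex_of_real (T w t) powr s) =
      c * (LINT w|stiefel_measure n m. f w * complex_of_real (S w) powr s)"
proof -
  let ?V = "stiefel_measure n m" and ?W = "stiefel_measure l k"
  interpret V: prob_space ?V by (rule prob_space_stiefel_measure[OF m])
  interpret W: prob_space ?W by (rule prob_space_stiefel_measure[OF kl])
  interpret VW: pair_prob_space ?V ?W ..
  note [measurable] = f T
  have "integrable (?V \<Otimes>\<^sub>M ?W) (\<lambda>x. f (fst x) * complex_of_real (T (fst x) (snd x)) powr s)"
  proof (rule VW.Fubini_integrable)
    have "integrable ?V (\<lambda>w. C * norm (f w * complex_of_real (S w) powr s))"
      using fS by (intro integrable_mult_right integrable_norm)
    also have "?this \<longleftrightarrow> integrable ?V (\<lambda>w. LINT t|?W. norm (f (fst (w, t)) * complex_of_real (T (fst (w, t)) (snd (w, t))) powr s))"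
      by (intro Bochner_Integration.integrable_cong refl) (simp add: space_stiefel_measure[OF m] norm_mult norm mult_ac)
    finally show "integrable ?V (\<lambda>w. LINT t|?W. norm (f (fst (w, t)) * complex_of_real (T (fst (w, t)) (snd (w, t))) powr s))" .
    have "integrable ?W (\<lambda>t. f w * complex_of_real (T w t) powr s)" if w: "w \<in> stiefel n m" for w
      using int[OF w] by (intro integrable_mult_right) (auto simp: has_bochner_integral_iff)
    then show "AE w in ?V. integrable ?W (\<lambda>t. f (fst (w, t)) * complex_of_real (T (fst (w, t)) (snd (w, t))) powr s)"
      by (auto simp: space_stiefel_measure[OF m])
  qed measurable
  then show "integrable (?V \<Otimes>\<^sub>M ?W) (\<lambda>(w, t). f w * complex_of_real (T w t) powr s)"
    by (simp add: case_prod_beta')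
  have "(LINT w|?V. LINT t|?W. f w * complex_of_real (T w t) powr s) = (LINT w|?V. c * (f w * complex_of_real (S w) powr s))"
    using int by (intro Bochner_Integration.integral_cong refl) (auto simp: space_stiefel_measure[OF m] has_bochner_integral_iff mult_ac)
  then show "(LINT w|?V. LINT t|?W. f w * complex_of_real (T w t) powr s) = c * (LINT w|?V. f w * complex_of_real (S w) powr s)"
    by simp
qed

text \<open>Fubini, with the kernel computed by \<open>complement_moment\<close>.\<close>

lemma dual_funk_cosine:
  assumes mk: "m \<le> k" and km: "k + m \<le> n" and s: "Re s > (real m - 1 - real k) / 2" "s = (\<alpha> - of_nat k) / 2"
    and f: "f \<in> borel_measurable (stiefel_borel n m)" and v: "v \<in> stiefel n m"
    and int: "integrable (stiefel_measure n m) (\<lambda>w. f w * complex_of_real (sine_det m v w) powr s)"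
  shows "dual_funk n m k (cosine_transform n m k \<alpha> f) v = frame_moment (n - m) m k s * sine_transform n m s f v"
proof -
  have m: "m \<le> n" and kn: "k \<le> n" "k \<le> n - m" and mk': "m + k \<le> n" using km by auto
  let ?V = "stiefel_measure n m" and ?W = "stiefel_measure (n - m) k"
  interpret V: prob_space ?V by (rule prob_space_stiefel_measure[OF m])
  interpret W: prob_space ?W by (rule prob_space_stiefel_measure[OF kn(2)])
  interpret VW: pair_prob_space ?V ?W ..
  note [measurable_cong] = sets_stiefel_measure[OF m] sets_stiefel_measure[OF kn(2)]
  note g = frame_section[OF v m]
  define e where "e t = frame_section n m v * (first_frame n (n - m) * t)" for t
  have e[measurable]: "e \<in> measurable (stiefel_borel (n - m) k) (stiefel_borel n k)"
    unfolding e_def by (rule measurable_embed_first_frame[OF g(1)]) simp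
  have e_mem: "e t \<in> stiefel n k" if "t \<in> stiefel (n - m) k" for t
    using measurable_space[OF e] that by simp
  have T: "(\<lambda>x. gram_det ((e (snd x))\<^sup>T * fst x)) \<in> borel_measurable (?V \<Otimes>\<^sub>M ?W)"
    by (rule measurable_gram_det_pair) measurable
  have fV: "f \<in> borel_measurable ?V" using f by (simp add: measurable_stiefel_measure_iff[OF m])
  note pair = integrable_pair_kernel[OF m kn(2) fV T complement_moment[OF mk km s(1) g, folded e_def]
      complement_moment_norm[OF mk km s(1) g _ v, folded e_def] int]
  have "dual_funk n m k (cosine_transform n m k \<alpha> f) v = (LINT t|?W. cosine_transform n m k \<alpha> f (e t))"
    unfolding dual_funk_is_funk e_def
    by (rule funk_eq[OF mk' v g measurable_cosine_transform[OF mk m f]])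
  also have "\<dots> = (LINT t|?W. LINT w|?V. f w * complex_of_real (gram_det ((e t)\<^sup>T * w)) powr s)"
    unfolding s(2) by (intro Bochner_Integration.integral_cong refl cosine_transform_eq[OF mk m])
      (simp add: space_stiefel_measure[OF kn(2)] e_mem)
  also have "\<dots> = (LINT w|?V. LINT t|?W. f w * complex_of_real (gram_det ((e t)\<^sup>T * w)) powr s)"
    by (rule VW.Fubini_integral) (rule pair(1))
  also have "\<dots> = frame_moment (n - m) m k s * sine_transform n m s f v"
    unfolding sine_transform_def by (rule pair(2))
  finally show ?thesis .
qed

text \<open>The inner integral of the Funk transform and the outer one over \<open>u\<close> form an integral over pairs
  \<open>(w, u)\<close> of orthogonal frames. By \<open>frame_pair_law_swap\<close> it may be taken over \<open>w\<close> first, and then the kernel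
  is again that of \<open>complement_moment\<close>.\<close>

lemma dual_cosine_funk:
  assumes mk: "m \<le> k" and km: "k + m \<le> n" and s: "Re s > (real m - 1 - real k) / 2" "s = (\<alpha> - of_nat k) / 2"
    and f: "f \<in> borel_measurable (stiefel_borel n m)" and v: "v \<in> stiefel n m"
    and int: "integrable (stiefel_measure n m) (\<lambda>w. f w * complex_of_real (sine_det m v w) powr s)"
  shows "dual_cosine_transform n m k \<alpha> (funk n m k f) v = frame_moment (n - m) m k s * sine_transform n m s f v"
proof -
  have m: "m \<le> n" "m \<le> n - k" and kn: "k \<le> n" "k \<le> n - m" using km by auto
  let ?V = "stiefel_measure n m" and ?W = "stiefel_measure (n - m) k"
  let ?U = "stiefel_measure n k" and ?O = "stiefel_measure (n - k) m"
  let ?S = "stiefel_borel n m \<Otimes>\<^sub>M stiefel_borel n k"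
  interpret V: prob_space ?V by (rule prob_space_stiefel_measure[OF m(1)])
  interpret W: prob_space ?W by (rule prob_space_stiefel_measure[OF kn(2)])
  interpret U: prob_space ?U by (rule prob_space_stiefel_measure[OF kn(1)])
  interpret O: prob_space ?O by (rule prob_space_stiefel_measure[OF m(2)])
  interpret VW: pair_prob_space ?V ?W ..
  interpret UO: pair_prob_space ?U ?O ..
  note [measurable_cong] = sets_stiefel_measure[OF m(1)] sets_stiefel_measure[OF m(2)] sets_stiefel_measure[OF kn(1)] sets_stiefel_measure[OF kn(2)]
  note [measurable] = measurable_section_embed[OF m(1), of k] measurable_section_embed[OF kn(1), of m] f
  define \<Psi> where "\<Psi> x = f (fst x) * complex_of_real (gram_det ((snd x)\<^sup>T * v)) powr s" for x
  have ker: "(\<lambda>u. gram_det (u\<^sup>T * v)) \<in> borel_measurable (stiefel_borel n k)"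
    by (rule measurable_gram_det_right_frame[OF stiefelD(1)[OF v]])
  note [measurable] = ker
  have \<Psi>[measurable]: "\<Psi> \<in> borel_measurable ?S"
    unfolding \<Psi>_def by measurable
  have maps[measurable]: "(\<lambda>x. (fst x, section_embed n m x)) \<in> measurable (?V \<Otimes>\<^sub>M ?W) ?S"
    "(\<lambda>x. (section_embed n k x, fst x)) \<in> measurable (?U \<Otimes>\<^sub>M ?O) ?S"
    by measurable
  have fV: "f \<in> borel_measurable ?V" using f by (simp add: measurable_stiefel_measure_iff[OF m(1)])
  have T: "(\<lambda>x. gram_det ((section_embed n m (fst x, snd x))\<^sup>T * v)) \<in> borel_measurable (?V \<Otimes>\<^sub>M ?W)"
    using measurable_compose[OF _ ker, of "section_embed n m" "?V \<Otimes>\<^sub>M ?W"] by simp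
  have int': "integrable ?V (\<lambda>w. f w * complex_of_real (sine_det m w v) powr s)"
  proof -
    have "integrable ?V (\<lambda>w. f w * complex_of_real (sine_det m w v) powr s) \<longleftrightarrow> integrable ?V (\<lambda>w. f w * complex_of_real (sine_det m v w) powr s)"
      by (intro Bochner_Integration.integrable_cong refl) (simp only: space_stiefel_measure[OF m(1)] sine_det_sym[OF v])
    then show ?thesis using int by blast
  qed
  have moment: "has_bochner_integral ?W (\<lambda>t. complex_of_real (gram_det ((section_embed n m (w, t))\<^sup>T * v)) powr s)
        (frame_moment (n - m) m k s * complex_of_real (sine_det m w v) powr s)"
    "(LINT t|?W. norm (complex_of_real (gram_det ((section_embed n m (w, t))\<^sup>T * v)) powr s)) =
        Re (frame_moment (n - m) m k (of_real (Re s))) * norm (complex_of_real (sine_det m w v) powr s)"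
    if w: "w \<in> stiefel n m" for w
    using complement_moment[OF mk km s(1) frame_section[OF w m(1)] v]
      complement_moment_norm[OF mk km s(1) frame_section[OF w m(1)] v w] by (simp_all add: section_embed_def)
  note pair = integrable_pair_kernel[OF m(1) kn(2) fV T moment int']
  have "integrable (?V \<Otimes>\<^sub>M ?W) (\<lambda>x. \<Psi> (fst x, section_embed n m x))"
    using pair(1) by (simp add: \<Psi>_def case_prod_beta')
  then have "integrable (distr (?V \<Otimes>\<^sub>M ?W) ?S (\<lambda>x. (fst x, section_embed n m x))) \<Psi>"
    by (subst integrable_distr_eq) measurable
  then have "integrable (distr (?U \<Otimes>\<^sub>M ?O) ?S (\<lambda>x. (section_embed n k x, fst x))) \<Psi>"
    unfolding frame_pair_law_swap[OF km] .
  then have UO_int: "integrable (?U \<Otimes>\<^sub>M ?O) (\<lambda>x. \<Psi> (section_embed n k x, fst x))"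
    by (subst (asm) integrable_distr_eq) measurable
  have "dual_cosine_transform n m k \<alpha> (funk n m k f) v =
      (LINT u|?U. funk n m k f u * complex_of_real (gram_det (u\<^sup>T * v)) powr s)"
    unfolding s(2) by (rule dual_cosine_transform_eq[OF mk kn(1) v])
  also have "\<dots> = (LINT u|?U. LINT w|?O. \<Psi> (section_embed n k (u, w), fst (u, w)))"
  proof (rule Bochner_Integration.integral_cong[OF refl])
    fix u assume "u \<in> space ?U"
    then have u: "u \<in> stiefel n k" by (simp add: space_stiefel_measure[OF kn(1)])
    show "funk n m k f u * complex_of_real (gram_det (u\<^sup>T * v)) powr s = (LINT w|?O. \<Psi> (section_embed n k (u, w), fst (u, w)))"
      by (simp add: funk_eq[OF km u frame_section[OF u kn(1)] f] \<Psi>_def section_embed_def)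
  qed
  also have "\<dots> = (LINT x|(?U \<Otimes>\<^sub>M ?O). \<Psi> (section_embed n k x, fst x))"
    using UO.integral_fst'[OF UO_int] by simp
  also have "\<dots> = (LINT y|distr (?U \<Otimes>\<^sub>M ?O) ?S (\<lambda>x. (section_embed n k x, fst x)). \<Psi> y)"
    by (rule integral_distr[symmetric]) measurable
  also have "\<dots> = (LINT x|(?V \<Otimes>\<^sub>M ?W). \<Psi> (fst x, section_embed n m x))"
    unfolding frame_pair_law_swap[OF km] by (rule integral_distr) measurable
  also have "\<dots> = (LINT w|?V. LINT t|?W. f w * complex_of_real (gram_det ((section_embed n m (w, t))\<^sup>T * v)) powr s)"
    using VW.integral_fst'[OF pair(1)] by (simp add: \<Psi>_def case_prod_beta')
  also have "\<dots> = frame_moment (n - m) m k s * (LINT w|?V. f w * complex_of_real (sine_det m w v) powr s)"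
    by (rule pair(2))
  also have "(LINT w|?V. f w * complex_of_real (sine_det m w v) powr s) = sine_transform n m s f v"
    unfolding sine_transform_def
    by (intro Bochner_Integration.integral_cong refl) (simp only: space_stiefel_measure[OF m(1)] sine_det_sym[OF v])
  finally show ?thesis .
qed

lemma eq_L1_cong:
  assumes "integrable M h" "f \<in> borel_measurable M" "g \<in> borel_measurable M" "AE x in M. f x = h x" "AE x in M. g x = h x"
  shows "eq_L1 M f g"
proof -
  have "integrable M f" "integrable M g"
    using assms integrable_cong_AE[of f M h] integrable_cong_AE[of g M h] by auto
  moreover have "AE x in M. f x = g x"
    using assms(4,5) by eventually_elim simp
  ultimately show ?thesis by (simp add: eq_L1_def)
qed

lemma funk_cosine_identity:
  assumes mk: "m \<le> k" and km: "k + m \<le> n" and f: "integrable (stiefel_measure n m) f"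
    and \<alpha>: "Re \<alpha> > real m - 1" and s: "s = (\<alpha> - of_nat k) / 2"
  shows "integrable (stiefel_measure n m) (sine_transform n m s f)"
    "dual_cosine_transform n m k \<alpha> (funk n m k f) \<in> borel_measurable (stiefel_measure n m)"
    "dual_funk n m k (cosine_transform n m k \<alpha> f) \<in> borel_measurable (stiefel_measure n m)"
    "AE v in stiefel_measure n m. dual_cosine_transform n m k \<alpha> (funk n m k f) v = frame_moment (n - m) m k s * sine_transform n m s f v"
    "AE v in stiefel_measure n m. dual_funk n m k (cosine_transform n m k \<alpha> f) v = frame_moment (n - m) m k s * sine_transform n m s f v"
proof -
  have m: "m \<le> n" and kn: "k \<le> n" and mk': "m + k \<le> n" using km by auto
  have s': "Re s > (real m - 1 - real k) / 2" using \<alpha> by (simp add: s)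
  have fb: "f \<in> borel_measurable (stiefel_borel n m)"
    using f by (simp add: measurable_stiefel_measure_iff[OF m, symmetric] borel_measurable_integrable)
  note sine = sine_transform_integrable[OF mk km s' f]
  show "integrable (stiefel_measure n m) (sine_transform n m s f)" by (rule sine)
  show "dual_cosine_transform n m k \<alpha> (funk n m k f) \<in> borel_measurable (stiefel_measure n m)"
    unfolding measurable_stiefel_measure_iff[OF m]
    by (rule measurable_dual_cosine_transform[OF mk kn measurable_funk[OF km fb]])
  show "dual_funk n m k (cosine_transform n m k \<alpha> f) \<in> borel_measurable (stiefel_measure n m)"
    unfolding measurable_stiefel_measure_iff[OF m] dual_funk_is_funk
    by (rule measurable_funk[OF mk' measurable_cosine_transform[OF mk m fb]])
  show "AE v in stiefel_measure n m. dual_cosine_transform n m k \<alpha> (funk n m k f) v = frame_moment (n - m) m k s * sine_transform n m s f v"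
    using sine(2) AE_space
  proof eventually_elim
    case (elim v)
    then show ?case
      by (intro dual_cosine_funk[OF mk km s' s fb]) (auto simp: space_stiefel_measure[OF m])
  qed
  show "AE v in stiefel_measure n m. dual_funk n m k (cosine_transform n m k \<alpha> f) v = frame_moment (n - m) m k s * sine_transform n m s f v"
    using sine(2) AE_space
  proof eventually_elim
    case (elim v)
    then show ?case
      by (intro dual_funk_cosine[OF mk km s' s fb]) (auto simp: space_stiefel_measure[OF m])
  qed
qed

lemma Q_transform_eq:
  assumes mm: "2 * m \<le> n" and v: "v \<in> stiefel n m" and s: "s = (\<beta> + of_nat m - of_nat n) / 2"
  shows "Q_transform n m \<beta> f v = sine_transform n m s f v"
  unfolding Q_transform_def sine_transform_def s
proof (intro Bochner_Integration.integral_cong refl)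
  have m: "m \<le> n" using mm by simp
  fix w assume "w \<in> space (stiefel_measure n m)"
  then have w: "w \<in> stiefel n m" by (simp add: space_stiefel_measure[OF m])
  show "f w * absdet (1\<^sub>m m - transpose_mat w * v * transpose_mat v * w) powr ((\<beta> + of_nat m - of_nat n) / 2) =
      f w * complex_of_real (sine_det m v w) powr ((\<beta> + of_nat m - of_nat n) / 2)"
    using absdet_sine[OF mm v w] by simp
qed

text \<open>Here \<open>u\<close> and \<open>v\<close> have equally many columns, so both determinants are the square of \<open>|u' v|\<close>.\<close>

lemma M_transform_eq:
  assumes m: "m \<le> n" and v: "v \<in> stiefel n m"
  shows "M_transform n m \<beta> \<phi> v = dual_cosine_transform n m m \<beta> \<phi> v"
  unfolding M_transform_def dual_cosine_transform_def
proof (intro Bochner_Integration.integral_cong refl)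
  fix u assume "u \<in> space (stiefel_measure n m)"
  then have u: "u \<in> stiefel n m" by (simp add: space_stiefel_measure[OF m])
  note d = stiefelD(3,4)[OF u] stiefelD(3,4)[OF v]
  have sq: "gram_det A = (Determinant.det A)\<^sup>2" if "dim_row A = m" "dim_col A = m" for A :: "real mat"
  proof -
    have "gram_det A = Determinant.det (A\<^sup>T) * Determinant.det A"
      unfolding gram_det_def using that by (intro det_mult[of _ m]) auto
    then show ?thesis using that by (simp add: det_transpose[of A m] power2_eq_square)
  qed
  have "v\<^sup>T * u = (u\<^sup>T * v)\<^sup>T" using d by (simp add: mat_transpose_mult)
  then have "gram_det (v\<^sup>T * u) = gram_det (u\<^sup>T * v)"
    using d by (subst (1 2) sq) (auto simp: det_transpose[of _ m])
  then have "absdet (u\<^sup>T * v * v\<^sup>T * u) = absdet (v\<^sup>T * u * u\<^sup>T * v)"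
    using absdet_cosine[OF u v order_refl] absdet_cosine[OF v u order_refl] by simp
  then show "\<phi> u * absdet (transpose_mat u * v * transpose_mat v * u) powr ((\<beta> - of_nat m) / 2) =
      \<phi> u * absdet (transpose_mat v * u * transpose_mat u * v) powr ((\<beta> - of_nat m) / 2)"
    by simp
qed

lemma Gamma_m_nonzero:
  assumes "Re z > (real m - 1) / 2"
  shows "Gamma_m m z \<noteq> 0"
proof -
  have "Gamma (z - of_nat j / 2) \<noteq> 0" if "j < m" for j
  proof (rule Gamma_nonzero_right_half_plane)
    have "real (Suc j) \<le> real m" using that by (intro of_nat_mono) simp
    then show "Re (z - of_nat j / 2) > 0" using assms by simp
  qed
  then show ?thesis by (auto simp: Gamma_m_def)
qed

theorem theorem4p3:
  fixes n m k :: nat and f :: "real mat \<Rightarrow> complex" and \<alpha> :: complex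
  assumes "1 \<le> m" and "m \<le> k" and "k + m \<le> n"
    and "integrable (stiefel_measure n m) f"
  shows "(Re \<alpha> > real m - 1 \<longrightarrow>
           eq_L1 (stiefel_measure n m)
             (dual_cosine_transform n m k \<alpha> (funk n m k f))
             (dual_funk n m k (cosine_transform n m k \<alpha> f)) \<and>
           eq_L1 (stiefel_measure n m)
             (dual_funk n m k (cosine_transform n m k \<alpha> f))
             (\<lambda>v. Gamma_m m (of_nat (n - m) / 2) * Gamma_m m (\<alpha> / 2)
                   / (Gamma_m m (of_nat k / 2)
                      * Gamma_m m ((\<alpha> + of_nat n - of_nat m - of_nat k) / 2))
                  * Q_transform n m (\<alpha> + of_nat n - of_nat k - of_nat m) f v)) \<and>
         (Re \<alpha> > real k - 1 \<longrightarrow>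
           eq_L1 (stiefel_measure n m)
             (dual_cosine_transform n m k \<alpha> (funk n m k f))
             (dual_funk n m k (cosine_transform n m k \<alpha> f)) \<and>
           eq_L1 (stiefel_measure n m)
             (dual_funk n m k (cosine_transform n m k \<alpha> f))
             (\<lambda>v. Gamma_m m (of_nat m / 2) * Gamma_m m (\<alpha> / 2)
                   / (Gamma_m m (of_nat k / 2)
                      * Gamma_m m ((\<alpha> + of_nat m - of_nat k) / 2))
                  * M_transform n m (\<alpha> + of_nat m - of_nat k) (funk n m m f) v))"
proof -
  have mk: "m \<le> k" and km: "k + m \<le> n" and f: "integrable (stiefel_measure n m) f" by fact+
  have m: "m \<le> n" and mm: "2 * m \<le> n" "m + m \<le> n" and kn: "k \<le> n - m" and mn: "m \<le> n - m" using mk km by auto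
  let ?V = "stiefel_measure n m"
  define s where "s = (\<alpha> - of_nat k) / 2"
  let ?c = "frame_moment (n - m) m k s"
  have c_eq: "?c = Gamma_m m (of_nat (n - m) / 2) * Gamma_m m (\<alpha> / 2)
      / (Gamma_m m (of_nat k / 2) * Gamma_m m ((\<alpha> + of_nat n - of_nat m - of_nat k) / 2))"
  proof -
    have eqs: "of_nat k / 2 + s = \<alpha> / 2" "of_nat (n - m) / 2 + s = (\<alpha> + of_nat n - of_nat m - of_nat k) / 2"
      using m by (simp_all add: s_def of_nat_diff field_simps)
    show ?thesis
      unfolding frame_moment_Gamma[OF mk kn] eqs ..
  qed
  have main: "eq_L1 ?V (dual_cosine_transform n m k \<alpha> (funk n m k f)) (dual_funk n m k (cosine_transform n m k \<alpha> f))"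
    and Q: "eq_L1 ?V (dual_funk n m k (cosine_transform n m k \<alpha> f)) (\<lambda>v. ?c * Q_transform n m (\<alpha> + of_nat n - of_nat k - of_nat m) f v)"
    if \<alpha>: "Re \<alpha> > real m - 1"
  proof -
    note id = funk_cosine_identity[OF mk km f \<alpha> s_def]
    have ci: "integrable ?V (\<lambda>v. ?c * sine_transform n m s f v)"
      using id(1) by (intro integrable_mult_right)
    show "eq_L1 ?V (dual_cosine_transform n m k \<alpha> (funk n m k f)) (dual_funk n m k (cosine_transform n m k \<alpha> f))"
      by (rule eq_L1_cong[OF ci id(2,3,4,5)])
    have Q_eq: "?c * Q_transform n m (\<alpha> + of_nat n - of_nat k - of_nat m) f v = ?c * sine_transform n m s f v" if "v \<in> space ?V" for v
    proof -
      have "Q_transform n m (\<alpha> + of_nat n - of_nat k - of_nat m) f v = sine_transform n m s f v"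
        using that by (intro Q_transform_eq[OF mm(1)]) (simp_all add: space_stiefel_measure[OF m] s_def)
      then show ?thesis by simp
    qed
    show "eq_L1 ?V (dual_funk n m k (cosine_transform n m k \<alpha> f)) (\<lambda>v. ?c * Q_transform n m (\<alpha> + of_nat n - of_nat k - of_nat m) f v)"
    proof (rule eq_L1_cong[OF ci id(3) _ id(5)])
      show "(\<lambda>v. ?c * Q_transform n m (\<alpha> + of_nat n - of_nat k - of_nat m) f v) \<in> borel_measurable ?V"
        using borel_measurable_integrable[OF ci] by (subst measurable_cong[OF Q_eq])
      show "AE v in ?V. ?c * Q_transform n m (\<alpha> + of_nat n - of_nat k - of_nat m) f v = ?c * sine_transform n m s f v"
        using AE_space by eventually_elim (rule Q_eq)
    qed
  qed
  have M: "eq_L1 ?V (dual_funk n m k (cosine_transform n m k \<alpha> f))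
      (\<lambda>v. Gamma_m m (of_nat m / 2) * Gamma_m m (\<alpha> / 2) / (Gamma_m m (of_nat k / 2) * Gamma_m m ((\<alpha> + of_nat m - of_nat k) / 2))
        * M_transform n m (\<alpha> + of_nat m - of_nat k) (funk n m m f) v)" (is "eq_L1 _ _ (\<lambda>v. ?d * ?M v)")
    if \<alpha>: "Re \<alpha> > real k - 1"
  proof -
    \<comment> \<open>the first formula for \<open>m\<close> and \<open>\<beta>\<close> in place of \<open>k\<close> and \<open>\<alpha>\<close> has the same exponent \<open>s\<close>\<close>
    let ?\<beta> = "\<alpha> + of_nat m - of_nat k" and ?c' = "frame_moment (n - m) m m s"
    have \<alpha>': "Re \<alpha> > real m - 1" and \<beta>: "Re ?\<beta> > real m - 1" and s\<beta>: "s = (?\<beta> - of_nat m) / 2"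
      using \<alpha> mk by (auto simp: s_def)
    note id = funk_cosine_identity[OF mk km f \<alpha>' s_def] and id' = funk_cosine_identity[OF order_refl mm(2) f \<beta> s\<beta>]
    have ci: "integrable ?V (\<lambda>v. ?c * sine_transform n m s f v)"
      using id(1) by (intro integrable_mult_right)
    have dc: "?d * ?c' = ?c"
    proof -
      have eqs: "of_nat m / 2 + s = ?\<beta> / 2" "of_nat (n - m) / 2 + s = (\<alpha> + of_nat n - of_nat m - of_nat k) / 2"
        using m by (simp_all add: s_def of_nat_diff field_simps)
      have c': "?c' = Gamma_m m (of_nat (n - m) / 2) * Gamma_m m (?\<beta> / 2)
          / (Gamma_m m (of_nat m / 2) * Gamma_m m ((\<alpha> + of_nat n - of_nat m - of_nat k) / 2))"
        unfolding frame_moment_Gamma[OF order_refl mn] eqs ..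
      have "Gamma_m m (of_nat m / 2) \<noteq> 0" "Gamma_m m (?\<beta> / 2) \<noteq> 0"
        using \<beta> by (auto intro!: Gamma_m_nonzero)
      then show ?thesis unfolding c' c_eq by (simp add: field_simps)
    qed
    have M_eq: "?M v = dual_cosine_transform n m m ?\<beta> (funk n m m f) v" if "v \<in> space ?V" for v
      using that by (intro M_transform_eq[OF m]) (simp add: space_stiefel_measure[OF m])
    show ?thesis
    proof (rule eq_L1_cong[OF ci id(3) _ id(5)])
      have "?M \<in> borel_measurable ?V"
        using id'(2) by (subst measurable_cong[OF M_eq])
      then show "(\<lambda>v. ?d * ?M v) \<in> borel_measurable ?V"
        by (intro borel_measurable_times borel_measurable_const)
      show "AE v in ?V. ?d * ?M v = ?c * sine_transform n m s f v"
        using id'(4) AE_space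
      proof eventually_elim
        case (elim v)
        show ?case unfolding M_eq[OF elim(2)] elim(1) dc[symmetric] by (simp only: mult.assoc)
      qed
    qed
  qed
  have "Re \<alpha> > real m - 1" if "Re \<alpha> > real k - 1"
    using that mk by simp
  then show ?thesis
    using main Q M unfolding c_eq by blast
qed

end
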